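(* Let $q=p_1^{r_1}\cdots p_t^{r_t}$ be an odd number, where $t\ge 1$, $p_1,\ldots,p_t$ are distinct odd primes and $r_i\ge1$, and let $n=\sum_{i=1}^tp_i^{r_i}$. Let $\Gamma_q\le B_n/[P_n,P_n]$ be the Bieberbach group defined in the context, with holonomy group $\mathbb{Z}_q$ generated by $\theta$ and holonomy representation $\psi_q\colon\mathbb{Z}_q\to\operatorname{Aut}\left(\mathbb{Z}^{\frac{n(n-1)}{2}}\right)$, and let $\mathcal{B}$ be the ordered basis of the free abelian group $L=\mathbb{Z}^{\frac{n(n-1)}{2}}$ described in the context. Then the matrix of $\psi_q(\theta)$ with respect to $\mathcal{B}$ (images of basis vectors as columns) is $$[\psi_q(\theta)]_{\mathcal{B}}=\bigoplus_{1\le j\le t}\left(\mathcal{N}_{p_j^{r_j}}[q]\oplus\left[\bigoplus_{1\le h\le\frac{p_j^{r_j}-3}{2}}\mathcal{M}_{p_j^{r_j}}\right]\right)\oplus\left(\bigoplus_{1\le j<h\le t}\mathcal{M}_{p_j^{r_j}p_h^{r_h}}\right),$$ which in the case $q=3$ has the form $[\psi_3(\theta)]_{\mathcal{B}}=\mathcal{N}_3[3]$. The characteristic polynomial of $[\psi_q(\theta)]_{\mathcal{B}}$ is $$\prod_{1\le j\le t}\left(x^{p_j^{r_j}}-1\right)^{\frac{p_j^{r_j}-1}{2}}\cdot\prod_{1\le j<h\le t}\left(x^{p_j^{r_j}p_h^{r_h}}-1\right).$$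
   Context: $B_n$ is the Artin braid group with standard generators $\sigma_1,\ldots,\sigma_{n-1}$, $P_n$ is the pure braid group (kernel of $\sigma\colon B_n\to S_n$, $\sigma_i\mapsto(i,\,i+1)$), $[P_n,P_n]$ its commutator subgroup, and $\overline\sigma\colon B_n/[P_n,P_n]\to S_n$ is induced by $\sigma$. Permutations are composed from left to right. For $1\le i<j\le n$, $A_{i,j}=\sigma_{j-1}\cdots\sigma_{i+1}\sigma_i^2\sigma_{i+1}^{-1}\cdots\sigma_{j-1}^{-1}$; the same symbol denotes its class in $B_n/[P_n,P_n]$. The classes $A_{i,j}$ form a basis of the free abelian group $P_n/[P_n,P_n]\cong\mathbb{Z}^{n(n-1)/2}$. Definition of $\Gamma_q$: put $n_0=0$, $n_l=\sum_{i=1}^l p_i^{r_i}$ (so $n=n_t$). For $0\le l\le t-1$, with $m=p_{l+1}^{r_{l+1}}$, let $$\delta_{n_l,m}=\sigma_{n_l+m-1}\cdots\sigma_{n_l+\frac{m+1}{2}}\,\sigma_{n_l+\frac{m-1}{2}}^{-1}\cdots\sigma_{n_l+1}^{-1}\in B_n/[P_n,P_n].$$ $\Gamma_q$ is the subgroup of $B_n/[P_n,P_n]$ generated by $A_{n_l+1,n_l+2}\,\delta_{n_l,p_{l+1}^{r_{l+1}}}$ for $0\le l\le t-1$ together with $A_{a,b}^{q}$ for $1\le a<b\le n$. It is a Bieberbach group (torsion-free crystallographic group) of dimension $n(n-1)/2$ with holonomy group $\overline\sigma(\Gamma_q)\cong\mathbb{Z}_q$, and $L=\Gamma_q\cap P_n/[P_n,P_n]$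 is its translation lattice, free abelian of rank $n(n-1)/2$. Let $\delta=\prod_{0\le l\le t-1}\delta_{n_l,p_{l+1}^{r_{l+1}}}$ (the factors commute) and $\theta=\overline\sigma(\delta)$, a generator of $\mathbb{Z}_q$. The holonomy representation $\psi_q$ is the action on $L$ induced by conjugation: $\psi_q(\theta)(x)=gxg^{-1}$ for any $g\in\Gamma_q$ with $\overline\sigma(g)=\theta$; equivalently $\psi_q(\theta)(x)=\delta x\delta^{-1}$. Ordered basis $\mathcal{B}$ of $L$: it consists of - for $1\le j\le t$: $e_{j,0,1}=\left(A_{n_{j-1}+1,n_{j-1}+2}\,\delta_{n_{j-1},p_j^{r_j}}\right)^{p_j^{r_j}}$, and $e_{j,0,k+1}=\delta^{k-1}A_{n_{j-1}+2,n_{j-1}+3}^{q}\delta^{-(k-1)}$ for $1\le k\le p_j^{r_j}-1$; - for $1\le j\le t$, $1\le h\le\frac{p_j^{r_j}-3}{2}$, $1\le k\le p_j^{r_j}$: $e_{j,h,k}=\delta^{k-1}A_{n_{j-1}+1,n_{j-1}+h+2}^{q}\delta^{-(k-1)}$; - for $1\le j<h\le t$, $1\le k\le p_j^{r_j}p_h^{r_h}$: $e_{t+j,t+h,k}=\delta^{k-1}A_{n_{j-1}+1,n_{h-1}+1}^{q}\delta^{-(k-1)}$, ordered lexicographically by the triple of indices. For $z\geq 3$, $\mathcal{N}_z[q]$ and $\mathcal{M}_z$ are the $z\times z$ matrices whose columns are as follows ($\epsilon_i$ denoting the standard basis column vectors). $\mathcal{N}_z[q]$: first column $\epsilon_1$;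 $i$-th column $\epsilon_{i+1}$ for $2\le i\le z-1$; last column $q\epsilon_1-\epsilon_2-\epsilon_3-\cdots-\epsilon_z$. $\mathcal{M}_z$: $i$-th column $\epsilon_{i+1}$ for $1\le i\le z-1$; last column $\epsilon_1$. $\bigoplus$ denotes block-diagonal sum. *)

theory Defs
  imports
    "HOL-Algebra.Sym_Groups"
    "Jordan_Normal_Form.Char_Poly"
begin

section \<open>Group presentations\<close>

text \<open>The letter \<open>(x, True)\<close> stands for the generator \<open>x\<close> and \<open>(x, False)\<close> for its inverse.\<close>

type_synonym 'a word = "('a \<times> bool) list"

definition words :: "'a set \<Rightarrow> 'a word set" where
  "words S = lists (S \<times> UNIV)"

text \<open>The congruence on words over \<open>S\<close> generated by free cancellation and by the defining
  relations \<open>R\<close>, where a pair \<open>(u, v)\<close> stands for the relation \<open>u = v\<close>.\<close>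

inductive pres_eq :: "'a set \<Rightarrow> ('a word \<times> 'a word) set \<Rightarrow> 'a word \<Rightarrow> 'a word \<Rightarrow> bool"
  for S R where
  refl: "w \<in> words S \<Longrightarrow> pres_eq S R w w"
| sym: "pres_eq S R u v \<Longrightarrow> pres_eq S R v u"
| trans: "pres_eq S R u v \<Longrightarrow> pres_eq S R v w \<Longrightarrow> pres_eq S R u w"
| append: "pres_eq S R u u' \<Longrightarrow> pres_eq S R v v' \<Longrightarrow> pres_eq S R (u @ v) (u' @ v')"
| cancel: "x \<in> S \<Longrightarrow> pres_eq S R [(x, b), (x, \<not> b)] []"
| relation: "(u, v) \<in> R \<Longrightarrow> u \<in> words S \<Longrightarrow> v \<in> words S \<Longrightarrow> pres_eq S R u v"

definition word_class :: "'a set \<Rightarrow> ('a word \<times> 'a word) set \<Rightarrow> 'a word \<Rightarrow> 'a word set" where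
  "word_class S R w = {v. pres_eq S R w v}"

definition presented_group :: "'a set \<Rightarrow> ('a word \<times> 'a word) set \<Rightarrow> 'a word set monoid" where
  "presented_group S R =
    \<lparr>carrier = word_class S R ` words S,
     mult = (\<lambda>X Y. \<Union>u\<in>X. \<Union>v\<in>Y. word_class S R (u @ v)),
     one = word_class S R []\<rparr>"


section \<open>Braid groups and pure braid groups\<close>

definition braid_relations :: "nat \<Rightarrow> (nat word \<times> nat word) set" where
  "braid_relations n =
    {([(i, True), (j, True)], [(j, True), (i, True)]) | i j. 1 \<le> i \<and> i + 2 \<le> j \<and> j < n} \<union>
    {([(i, True), (i + 1, True), (i, True)], [(i + 1, True), (i, True), (i + 1, True)]) | i.
       1 \<le> i \<and> i + 1 < n}"

definition braid_group :: "nat \<Rightarrow> nat word set monoid" where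
  "braid_group n = presented_group {1..<n} (braid_relations n)"

definition braid_class :: "nat \<Rightarrow> nat word \<Rightarrow> nat word set" where
  "braid_class n w = word_class {1..<n} (braid_relations n) w"

text \<open>Permutations are composed from left to right.\<close>

definition sym_group_lr :: "nat \<Rightarrow> (nat \<Rightarrow> nat) monoid" where
  "sym_group_lr n = (sym_group n)\<lparr>mult := (\<lambda>p q. q \<circ> p)\<rparr>"

primrec word_perm :: "nat word \<Rightarrow> nat \<Rightarrow> nat" where
  "word_perm [] = id"
| "word_perm (x # w) = word_perm w \<circ> transpose (fst x) (fst x + 1)"

definition braid_perm :: "nat word set \<Rightarrow> nat \<Rightarrow> nat" where
  "braid_perm X = the_elem (word_perm ` X)"

definition pure_braids :: "nat \<Rightarrow> nat word set set" where
  "pure_braids n = kernel (braid_group n) (sym_group_lr n) braid_perm"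

definition pure_comm :: "nat \<Rightarrow> nat word set set" where
  "pure_comm n = derived (braid_group n) (pure_braids n)"

text \<open>The group $B_n/[P_n,P_n]$, the class of a word in it, its subgroup $P_n/[P_n,P_n]$, and the
  induced map $\overline\sigma$ to the symmetric group.\<close>

definition braid_quot :: "nat \<Rightarrow> nat word set set monoid" where
  "braid_quot n = braid_group n Mod pure_comm n"

definition quot_class :: "nat \<Rightarrow> nat word \<Rightarrow> nat word set set" where
  "quot_class n w = pure_comm n #>\<^bsub>braid_group n\<^esub> braid_class n w"

definition pure_quot :: "nat \<Rightarrow> nat word set set set" where
  "pure_quot n = (\<lambda>b. pure_comm n #>\<^bsub>braid_group n\<^esub> b) ` pure_braids n"

definition quot_perm :: "nat word set set \<Rightarrow> nat \<Rightarrow> nat" where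
  "quot_perm X = the_elem (braid_perm ` X)"

text \<open>$A_{i,j}=\sigma_{j-1}\cdots\sigma_{i+1}\sigma_i^2\sigma_{i+1}^{-1}\cdots\sigma_{j-1}^{-1}$\<close>

definition pure_gen :: "nat \<Rightarrow> nat \<Rightarrow> nat \<Rightarrow> nat word set set" where
  "pure_gen n i j = quot_class n
    (map (\<lambda>k. (k, True)) (rev [i + 1..<j]) @ [(i, True), (i, True)] @
     map (\<lambda>k. (k, False)) [i + 1..<j])"

text \<open>$\delta_{s,m}=\sigma_{s+m-1}\cdots\sigma_{s+\frac{m+1}2}
  \sigma_{s+\frac{m-1}2}^{-1}\cdots\sigma_{s+1}^{-1}$\<close>

definition delta_block :: "nat \<Rightarrow> nat \<Rightarrow> nat \<Rightarrow> nat word set set" where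
  "delta_block n s m = quot_class n
    (map (\<lambda>k. (k, True)) (rev [s + (m + 1) div 2..<s + m]) @
     map (\<lambda>k. (k, False)) (rev [s + 1..<s + (m - 1) div 2 + 1]))"


section \<open>The Bieberbach groups and their holonomy representations\<close>

text \<open>Below, \<open>m j\<close> is the prime power $p_j^{r_j}$ for $1\le j\le t$, \<open>q\<close> is the product and
  \<open>n\<close> is the sum of these prime powers.\<close>

definition block_start :: "(nat \<Rightarrow> nat) \<Rightarrow> nat \<Rightarrow> nat" where
  "block_start m l = (\<Sum>i=1..l. m i)"

definition twisted_delta :: "nat \<Rightarrow> (nat \<Rightarrow> nat) \<Rightarrow> nat \<Rightarrow> nat word set set" where
  "twisted_delta n m l =
    pure_gen n (block_start m l + 1) (block_start m l + 2) \<otimes>\<^bsub>braid_quot n\<^esub>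
    delta_block n (block_start m l) (m (l + 1))"

definition Gamma :: "nat \<Rightarrow> nat \<Rightarrow> nat \<Rightarrow> (nat \<Rightarrow> nat) \<Rightarrow> nat word set set set" where
  "Gamma n q t m = generate (braid_quot n)
    ({twisted_delta n m l | l. l < t} \<union>
     {pure_gen n a b [^]\<^bsub>braid_quot n\<^esub> q | a b. 1 \<le> a \<and> a < b \<and> b \<le> n})"

definition translation_lattice :: "nat \<Rightarrow> nat \<Rightarrow> nat \<Rightarrow> (nat \<Rightarrow> nat) \<Rightarrow> nat word set set monoid" where
  "translation_lattice n q t m = (braid_quot n)\<lparr>carrier := Gamma n q t m \<inter> pure_quot n\<rparr>"

definition delta :: "nat \<Rightarrow> nat \<Rightarrow> (nat \<Rightarrow> nat) \<Rightarrow> nat word set set" where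
  "delta n t m = foldr (mult (braid_quot n))
    (map (\<lambda>l. delta_block n (block_start m l) (m (l + 1))) [0..<t]) \<one>\<^bsub>braid_quot n\<^esub>"

definition theta :: "nat \<Rightarrow> nat \<Rightarrow> (nat \<Rightarrow> nat) \<Rightarrow> nat \<Rightarrow> nat" where
  "theta n t m = quot_perm (delta n t m)"

text \<open>Conjugation by a lift of the holonomy element \<open>s\<close>. As the translation lattice is
  commutative, the lift chosen is irrelevant.\<close>

definition holonomy_rep ::
  "nat \<Rightarrow> nat \<Rightarrow> nat \<Rightarrow> (nat \<Rightarrow> nat) \<Rightarrow> (nat \<Rightarrow> nat) \<Rightarrow> nat word set set \<Rightarrow> nat word set set" where
  "holonomy_rep n q t m s x =
    (let g = (SOME g. g \<in> Gamma n q t m \<and> quot_perm g = s)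
     in g \<otimes>\<^bsub>braid_quot n\<^esub> x \<otimes>\<^bsub>braid_quot n\<^esub> inv\<^bsub>braid_quot n\<^esub> g)"


section \<open>Ordered bases of free abelian groups, and matrices\<close>

text \<open>The groups are written multiplicatively.\<close>

definition int_comb :: "('a, 'b) monoid_scheme \<Rightarrow> 'a list \<Rightarrow> int vec \<Rightarrow> 'a" where
  "int_comb G bs c = (\<Otimes>\<^bsub>G\<^esub>i\<in>{..<length bs}. (bs ! i) [^]\<^bsub>G\<^esub> (c $ i))"

definition ordered_basis :: "('a, 'b) monoid_scheme \<Rightarrow> 'a list \<Rightarrow> bool" where
  "ordered_basis G bs \<longleftrightarrow> comm_group G \<and> set bs \<subseteq> carrier G \<and>
    (\<forall>x\<in>carrier G. \<exists>!c. c \<in> carrier_vec (length bs) \<and> int_comb G bs c = x)"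

definition coordinates :: "('a, 'b) monoid_scheme \<Rightarrow> 'a list \<Rightarrow> 'a \<Rightarrow> int vec" where
  "coordinates G bs x = (THE c. c \<in> carrier_vec (length bs) \<and> int_comb G bs c = x)"

definition matrix_wrt :: "('a, 'b) monoid_scheme \<Rightarrow> 'a list \<Rightarrow> ('a \<Rightarrow> 'a) \<Rightarrow> int mat" where
  "matrix_wrt G bs f = mat_of_cols (length bs) (map (\<lambda>b. coordinates G bs (f b)) bs)"


section \<open>The basis of the translation lattice\<close>

definition delta_conj :: "nat \<Rightarrow> nat \<Rightarrow> (nat \<Rightarrow> nat) \<Rightarrow> nat \<Rightarrow> nat word set set \<Rightarrow> nat word set set" where
  "delta_conj n t m k x =
    delta n t m [^]\<^bsub>braid_quot n\<^esub> k \<otimes>\<^bsub>braid_quot n\<^esub> x \<otimes>\<^bsub>braid_quot n\<^esub>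
    inv\<^bsub>braid_quot n\<^esub> (delta n t m [^]\<^bsub>braid_quot n\<^esub> k)"

text \<open>The elements $e_{j,0,1}$, then $e_{j,0,k+1}$ for $1\le k\le m_j-1$, then $e_{j,h,k}$ for
  $h\ge1$, and finally $e_{t+j,t+h,k}$.\<close>

definition basis_fixed :: "nat \<Rightarrow> (nat \<Rightarrow> nat) \<Rightarrow> nat \<Rightarrow> nat word set set" where
  "basis_fixed n m j = twisted_delta n m (j - 1) [^]\<^bsub>braid_quot n\<^esub> m j"

definition basis_adjacent ::
  "nat \<Rightarrow> nat \<Rightarrow> nat \<Rightarrow> (nat \<Rightarrow> nat) \<Rightarrow> nat \<Rightarrow> nat \<Rightarrow> nat word set set" where
  "basis_adjacent n q t m j k = delta_conj n t m (k - 1)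
    (pure_gen n (block_start m (j - 1) + 2) (block_start m (j - 1) + 3) [^]\<^bsub>braid_quot n\<^esub> q)"

definition basis_inner ::
  "nat \<Rightarrow> nat \<Rightarrow> nat \<Rightarrow> (nat \<Rightarrow> nat) \<Rightarrow> nat \<Rightarrow> nat \<Rightarrow> nat \<Rightarrow> nat word set set" where
  "basis_inner n q t m j h k = delta_conj n t m (k - 1)
    (pure_gen n (block_start m (j - 1) + 1) (block_start m (j - 1) + h + 2) [^]\<^bsub>braid_quot n\<^esub> q)"

definition basis_cross ::
  "nat \<Rightarrow> nat \<Rightarrow> nat \<Rightarrow> (nat \<Rightarrow> nat) \<Rightarrow> nat \<Rightarrow> nat \<Rightarrow> nat \<Rightarrow> nat word set set" where
  "basis_cross n q t m j h k = delta_conj n t m (k - 1)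
    (pure_gen n (block_start m (j - 1) + 1) (block_start m (h - 1) + 1) [^]\<^bsub>braid_quot n\<^esub> q)"

definition lattice_basis :: "nat \<Rightarrow> nat \<Rightarrow> nat \<Rightarrow> (nat \<Rightarrow> nat) \<Rightarrow> nat word set set list" where
  "lattice_basis n q t m =
    concat (map (\<lambda>j.
      basis_fixed n m j # map (basis_adjacent n q t m j) [1..<m j] @
      concat (map (\<lambda>h. map (basis_inner n q t m j h) [1..<m j + 1]) [1..<(m j - 3) div 2 + 1]))
      [1..<t + 1]) @
    concat (map (\<lambda>j. concat (map (\<lambda>h. map (basis_cross n q t m j h) [1..<m j * m h + 1])
      [j + 1..<t + 1])) [1..<t + 1])"


section \<open>The matrices\<close>

text \<open>Indices of vectors start at 0, so that the $i$-th standard basis vector $\epsilon_i$ is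
  \<open>unit_vec z (i - 1)\<close>.\<close>

definition N_mat :: "nat \<Rightarrow> nat \<Rightarrow> int mat" where
  "N_mat z q = mat_of_cols z
    ([unit_vec z 0] @ map (\<lambda>i. unit_vec z i) [2..<z] @
     [vec z (\<lambda>r. if r = 0 then int q else - 1)])"

definition M_mat :: "nat \<Rightarrow> int mat" where
  "M_mat z = mat_of_cols z (map (\<lambda>i. unit_vec z i) [1..<z] @ [unit_vec z 0])"

definition holonomy_mat :: "nat \<Rightarrow> nat \<Rightarrow> (nat \<Rightarrow> nat) \<Rightarrow> int mat" where
  "holonomy_mat q t m = diag_block_mat
    (concat (map (\<lambda>j. N_mat (m j) q # map (\<lambda>h. M_mat (m j)) [1..<(m j - 3) div 2 + 1])
       [1..<t + 1]) @
     concat (map (\<lambda>j. map (\<lambda>h. M_mat (m j * m h)) [j + 1..<t + 1]) [1..<t + 1]))"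

end

theory Submission
  imports Defs "HOL-Algebra.Elementary_Groups" "HOL-Number_Theory.Cong"
begin

text \<open>The group $Q = B_n/[P_n,P_n]$ is computed by counting crossings. To a braid belong its permutation
and, for each pair of strands (named by the pair \<open>e\<close> of their starting positions), the number
\<open>lk x e\<close> of their crossings, counted with sign. These numbers form a cocycle,
\<open>lk (x y) e = lk x e + lk y (perm x ` e)\<close>, so they are additive on pure braids and vanish on
$[P_n,P_n]$. An element of $P_n/[P_n,P_n]$ is determined by them (\<open>pure_quot_eqI\<close>), as
$P_n/[P_n,P_n]$ is generated by the $A_{i,j}$ (\<open>pure_quot_generated\<close>), and $A_{i,j}$ counts 2 on
$\{i,j\}$ and 0 on all other pairs. For the generation, note that a conjugate of $\sigma_i^2$ in $Q$
depends only on the permutation of the conjugating braid, because pure braids commute in $Q$; hence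
every such conjugate is some $A_{a,b}$. Modulo the normal subgroup of the $A_{a,b}$ the generators
become involutions, and the Coxeter presentation of the symmetric group (\<open>coxeter_presentation\<close>)
shows that nothing is left of a pure braid. From there on, equations in
$P_n/[P_n,P_n]$ are equations between crossing numbers.

On a block of $m$ strands $\delta$ is a cyclic rotation, and its crossing numbers are a coboundary:
they record how the indicator function of the pairs at distance more than $m/2$ changes. After
subtraction of this coboundary (\<open>rlk\<close>) $\delta$ has no crossings left, and the generator
$A\delta$ of $\Gamma_q$ counts 2 on a single adjacent pair. Powers of $A\delta$ count how often the
rotation carries an adjacent pair over the origin, which is a difference of two floor functions.
Every element of $\Gamma_q$ satisfies the resulting congruences modulo $2q$ (\<open>Gamma_twisted\<close>).
For an element of the lattice they say that its numbers are divisible by $2q$ on non-adjacent pairs,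
and congruent to each other modulo $2q$ on the adjacent pairs of a block.

The proposed basis consists of elements whose numbers are $2q$ on one pair, and, for each block, of
one element whose numbers are 2 on all adjacent pairs. The pairs fall into orbits under $\delta$,
and the basis into lists supported on single orbits. On one orbit the existence and
uniqueness of coordinates are elementary (\<open>supported_basis_indicators\<close>, \<open>supported_basis_cycle\<close>),
and lists with disjoint supports can be joined (\<open>supported_basis_concat\<close>). That the listed orbits
are disjoint and exhaust all pairs follows from their covering all pairs and from having
$n(n-1)/2$ elements in total (\<open>orbit_pair_bij\<close>). Conjugation by $\delta$ moves each
pair of an orbit to the next one; this gives the blocks $\mathcal{M}$ and $\mathcal{N}$.
Finally, $\mathcal{M}_z$ is the companion matrix of $x^z-1$, and $\mathcal{N}_z$ is block triangular with
diagonal blocks 1 and the companion matrix of $1+x+\cdots+x^{z-1}$.\<close>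


section \<open>Groups given by presentations\<close>

lemma words_append [simp]: "u @ v \<in> words S \<longleftrightarrow> u \<in> words S \<and> v \<in> words S"
  by (auto simp: words_def)

lemma words_Nil [simp]: "[] \<in> words S"
  by (simp add: words_def)

lemma words_Cons [simp]: "x # w \<in> words S \<longleftrightarrow> fst x \<in> S \<and> w \<in> words S"
  by (cases x) (auto simp: words_def)

definition word_inverse :: "'a word \<Rightarrow> 'a word" where
  "word_inverse w = rev (map (\<lambda>(x, b). (x, \<not> b)) w)"

lemma word_inverse_simps [simp]:
  "word_inverse [] = []"
  "word_inverse ((x, b) # w) = word_inverse w @ [(x, \<not> b)]"
  by (simp_all add: word_inverse_def)

lemma word_inverse_in_words [simp]: "w \<in> words S \<Longrightarrow> word_inverse w \<in> words S"
  by (induction w) auto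

lemma pres_eq_words: "pres_eq S R u v \<Longrightarrow> u \<in> words S \<and> v \<in> words S"
  by (induction rule: pres_eq.induct) auto

lemma word_class_eq_iff:
  assumes "u \<in> words S"
  shows "word_class S R u = word_class S R v \<longleftrightarrow> pres_eq S R u v"
proof
  assume "word_class S R u = word_class S R v"
  moreover have "u \<in> word_class S R u"
    using assms by (simp add: word_class_def pres_eq.refl)
  ultimately show "pres_eq S R u v"
    by (auto simp: word_class_def intro: pres_eq.sym)
next
  assume "pres_eq S R u v"
  then show "word_class S R u = word_class S R v"
    unfolding word_class_def by (blast intro: pres_eq.sym pres_eq.trans)
qed

lemma presented_group_mult:
  assumes "u \<in> words S" "v \<in> words S"
  shows "word_class S R u \<otimes>\<^bsub>presented_group S R\<^esub> word_class S R v = word_class S R (u @ v)"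
proof -
  have "word_class S R (u' @ v') = word_class S R (u @ v)"
    if "pres_eq S R u u'" "pres_eq S R v v'" for u' v'
  proof (subst word_class_eq_iff)
    show "u' @ v' \<in> words S"
      using that by (auto dest: pres_eq_words)
    show "pres_eq S R (u' @ v') (u @ v)"
      using that by (rule pres_eq.sym[OF pres_eq.append])
  qed
  then have "word_class S R (u' @ v') = word_class S R (u @ v)"
    if "u' \<in> word_class S R u" "v' \<in> word_class S R v" for u' v'
    using that by (simp add: word_class_def)
  moreover have "word_class S R u \<noteq> {}" "word_class S R v \<noteq> {}"
    using assms by (auto simp: word_class_def intro: pres_eq.refl)
  ultimately have "(\<Union>u'\<in>word_class S R u. \<Union>v'\<in>word_class S R v. word_class S R (u' @ v')) =
      word_class S R (u @ v)"
    by (subst SUP_cong[OF HOL.refl SUP_cong[OF HOL.refl]]) auto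
  then show ?thesis
    by (simp add: presented_group_def)
qed

lemma pres_eq_word_inverse: "w \<in> words S \<Longrightarrow> pres_eq S R (word_inverse w @ w) []"
proof (induction w)
  case (Cons a w)
  obtain x b where a: "a = (x, b)" by force
  have "pres_eq S R (word_inverse w @ [(x, \<not> b), (x, b)] @ w) (word_inverse w @ [] @ w)"
    using Cons.prems pres_eq.cancel[of x S R "\<not> b"]
    by (intro pres_eq.append pres_eq.refl) (auto simp: a)
  then show ?case
    using Cons by (auto simp: a intro: pres_eq.trans)
qed (auto intro: pres_eq.refl)

lemma group_presented_group: "group (presented_group S R)"
proof (rule groupI)
  let ?G = "presented_group S R"
  have car: "carrier ?G = word_class S R ` words S" and one: "\<one>\<^bsub>?G\<^esub> = word_class S R []"
    by (simp_all add: presented_group_def)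
  show "x \<otimes>\<^bsub>?G\<^esub> y \<in> carrier ?G" if "x \<in> carrier ?G" "y \<in> carrier ?G" for x y
    using that by (auto simp: car presented_group_mult)
  show "\<one>\<^bsub>?G\<^esub> \<in> carrier ?G"
    by (simp add: car one)
  show "x \<otimes>\<^bsub>?G\<^esub> y \<otimes>\<^bsub>?G\<^esub> z = x \<otimes>\<^bsub>?G\<^esub> (y \<otimes>\<^bsub>?G\<^esub> z)"
    if "x \<in> carrier ?G" "y \<in> carrier ?G" "z \<in> carrier ?G" for x y z
    using that by (auto simp: car presented_group_mult)
  show "\<one>\<^bsub>?G\<^esub> \<otimes>\<^bsub>?G\<^esub> x = x" if "x \<in> carrier ?G" for x
    using that by (auto simp: car one presented_group_mult)
  show "\<exists>y\<in>carrier ?G. y \<otimes>\<^bsub>?G\<^esub> x = \<one>\<^bsub>?G\<^esub>" if x: "x \<in> carrier ?G" for x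
  proof -
    obtain w where w: "w \<in> words S" "x = word_class S R w"
      using x by (auto simp: car)
    then have "word_class S R (word_inverse w @ w) = word_class S R []"
      by (subst word_class_eq_iff) (auto intro: pres_eq_word_inverse)
    with w show ?thesis
      by (intro bexI[of _ "word_class S R (word_inverse w)"]) (auto simp: car one presented_group_mult)
  qed
qed


section \<open>Permutations and linking numbers of braid words\<close>

lemma word_perm_append: "word_perm (u @ v) = word_perm v \<circ> word_perm u"
  by (induction u) (auto simp: fun_eq_iff)

lemma bij_word_perm: "bij (word_perm w)"
proof (induction w)
  case (Cons x w)
  then show ?case
    unfolding word_perm.simps by (intro bij_comp) auto
qed (simp only: word_perm.simps bij_id)

lemma word_perm_permutes: "w \<in> words {1..<n} \<Longrightarrow> word_perm w permutes {1..n}"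
proof (induction w)
  case (Cons x w)
  then show ?case
    unfolding word_perm.simps by (intro permutes_compose permutes_swap_id) auto
qed (simp only: word_perm.simps permutes_id)

text \<open>The signed number of crossings of the two strands that start at the positions in \<open>e\<close>. Unordered pairs
are sets here, so that a permutation acts on them by taking images.\<close>

primrec linking :: "nat word \<Rightarrow> nat set \<Rightarrow> int" where
  "linking [] e = 0"
| "linking (x # w) e =
    (if e = {fst x, fst x + 1} then if snd x then 1 else - 1 else 0) +
    linking w (transpose (fst x) (fst x + 1) ` e)"

lemma linking_append: "linking (u @ v) e = linking u e + linking v (word_perm u ` e)"
  by (induction u arbitrary: e) (auto simp: image_comp o_def)

lemma transpose_image_eq_iff: "transpose a b ` X = Y \<longleftrightarrow> X = transpose a b ` Y"
  by (auto simp: image_image)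

lemma linking_far_commute:
  assumes "i + 2 \<le> j"
  shows "linking [(i, True), (j, True)] = linking [(j, True), (i, True)]"
proof
  fix e :: "nat set"
  have "transpose i (i + 1) ` e = {j, j + 1} \<longleftrightarrow> e = {j, j + 1}"
    "transpose j (j + 1) ` e = {i, i + 1} \<longleftrightarrow> e = {i, i + 1}"
    unfolding transpose_image_eq_iff using assms by (simp_all add: transpose_def)
  then show "linking [(i, True), (j, True)] e = linking [(j, True), (i, True)] e"
    by simp
qed

lemma linking_braid_relation:
  "linking [(i, True), (i + 1, True), (i, True)] = linking [(i + 1, True), (i, True), (i + 1, True)]"
proof
  fix e :: "nat set"
  let ?s = "transpose i (i + 1)" and ?t = "transpose (i + 1) (i + 2)"
  have s: "?s ` e = {i + 1, i + 2} \<longleftrightarrow> e = {i, i + 2}" "?t ` e = {i, i + 1} \<longleftrightarrow> e = {i, i + 2}"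
    "?t ` ?s ` e = {i, i + 1} \<longleftrightarrow> e = {i + 1, i + 2}" "?s ` ?t ` e = {i + 1, i + 2} \<longleftrightarrow> e = {i, i + 1}"
    unfolding transpose_image_eq_iff by (auto simp add: transpose_def)
  show "linking [(i, True), (i + 1, True), (i, True)] e = linking [(i + 1, True), (i, True), (i + 1, True)] e"
    using s by (simp add: numeral_2_eq_2)
qed

text \<open>On both sides of a braid relation each two of the strands involved cross equally often, in a
different order.\<close>

lemma pres_eq_invariant:
  assumes "pres_eq {1..<n} (braid_relations n) u v"
  shows "word_perm u = word_perm v \<and> linking u = linking v"
  using assms
proof (induction rule: pres_eq.induct)
  case (append u u' v v')
  then show ?case
    by (auto simp: word_perm_append linking_append fun_eq_iff)
next
  case (cancel x b)
  have "transpose x (x + 1) ` e = {x, x + 1} \<longleftrightarrow> e = {x, x + 1}" for e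
    unfolding transpose_image_eq_iff by auto
  then show ?case
    by (auto simp: fun_eq_iff)
next
  case (relation u v)
  then consider (far) i j where "i + 2 \<le> j" "u = [(i, True), (j, True)]" "v = [(j, True), (i, True)]"
    | (near) i where "u = [(i, True), (i + 1, True), (i, True)]" "v = [(i + 1, True), (i, True), (i + 1, True)]"
    unfolding braid_relations_def by blast
  then show ?case
  proof cases
    case far
    moreover have "word_perm u = word_perm v"
      using far by (auto simp: fun_eq_iff transpose_def)
    moreover have "linking u = linking v"
      unfolding far(2,3) by (rule linking_far_commute) (fact far(1))
    ultimately show ?thesis
      by blast
  next
    case near
    moreover have "word_perm u = word_perm v"
      using near by (auto simp: fun_eq_iff transpose_def)
    moreover have "linking u = linking v"
      unfolding near by (rule linking_braid_relation)
    ultimately show ?thesis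
      by blast
  qed
qed auto


section \<open>The quotient of the braid group by the commutators of pure braids\<close>

lemma word_perm_word_inverse: "word_perm (word_inverse w) = inv_into UNIV (word_perm w)"
proof (induction w)
  case (Cons x w)
  obtain a b where x: "x = (a, b)" by force
  have "inv_into UNIV (word_perm w \<circ> transpose a (a + 1)) =
      transpose a (a + 1) \<circ> inv_into UNIV (word_perm w)"
    by (subst o_inv_distrib) (auto simp: bij_word_perm)
  then show ?case
    using Cons by (simp only: x word_inverse_simps word_perm_append word_perm.simps fst_conv o_id id_o)
qed (simp add: id_def)

lemma group_sym_group_lr: "group (sym_group_lr n)"
proof -
  interpret S: group "sym_group n" by (rule sym_group_is_group)
  show ?thesis
    using S.m_assoc S.l_inv_ex S.r_inv_ex
    by (intro groupI) (auto simp: sym_group_lr_def sym_group_def permutes_compose comp_assoc permutes_id)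
qed

locale braid_quotient =
  fixes n :: nat
begin

text \<open>Letters are indexed by \<open>{1..<n}\<close>, and neighbours are written \<open>i + 1\<close>; this form should survive
  simplification.\<close>

declare One_nat_def [simp del]

abbreviation "W \<equiv> words {1..<n}"
abbreviation "B \<equiv> braid_group n"
abbreviation "Q \<equiv> braid_quot n"
abbreviation "cls \<equiv> quot_class n"

lemma carrier_B: "carrier B = braid_class n ` W"
  by (simp add: braid_group_def presented_group_def braid_class_def fun_eq_iff)

lemma one_B: "\<one>\<^bsub>B\<^esub> = braid_class n []"
  by (simp add: braid_group_def presented_group_def braid_class_def)

lemma mult_B: "u \<in> W \<Longrightarrow> v \<in> W \<Longrightarrow> braid_class n u \<otimes>\<^bsub>B\<^esub> braid_class n v = braid_class n (u @ v)"
  by (simp add: braid_group_def presented_group_mult braid_class_def)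

lemma braid_class_eq_iff:
  "u \<in> W \<Longrightarrow> braid_class n u = braid_class n v \<longleftrightarrow> pres_eq {1..<n} (braid_relations n) u v"
  by (simp add: braid_class_def word_class_eq_iff)

lemma braid_class_eq_invariant:
  "u \<in> W \<Longrightarrow> braid_class n u = braid_class n v \<Longrightarrow> word_perm u = word_perm v \<and> linking u = linking v"
  by (simp add: braid_class_eq_iff pres_eq_invariant)

sublocale B: group B
  by (simp add: braid_group_def group_presented_group)

lemma inv_B: "w \<in> W \<Longrightarrow> inv\<^bsub>B\<^esub> braid_class n w = braid_class n (word_inverse w)"
  by (rule B.inv_equality)
    (auto simp: mult_B one_B carrier_B braid_class_eq_iff pres_eq_word_inverse)

lemma braid_perm_class: 
  assumes "w \<in> W"
  shows "braid_perm (braid_class n w) = word_perm w"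
proof -
  have "word_perm ` braid_class n w = {word_perm w}"
    using assms pres_eq_invariant
    by (force simp: braid_class_def word_class_def intro: pres_eq.refl)
  then show ?thesis by (simp add: braid_perm_def)
qed

sublocale perm: group_hom B "sym_group_lr n" braid_perm
proof (intro group_hom.intro group_hom_axioms.intro homI)
  show "group B" ..
  show "group (sym_group_lr n)" by (rule group_sym_group_lr)
  show "braid_perm x \<in> carrier (sym_group_lr n)" if "x \<in> carrier B" for x
    using that word_perm_permutes
    by (auto simp: carrier_B braid_perm_class sym_group_lr_def sym_group_def)
  show "braid_perm (x \<otimes>\<^bsub>B\<^esub> y) = braid_perm x \<otimes>\<^bsub>sym_group_lr n\<^esub> braid_perm y"
    if "x \<in> carrier B" "y \<in> carrier B" for x y
    using that
    by (auto simp: carrier_B mult_B braid_perm_class sym_group_lr_def word_perm_append)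
qed

lemma pure_braids_eq: "pure_braids n = braid_class n ` {w \<in> W. word_perm w = id}"
  by (auto simp: pure_braids_def kernel_def carrier_B braid_perm_class sym_group_lr_def
      sym_group_def)

lemma pure_comm_normal: "pure_comm n \<lhd> B"
  unfolding pure_comm_def pure_braids_def
  by (rule B.derived_is_normal[OF perm.normal_kernel])

sublocale Q: group Q
  unfolding braid_quot_def by (rule normal.factorgroup_is_group[OF pure_comm_normal])

abbreviation quot_mult (infixl "\<cdot>" 70) where "x \<cdot> y \<equiv> x \<otimes>\<^bsub>Q\<^esub> y"

lemma carrier_Q: "carrier Q = cls ` W"
  by (simp add: braid_quot_def carrier_FactGroup carrier_B image_image quot_class_def)

lemma quot_class_in_carrier [simp]: "w \<in> W \<Longrightarrow> cls w \<in> carrier Q"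
  by (simp add: carrier_Q)

lemma quot_class_mult: "u \<in> W \<Longrightarrow> v \<in> W \<Longrightarrow> cls u \<cdot> cls v = cls (u @ v)"
  using normal.rcos_sum[OF pure_comm_normal, of "braid_class n u" "braid_class n v"]
  by (simp add: braid_quot_def quot_class_def carrier_B mult_B)

lemma quot_class_one: "\<one>\<^bsub>Q\<^esub> = cls []"
  using normal.axioms(1)[OF pure_comm_normal]
  by (simp add: braid_quot_def quot_class_def B.coset_mult_one subgroup.subset flip: one_B)

lemma quot_class_pres_eq:
  "pres_eq {1..<n} (braid_relations n) u v \<Longrightarrow> cls u = cls v"
  using braid_class_eq_iff[of u v] pres_eq_words[of "{1..<n}" _ u v]
  by (simp add: quot_class_def)

lemma quot_class_inv: "w \<in> W \<Longrightarrow> inv\<^bsub>Q\<^esub> cls w = cls (word_inverse w)"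
  by (rule Q.inv_equality)
    (auto simp: quot_class_mult quot_class_one intro!: quot_class_pres_eq pres_eq_word_inverse)

text \<open>The linking numbers factor through the quotient because on pure braids they are additive:
  the pure braids whose linking numbers vanish form a subgroup that contains all commutators.\<close>

lemma pure_comm_invariant:
  assumes "x \<in> pure_comm n"
  shows "\<exists>w\<in>W. x = braid_class n w \<and> word_perm w = id \<and> linking w = (\<lambda>_. 0)"
proof -
  let ?K = "braid_class n ` {w \<in> W. word_perm w = id \<and> linking w = (\<lambda>_. 0)}"
  have "derived B (pure_braids n) \<subseteq> ?K"
    unfolding derived_def
  proof (rule B.generate_subgroup_incl)
    show "subgroup ?K B"
    proof (rule B.subgroupI)
      show "?K \<subseteq> carrier B" by (auto simp: carrier_B)
      show "?K \<noteq> {}" by (auto intro!: exI[of _ "[]"])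
      show "inv\<^bsub>B\<^esub> x \<in> ?K" if x: "x \<in> ?K" for x
      proof -
        obtain w where w: "w \<in> W" "word_perm w = id" "linking w = (\<lambda>_. 0)" "x = braid_class n w"
          using x by auto
        have "linking (word_inverse w) e = 0" for e
          using linking_append[of w "word_inverse w" e]
            braid_class_eq_invariant[of "w @ word_inverse w" "[]"] w B.r_inv[of x]
          by (auto simp: inv_B mult_B one_B carrier_B)
        moreover have "word_perm (word_inverse w) = id"
          using w by (simp add: word_perm_word_inverse inv_id)
        ultimately show ?thesis
          unfolding w(4) inv_B[OF w(1)] using w(1) by (intro imageI) auto
      qed
      show "x \<otimes>\<^bsub>B\<^esub> y \<in> ?K" if "x \<in> ?K" "y \<in> ?K" for x y
        using that by (auto simp: mult_B word_perm_append linking_append fun_eq_iff intro!: imageI)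
    qed
    show "derived_set B (pure_braids n) \<subseteq> ?K"
    proof clarify
      fix x y assume "x \<in> pure_braids n" "y \<in> pure_braids n"
      then obtain u v where uv: "u \<in> W" "word_perm u = id" "x = braid_class n u"
        "v \<in> W" "word_perm v = id" "y = braid_class n v"
        by (auto simp: pure_braids_eq)
      define w where "w = u @ v @ word_inverse u @ word_inverse v"
      have eq: "x \<otimes>\<^bsub>B\<^esub> y \<otimes>\<^bsub>B\<^esub> inv\<^bsub>B\<^esub> x \<otimes>\<^bsub>B\<^esub> inv\<^bsub>B\<^esub> y = braid_class n w"
        using uv by (simp add: mult_B inv_B w_def)
      have W: "w \<in> W" using uv by (simp add: w_def)
      have "linking (z @ word_inverse z) = (\<lambda>_. 0)" if "z \<in> W" for z
        using that B.r_inv[of "braid_class n z"] braid_class_eq_invariant[of "z @ word_inverse z" "[]"]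
        by (auto simp: inv_B mult_B one_B carrier_B)
      from this[OF uv(1)] this[OF uv(4)]
      have "linking u e + linking (word_inverse u) e = 0" "linking v e + linking (word_inverse v) e = 0" for e
        using uv by (auto simp: linking_append dest: fun_cong[of _ _ e])
      moreover have "linking w e = (linking u e + linking (word_inverse u) e) +
          (linking v e + linking (word_inverse v) e)" for e
        using uv by (simp add: linking_append w_def word_perm_append word_perm_word_inverse inv_id)
      ultimately have "linking w e = 0" for e
        by simp
      then have "linking w = (\<lambda>_. 0)" "word_perm w = id"
        using uv by (auto simp: w_def word_perm_append word_perm_word_inverse inv_id)
      then show "x \<otimes>\<^bsub>B\<^esub> y \<otimes>\<^bsub>B\<^esub> inv\<^bsub>B\<^esub> x \<otimes>\<^bsub>B\<^esub> inv\<^bsub>B\<^esub> y \<in> ?K"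
        using eq W by auto
    qed
  qed
  then show ?thesis
    using assms by (auto simp: pure_comm_def)
qed

lemma quot_class_eq_invariant:
  assumes "u \<in> W" "v \<in> W" "cls u = cls v"
  shows "word_perm u = word_perm v" "linking u = linking v"
proof -
  have sub: "subgroup (pure_comm n) B"
    using pure_comm_normal by (rule normal.axioms(1))
  have "braid_class n u \<in> cls u"
    using assms(1) sub by (simp add: quot_class_def B.rcos_self carrier_B)
  then have "braid_class n u \<in> cls v"
    using assms by simp
  then obtain x where "x \<in> pure_comm n" "braid_class n u = x \<otimes>\<^bsub>B\<^esub> braid_class n v"
    by (auto simp: quot_class_def r_coset_def)
  then obtain w where w: "w \<in> W" "word_perm w = id" "linking w = (\<lambda>_. 0)"
    "braid_class n u = braid_class n (w @ v)"
    using pure_comm_invariant[of x] assms by (auto simp: mult_B)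
  then have "word_perm u = word_perm (w @ v) \<and> linking u = linking (w @ v)"
    using assms by (intro braid_class_eq_invariant) auto
  with w show "word_perm u = word_perm v" "linking u = linking v"
    by (auto simp: word_perm_append linking_append fun_eq_iff)
qed

lemma quot_perm_class:
  assumes "w \<in> W"
  shows "quot_perm (cls w) = word_perm w"
proof -
  have sub: "subgroup (pure_comm n) B"
    using pure_comm_normal by (rule normal.axioms(1))
  have "braid_perm X = word_perm w" if X: "X \<in> cls w" for X
  proof -
    obtain x where x: "x \<in> pure_comm n" "X = x \<otimes>\<^bsub>B\<^esub> braid_class n w"
      using X by (auto simp: quot_class_def r_coset_def)
    then obtain v where v: "v \<in> W" "x = braid_class n v" "word_perm v = id"
      using pure_comm_invariant by blast
    with x assms show ?thesis
      by (simp add: mult_B braid_perm_class word_perm_append)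
  qed
  moreover have "braid_class n w \<in> cls w"
    using sub assms by (simp add: quot_class_def B.rcos_self carrier_B)
  ultimately have "braid_perm ` cls w = {word_perm w}"
    by auto
  then show ?thesis by (simp add: quot_perm_def)
qed

lemma pure_quot_eq: "pure_quot n = cls ` {w \<in> W. word_perm w = id}"
  by (auto simp: pure_quot_def pure_braids_eq quot_class_def)

lemma pure_quot_altdef: "pure_quot n = {x \<in> carrier Q. quot_perm x = id}"
  by (auto simp: pure_quot_eq carrier_Q quot_perm_class)

lemma pure_quot_commute:
  assumes "x \<in> pure_quot n" "y \<in> pure_quot n"
  shows "x \<cdot> y = y \<cdot> x"
proof -
  obtain u v where uv: "u \<in> W" "word_perm u = id" "x = cls u" "v \<in> W" "word_perm v = id" "y = cls v"
    using assms by (auto simp: pure_quot_eq)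
  let ?c = "braid_class n"
  have "?c u \<otimes>\<^bsub>B\<^esub> ?c v \<otimes>\<^bsub>B\<^esub> inv\<^bsub>B\<^esub> ?c u \<otimes>\<^bsub>B\<^esub> inv\<^bsub>B\<^esub> ?c v \<in> pure_comm n"
    unfolding pure_comm_def derived_def
    using uv by (intro generate.incl) (auto simp: pure_braids_eq)
  then have "cls (u @ v @ word_inverse u @ word_inverse v) = \<one>\<^bsub>Q\<^esub>"
    using B.coset_join2[of _ "pure_comm n"] normal.axioms(1)[OF pure_comm_normal] uv
    by (simp add: mult_B inv_B quot_class_def braid_quot_def carrier_B)
  then have "x \<cdot> y \<cdot> inv\<^bsub>Q\<^esub> x \<cdot> inv\<^bsub>Q\<^esub> y = \<one>\<^bsub>Q\<^esub>"
    using uv by (simp add: quot_class_mult quot_class_inv)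
  then have "x \<cdot> y \<cdot> inv\<^bsub>Q\<^esub> (y \<cdot> x) = \<one>\<^bsub>Q\<^esub>"
    using uv by (simp add: Q.inv_mult_group Q.m_assoc)
  then show ?thesis
    using uv Q.inv_solve_right[of "\<one>\<^bsub>Q\<^esub>" "x \<cdot> y" "y \<cdot> x"] by simp
qed

text \<open>By \<open>quot_class_eq_invariant\<close> the choice of a representative is irrelevant.\<close>

definition lk :: "nat word set set \<Rightarrow> nat set \<Rightarrow> int" where
  "lk X = linking (SOME w. w \<in> W \<and> cls w = X)"

lemma lk_class: 
  assumes "w \<in> W"
  shows "lk (cls w) = linking w"
proof -
  have "(SOME v. v \<in> W \<and> cls v = cls w) \<in> W \<and> cls (SOME v. v \<in> W \<and> cls v = cls w) = cls w"
    by (rule someI[of _ w]) (use assms in auto)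
  then show ?thesis
    using quot_class_eq_invariant(2) assms unfolding lk_def by blast
qed

lemma lk_mult:
  "x \<in> carrier Q \<Longrightarrow> y \<in> carrier Q \<Longrightarrow> lk (x \<cdot> y) e = lk x e + lk y (quot_perm x ` e)"
  by (auto simp: carrier_Q quot_class_mult lk_class quot_perm_class linking_append)

lemma quot_perm_mult:
  "x \<in> carrier Q \<Longrightarrow> y \<in> carrier Q \<Longrightarrow> quot_perm (x \<cdot> y) = quot_perm y \<circ> quot_perm x"
  by (auto simp: carrier_Q quot_class_mult quot_perm_class word_perm_append)

lemma quot_perm_permutes: "x \<in> carrier Q \<Longrightarrow> quot_perm x permutes {1..n}"
  by (auto simp: carrier_Q quot_perm_class word_perm_permutes)

lemma quot_perm_one [simp]: "quot_perm \<one>\<^bsub>Q\<^esub> = id"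
  by (simp only: quot_class_one quot_perm_class words_Nil word_perm.simps)

lemma lk_one [simp]: "lk \<one>\<^bsub>Q\<^esub> e = 0"
  by (simp add: quot_class_one lk_class)

lemma quot_perm_inv: 
  assumes "x \<in> carrier Q"
  shows "quot_perm (inv\<^bsub>Q\<^esub> x) = inv_into UNIV (quot_perm x)"
  using assms by (auto simp: carrier_Q quot_class_inv quot_perm_class word_perm_word_inverse)

lemma lk_inv:
  assumes "x \<in> carrier Q"
  shows "lk (inv\<^bsub>Q\<^esub> x) e = - lk x (quot_perm (inv\<^bsub>Q\<^esub> x) ` e)"
  using lk_mult[of "inv\<^bsub>Q\<^esub> x" x e] assms by simp

end


section \<open>The Coxeter presentation of the symmetric group\<close>

text \<open>Since the generators are involutions, words without inverse letters suffice.\<close>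

inductive coxeter_eq :: "nat \<Rightarrow> nat list \<Rightarrow> nat list \<Rightarrow> bool" for n where
  refl: "coxeter_eq n w w"
| sym: "coxeter_eq n u v \<Longrightarrow> coxeter_eq n v u"
| trans [trans]: "coxeter_eq n u v \<Longrightarrow> coxeter_eq n v w \<Longrightarrow> coxeter_eq n u w"
| append: "coxeter_eq n u u' \<Longrightarrow> coxeter_eq n v v' \<Longrightarrow> coxeter_eq n (u @ v) (u' @ v')"
| square: "i \<in> {1..<n} \<Longrightarrow> coxeter_eq n [i, i] []"
| commute: "1 \<le> i \<Longrightarrow> i + 2 \<le> j \<Longrightarrow> j < n \<Longrightarrow> coxeter_eq n [i, j] [j, i]"
| braid: "1 \<le> i \<Longrightarrow> i + 1 < n \<Longrightarrow> coxeter_eq n [i, i + 1, i] [i + 1, i, i + 1]"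

lemma coxeter_eq_mono: "coxeter_eq n u v \<Longrightarrow> n \<le> n' \<Longrightarrow> coxeter_eq n' u v"
proof (induction rule: coxeter_eq.induct)
  case (trans u v w)
  then show ?case by (blast intro: coxeter_eq.trans)
qed (auto intro: coxeter_eq.refl coxeter_eq.sym coxeter_eq.append coxeter_eq.square
    coxeter_eq.commute coxeter_eq.braid[simplified])

abbreviation positive_word :: "nat list \<Rightarrow> nat word" where
  "positive_word \<equiv> map (\<lambda>i. (i, True))"

lemma coxeter_eq_word_perm:
  "coxeter_eq n u v \<Longrightarrow> word_perm (positive_word u) = word_perm (positive_word v)"
proof (induction rule: coxeter_eq.induct)
  case (append u u' v v')
  then show ?case by (simp add: word_perm_append)
qed (auto simp: fun_eq_iff transpose_def)

lemma coxeter_eq_commute_word: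
  assumes "i \<in> {1..<n}" "\<And>j. j \<in> set w \<Longrightarrow> j \<in> {1..<n} \<and> (i + 2 \<le> j \<or> j + 2 \<le> i)"
  shows "coxeter_eq n (w @ [i]) (i # w)"
  using assms(2)
proof (induction w)
  case (Cons j w)
  have "coxeter_eq n ([j] @ (w @ [i])) ([j] @ (i # w))"
    using Cons by (intro coxeter_eq.append coxeter_eq.refl) auto
  also have "[j] @ (i # w) = [j, i] @ w" by simp
  also have "coxeter_eq n ([j, i] @ w) ([i, j] @ w)"
    using Cons.prems[of j] assms(1) coxeter_eq.commute[of j i n]
      coxeter_eq.sym[OF coxeter_eq.commute[of i j n]]
    by (intro coxeter_eq.append coxeter_eq.refl) auto
  finally show ?case by simp
qed (simp add: coxeter_eq.refl)

lemma rev_upt_split: "k \<le> i \<Longrightarrow> i \<le> n \<Longrightarrow> rev [k..<n] = rev [i..<n] @ rev [k..<i]"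
  by (metis rev_append upt_add_eq_append le_add_diff_inverse)

text \<open>The letter \<open>i\<close> moves to the left through the smaller letters, becomes \<open>i - 1\<close> by the braid relation
\<open>i (i - 1) i = (i - 1) i (i - 1)\<close>, and moves on through the larger letters.\<close>

lemma coxeter_eq_shift:
  assumes "1 \<le> k" "k < i" "i < m" "m \<le> n"
  shows "coxeter_eq n (rev [k..<m] @ [i]) ((i - 1) # rev [k..<m])"
proof -
  let ?L = "rev [i + 1..<m]" and ?R = "rev [k..<i - 1]"
  have eq: "rev [k..<m] = ?L @ [i, i - 1] @ ?R"
    using assms rev_upt_split[of k "i + 1" m] rev_upt_split[of k "i - 1" "i + 1"]
    by (simp del: upt_Suc add: upt_conv_Cons)
  have "rev [k..<m] @ [i] = ?L @ [i, i - 1] @ (?R @ [i])"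
    by (simp only: eq append_assoc)
  also have "coxeter_eq n \<dots> (?L @ [i, i - 1] @ (i # ?R))"
    using assms by (intro coxeter_eq.append coxeter_eq.refl coxeter_eq_commute_word) auto
  also have "?L @ [i, i - 1] @ (i # ?R) = ?L @ [i, i - 1, i] @ ?R"
    by simp
  also have "coxeter_eq n \<dots> (?L @ [i - 1, i, i - 1] @ ?R)"
    using coxeter_eq.sym[OF coxeter_eq.braid[of "i - 1" n]] assms
    by (intro coxeter_eq.append coxeter_eq.refl) auto
  also have "\<dots> = (?L @ [i - 1]) @ [i, i - 1] @ ?R"
    by simp
  also have "coxeter_eq n \<dots> (((i - 1) # ?L) @ [i, i - 1] @ ?R)"
    using assms by (intro coxeter_eq.append[OF _ coxeter_eq.refl] coxeter_eq_commute_word) auto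
  also have "\<dots> = (i - 1) # rev [k..<m]"
    by (simp only: eq append.simps)
  finally show ?thesis .
qed

text \<open>The descending words \<open>rev [k..<Suc n]\<close> represent the cosets of the subgroup generated by the first
\<open>n - 1\<close> letters; right multiplication by a letter permutes these cosets.\<close>

lemma coxeter_coset_step:
  assumes "i \<in> {1..<Suc n}" "k \<in> {1..Suc n}"
  shows "\<exists>u k'. set u \<subseteq> {1..<n} \<and> k' \<in> {1..Suc n} \<and>
    coxeter_eq (Suc n) (rev [k..<Suc n] @ [i]) (u @ rev [k'..<Suc n])"
proof -
  consider "i + 1 = k" | "i = k" | "i + 2 \<le> k" | "k < i"
    by linarith
  then show ?thesis
  proof cases
    case 1
    then have "rev [k..<Suc n] @ [i] = [] @ rev [i..<Suc n]"
      using assms by (simp del: upt_Suc add: upt_conv_Cons)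
    then show ?thesis
      using assms by (intro exI[of _ "[]"] exI[of _ i]) (simp add: coxeter_eq.refl)
  next
    case 2
    then have eq: "rev [k..<Suc n] @ [i] = rev [k + 1..<Suc n] @ [i, i]"
      using assms by (simp del: upt_Suc add: upt_conv_Cons)
    have "coxeter_eq (Suc n) (rev [k + 1..<Suc n] @ [i, i]) (rev [k + 1..<Suc n] @ [])"
      using assms by (intro coxeter_eq.append coxeter_eq.refl coxeter_eq.square)
    then show ?thesis
      using assms 2 unfolding eq by (intro exI[of _ "[]"] exI[of _ "k + 1"]) auto
  next
    case 3
    then have "coxeter_eq (Suc n) (rev [k..<Suc n] @ [i]) (i # rev [k..<Suc n])"
      using assms by (intro coxeter_eq_commute_word) auto
    then show ?thesis
      using assms 3 by (intro exI[of _ "[i]"] exI[of _ k]) auto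
  next
    case 4
    then have "coxeter_eq (Suc n) (rev [k..<Suc n] @ [i]) ([i - 1] @ rev [k..<Suc n])"
      using coxeter_eq_shift[of k i "Suc n" "Suc n"] assms by simp
    then show ?thesis
      using assms 4 by (intro exI[of _ "[i - 1]"] exI[of _ k]) auto
  qed
qed

lemma coxeter_normal_form:
  assumes "set w \<subseteq> {1..<Suc n}"
  shows "\<exists>u k. set u \<subseteq> {1..<n} \<and> k \<in> {1..Suc n} \<and> coxeter_eq (Suc n) w (u @ rev [k..<Suc n])"
  using assms
proof (induction w rule: rev_induct)
  case Nil
  show ?case
    by (intro exI[of _ "[]"] exI[of _ "Suc n"]) (simp add: coxeter_eq.refl)
next
  case (snoc i w)
  then obtain u k where u: "set u \<subseteq> {1..<n}" "k \<in> {1..Suc n}"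
    "coxeter_eq (Suc n) w (u @ rev [k..<Suc n])"
    by auto
  obtain u' k' where u': "set u' \<subseteq> {1..<n}" "k' \<in> {1..Suc n}"
    "coxeter_eq (Suc n) (rev [k..<Suc n] @ [i]) (u' @ rev [k'..<Suc n])"
    using coxeter_coset_step[of i n k] snoc.prems u(2) by auto
  have "coxeter_eq (Suc n) (w @ [i]) ((u @ rev [k..<Suc n]) @ [i])"
    using u(3) by (intro coxeter_eq.append coxeter_eq.refl)
  also have "(u @ rev [k..<Suc n]) @ [i] = u @ (rev [k..<Suc n] @ [i])"
    by simp
  also have "coxeter_eq (Suc n) \<dots> (u @ (u' @ rev [k'..<Suc n]))"
    by (rule coxeter_eq.append[OF coxeter_eq.refl u'(3)])
  finally show ?case
    using u u' by (intro exI[of _ "u @ u'"] exI[of _ k']) auto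
qed

lemma word_perm_fixes:
  assumes "\<And>x. x \<in> set w \<Longrightarrow> fst x + 1 < a \<or> a < fst x"
  shows "word_perm w a = a"
  using assms
proof (induction w)
  case (Cons x w)
  from Cons.prems[of x] have "transpose (fst x) (fst x + 1) a = a"
    by (intro transpose_apply_other) auto
  with Cons show ?case by simp
qed simp

lemma word_perm_descending: "k \<le> n \<Longrightarrow> word_perm (positive_word (rev [k..<n])) n = k"
proof (induction "n - k" arbitrary: n)
  case (Suc d)
  then obtain n' where n': "n = Suc n'" "k \<le> n'"
    by (cases n) auto
  then show ?case
    using Suc by (simp add: transpose_def)
qed auto

text \<open>A word for the trivial permutation is rewritten to the empty word: its normal form fixes the
  last point only if the descending tail is empty, and then one generator less is involved.\<close>

theorem coxeter_presentation:
  assumes "set w \<subseteq> {1..<n}" "word_perm (positive_word w) = id"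
  shows "coxeter_eq n w []"
  using assms
proof (induction n arbitrary: w)
  case 0
  then show ?case by (auto intro: coxeter_eq.refl)
next
  case (Suc n)
  obtain u k where u: "set u \<subseteq> {1..<n}" "k \<in> {1..Suc n}"
    "coxeter_eq (Suc n) w (u @ rev [k..<Suc n])"
    using coxeter_normal_form[OF Suc.prems(1)] by blast
  have perm: "word_perm (positive_word (rev [k..<Suc n])) \<circ> word_perm (positive_word u) = id"
    using coxeter_eq_word_perm[OF u(3)] Suc.prems(2) by (simp only: map_append word_perm_append)
  have "word_perm (positive_word u) (Suc n) = Suc n"
    using u(1) by (intro word_perm_fixes) auto
  then have "k = Suc n"
    using fun_cong[OF perm, of "Suc n"] u(2) by (simp del: upt_Suc add: word_perm_descending)
  then have "word_perm (positive_word u) = id" "coxeter_eq (Suc n) w u"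
    using perm u(3) by auto
  with Suc.IH[OF u(1)] show ?case
    by (meson coxeter_eq.trans coxeter_eq_mono le_SucI order_refl)
qed


section \<open>Linking numbers determine the pure braids modulo commutators\<close>

lemma word_inverse_append: "word_inverse (u @ v) = word_inverse v @ word_inverse u"
  by (simp add: word_inverse_def)

lemma word_inverse_positive_rev:
  "word_inverse (positive_word (rev ks)) = map (\<lambda>k. (k, False)) ks"
  by (simp add: word_inverse_def rev_map comp_def)

lemma set_positive_word_in_words [simp]: "positive_word ks \<in> words S \<longleftrightarrow> set ks \<subseteq> S"
  by (induction ks) auto

definition pairs :: "nat \<Rightarrow> nat set set" where
  "pairs n = {e. e \<subseteq> {1..n} \<and> card e = 2}"

lemma pairs_eq: "pairs n = {{a, b} | a b. 1 \<le> a \<and> a < b \<and> b \<le> n}"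
proof (intro equalityI subsetI)
  fix e assume "e \<in> pairs n"
  then obtain x y where "e = {x, y}" "x \<noteq> y" "e \<subseteq> {1..n}"
    unfolding pairs_def card_2_iff by blast
  then have "e = {min x y, max x y} \<and> 1 \<le> min x y \<and> min x y < max x y \<and> max x y \<le> n"
    by (auto simp: min_def max_def)
  then show "e \<in> {{a, b} | a b. 1 \<le> a \<and> a < b \<and> b \<le> n}"
    by blast
qed (auto simp: pairs_def)

lemma finite_pairs [simp]: "finite (pairs n)"
  by (rule finite_subset[of _ "Pow {1..n}"]) (auto simp: pairs_def)

context braid_quotient
begin

definition conj_square :: "nat word \<Rightarrow> nat \<Rightarrow> nat word set set" where
  "conj_square u i = cls (u @ [(i, True), (i, True)] @ word_inverse u)"

lemma conj_square_altdef:
  assumes "u \<in> W" "i \<in> {1..<n}"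
  shows "conj_square u i = cls u \<cdot> cls [(i, True), (i, True)] \<cdot> inv\<^bsub>Q\<^esub> cls u"
  using assms by (simp add: conj_square_def quot_class_mult quot_class_inv)

lemma conj_square_append:
  assumes "u \<in> W" "v \<in> W" "i \<in> {1..<n}"
  shows "conj_square (u @ v) i = cls u \<cdot> conj_square v i \<cdot> inv\<^bsub>Q\<^esub> cls u"
  using assms by (simp add: conj_square_def quot_class_mult quot_class_inv word_inverse_append)

lemma pure_gen_eq: "pure_gen n i j = conj_square (positive_word (rev [i + 1..<j])) i"
  unfolding conj_square_def word_inverse_positive_rev by (simp add: pure_gen_def)

lemma square_pure: "i \<in> {1..<n} \<Longrightarrow> cls [(i, True), (i, True)] \<in> pure_quot n"
  by (auto simp: pure_quot_eq fun_eq_iff intro!: imageI)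

text \<open>As pure braids commute modulo commutators, a conjugate of a square depends on the
  conjugating braid only through its permutation.\<close>

lemma conj_square_cong:
  assumes "u \<in> W" "v \<in> W" "i \<in> {1..<n}" "word_perm u = word_perm v"
  shows "conj_square u i = conj_square v i"
proof -
  let ?s = "cls [(i, True), (i, True)]" and ?x = "cls u" and ?y = "cls v"
  define z where "z = inv\<^bsub>Q\<^esub> ?y \<cdot> ?x"
  have "word_perm (word_inverse v @ u) = id"
    using assms bij_is_surj[OF bij_word_perm, of v]
    by (simp add: word_perm_append word_perm_word_inverse surj_iff)
  then have z: "z \<in> pure_quot n"
    using assms by (auto simp: z_def quot_class_inv quot_class_mult pure_quot_eq)
  have car: "z \<in> carrier Q" "?x \<in> carrier Q" "?y \<in> carrier Q" "?s \<in> carrier Q"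
    using assms by (auto simp: z_def)
  have x: "?x = ?y \<cdot> z"
    using car by (simp add: z_def flip: Q.m_assoc)
  have "z \<cdot> ?s \<cdot> inv\<^bsub>Q\<^esub> z = ?s"
    unfolding pure_quot_commute[OF z square_pure[OF assms(3)]]
    using car by (simp add: Q.m_assoc)
  then have "?x \<cdot> ?s \<cdot> inv\<^bsub>Q\<^esub> ?x = ?y \<cdot> ?s \<cdot> inv\<^bsub>Q\<^esub> ?y"
    unfolding x using car by (simp add: Q.inv_mult_group Q.m_assoc) (simp flip: Q.m_assoc)
  then show ?thesis
    using assms by (simp add: conj_square_altdef)
qed

lemma conj_square_coxeter_cong:
  assumes "coxeter_eq n' u v" "set u \<subseteq> {1..<n}" "set v \<subseteq> {1..<n}" "i \<in> {1..<n}"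
  shows "conj_square (positive_word u) i = conj_square (positive_word v) i"
  using assms by (intro conj_square_cong coxeter_eq_word_perm) auto

lemma quot_class_eqI:
  assumes "cls u = cls v" "x \<in> W" "u \<in> W" "v \<in> W" "y \<in> W"
  shows "cls (x @ u @ y) = cls (x @ v @ y)"
proof -
  have "cls (x @ w @ y) = cls x \<cdot> cls w \<cdot> cls y" if "w \<in> W" for w
    using assms that by (simp add: quot_class_mult)
  with assms show ?thesis by simp
qed

lemma conj_square_eqI:
  assumes "u \<in> W" "v \<in> W" "i \<in> {1..<n}" "j \<in> {1..<n}"
    "cls (v @ [(i, True), (i, True)]) = cls ([(j, True), (j, True)] @ v)"
  shows "conj_square (u @ v) i = conj_square u j"
proof -
  have "cls v \<cdot> cls [(i, True), (i, True)] = cls [(j, True), (j, True)] \<cdot> cls v"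
    using assms by (simp add: quot_class_mult)
  then have "conj_square v i = cls [(j, True), (j, True)]"
    using assms(1-4) by (simp add: conj_square_altdef Q.m_assoc)
  then show ?thesis
    using assms(1-4) by (simp only: conj_square_append conj_square_altdef)
qed

lemma quot_class_braid:
  assumes "1 \<le> i" "i + 1 < n"
  shows "cls [(i, True), (i + 1, True), (i, True)] = cls [(i + 1, True), (i, True), (i + 1, True)]"
  using assms by (intro quot_class_pres_eq pres_eq.relation) (auto simp: braid_relations_def)

lemma quot_class_commute:
  assumes "i \<in> {1..<n}" "k \<in> {1..<n}" "i + 2 \<le> k \<or> k + 2 \<le> i \<or> k = i"
  shows "cls [(k, True), (i, True)] = cls [(i, True), (k, True)]"
proof -
  have "cls [(k, True), (i, True)] = cls [(i, True), (k, True)]" if "k \<in> {1..<n}" "i \<in> {1..<n}" "i + 2 \<le> k" for i k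
    using that by (intro quot_class_pres_eq pres_eq.sym[OF pres_eq.relation]) (auto simp: braid_relations_def)
  from this[of k i] this[of i k] assms show ?thesis by auto
qed

lemma conj_square_commute:
  assumes "u \<in> W" "i \<in> {1..<n}" "k \<in> {1..<n}" "i + 2 \<le> k \<or> k + 2 \<le> i \<or> k = i"
  shows "conj_square (u @ [(k, True)]) i = conj_square u i"
proof (rule conj_square_eqI)
  note c = quot_class_commute[OF assms(2-4)]
  show "cls ([(k, True)] @ [(i, True), (i, True)]) = cls ([(i, True), (i, True)] @ [(k, True)])"
    using quot_class_eqI[OF c, of "[]" "[(i, True)]"] quot_class_eqI[OF c, of "[(i, True)]" "[]"] assms
    by simp
qed (use assms in auto)

text \<open>This is \<open>(\<sigma>\<^sub>i \<sigma>\<^sub>i\<^sub>+\<^sub>1) \<sigma>\<^sub>i = \<sigma>\<^sub>i\<^sub>+\<^sub>1 (\<sigma>\<^sub>i \<sigma>\<^sub>i\<^sub>+\<^sub>1)\<close>, applied twice.\<close>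

lemma conj_square_braid:
  assumes "u \<in> W" "1 \<le> i" "i + 1 < n"
  shows "conj_square (u @ [(i, True), (i + 1, True)]) i = conj_square u (i + 1)"
proof (rule conj_square_eqI)
  note b = quot_class_braid[OF assms(2,3)]
  show "cls ([(i, True), (i + 1, True)] @ [(i, True), (i, True)]) =
      cls ([(i + 1, True), (i + 1, True)] @ [(i, True), (i + 1, True)])"
    using quot_class_eqI[OF b, of "[]" "[(i, True)]"] quot_class_eqI[OF b, of "[(i + 1, True)]" "[]"] assms
    by simp
qed (use assms in auto)

lemma conj_square_braid':
  assumes "u \<in> W" "1 \<le> i" "i + 1 < n"
  shows "conj_square (u @ [(i, True)]) (i + 1) = conj_square (u @ [(i + 1, True)]) i"
proof -
  have "conj_square (u @ [(i, True)]) (i + 1) = conj_square (u @ [(i, True), (i, True), (i + 1, True)]) i"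
    using conj_square_braid[of "u @ [(i, True)]" i] assms by simp
  also have "\<dots> = conj_square (u @ [(i + 1, True)]) i"
    using assms by (intro conj_square_cong) (auto simp: word_perm_append fun_eq_iff)
  finally show ?thesis .
qed

text \<open>The conjugating word may be replaced by any other word with the same permutation. So, according to
the position of \<open>k\<close> relative to \<open>i\<close> and \<open>j\<close>, the new letter is absorbed, or cancelled, or moved
to the right end, where it either commutes with the square or turns it into the square of a
neighbouring generator.\<close>

lemma conj_generator_pure_gen:
  assumes "1 \<le> i" "i < j" "j \<le> n" "k \<in> {1..<n}"
  shows "\<exists>a b. 1 \<le> a \<and> a < b \<and> b \<le> n \<and>
    conj_square ((k, True) # positive_word (rev [i + 1..<j])) i = pure_gen n a b"
proof -
  let ?w = "rev [i + 1..<j]"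
  have i: "i \<in> {1..<n}" and w: "set ?w \<subseteq> {1..<n}" using assms by auto
  consider "k = j" | "k + 1 = j" "i < k" | "k = i" "j = i + 1" | "j < k \<or> k + 1 < i"
    | "i < k" "k + 1 < j" | "k + 1 = i" | "k = i" "i + 1 < j"
    using assms by force
  then show ?thesis
  proof cases
    case 1
    then have "k # ?w = rev [i + 1..<j + 1]" using assms by (simp add: One_nat_def)
    then have "conj_square ((k, True) # positive_word ?w) i = pure_gen n i (j + 1)"
      unfolding pure_gen_eq by (metis list.simps(9))
    then show ?thesis using assms 1 by (intro exI[of _ i] exI[of _ "j + 1"]) auto
  next
    case 2
    have eq: "k # ?w = [k, k] @ rev [i + 1..<k]" using 2(2) by (simp add: One_nat_def flip: 2(1))
    have "coxeter_eq n (k # ?w) ([] @ rev [i + 1..<k])"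
      unfolding eq using assms by (intro coxeter_eq.append coxeter_eq.refl coxeter_eq.square)
    from conj_square_coxeter_cong[OF this _ _ i]
    have "conj_square ((k, True) # positive_word ?w) i = pure_gen n i k"
      unfolding pure_gen_eq using assms 2 w by auto
    then show ?thesis using assms 2 by (intro exI[of _ i] exI[of _ k]) auto
  next
    case 3
    have "conj_square ((k, True) # positive_word ?w) i = pure_gen n i j"
      unfolding pure_gen_eq using conj_square_commute[of "[]" i k] assms 3 by simp
    then show ?thesis using assms by blast
  next
    case 4
    have "coxeter_eq n (?w @ [k]) (k # ?w)"
      using assms 4 by (intro coxeter_eq_commute_word) auto
    then have "conj_square (positive_word (k # ?w)) i = conj_square (positive_word (?w @ [k])) i"
      using assms w i by (intro conj_square_coxeter_cong[symmetric]) auto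
    also have "\<dots> = conj_square (positive_word ?w @ [(k, True)]) i"
      by simp
    also have "\<dots> = conj_square (positive_word ?w) i"
      using 4 w assms by (intro conj_square_commute) (simp_all, linarith?)
    finally have "conj_square ((k, True) # positive_word ?w) i = pure_gen n i j"
      by (simp add: pure_gen_eq)
    then show ?thesis using assms by blast
  next
    case 5
    have "coxeter_eq n (?w @ [k + 1]) ((k + 1 - 1) # ?w)"
      using assms 5 by (intro coxeter_eq_shift) auto
    then have "coxeter_eq n (?w @ [k + 1]) (k # ?w)" by simp
    then have "conj_square (positive_word (k # ?w)) i = conj_square (positive_word (?w @ [k + 1])) i"
      using assms w i 5 by (intro conj_square_coxeter_cong[symmetric]) auto
    also have "\<dots> = conj_square (positive_word ?w @ [(k + 1, True)]) i"
      by simp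
    also have "\<dots> = conj_square (positive_word ?w) i"
      using 5 w assms by (intro conj_square_commute) (simp_all, linarith?)
    finally have "conj_square ((k, True) # positive_word ?w) i = pure_gen n i j"
      by (simp add: pure_gen_eq)
    then show ?thesis using assms by blast
  next
    case 6
    have "coxeter_eq n (?w @ [k]) (k # ?w)"
      using assms 6 by (intro coxeter_eq_commute_word) auto
    then have "conj_square (positive_word (k # ?w)) i = conj_square (positive_word (?w @ [k])) i"
      using assms w i by (intro conj_square_coxeter_cong[symmetric]) auto
    also have "\<dots> = conj_square (positive_word ?w @ [(k, True)]) (k + 1)"
      by (simp add: 6)
    also have "\<dots> = conj_square (positive_word ?w @ [(k + 1, True)]) k"
      using assms 6 w i by (intro conj_square_braid') auto
    also have "\<dots> = conj_square (positive_word ?w @ [(i, True)]) k"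
      by (simp add: 6)
    also have "positive_word ?w @ [(i, True)] = positive_word (rev [k + 1..<j])"
      using assms 6 by (auto simp: upt_conv_Cons One_nat_def)
    finally have "conj_square ((k, True) # positive_word ?w) i = pure_gen n k j"
      by (simp add: pure_gen_eq)
    then show ?thesis
      using assms 6 by (intro exI[of _ k] exI[of _ j]) auto
  next
    case 7
    let ?v = "rev [i + 1 + 1..<j]"
    have v: "?w = ?v @ [i + 1]" "set ?v \<subseteq> {1..<n}"
      using assms 7 by (auto simp: upt_conv_Cons One_nat_def)
    have "coxeter_eq n (?v @ [i]) (i # ?v)"
      using assms 7 by (intro coxeter_eq_commute_word) auto
    then have "coxeter_eq n ((?v @ [i]) @ [i + 1]) ((i # ?v) @ [i + 1])"
      by (intro coxeter_eq.append coxeter_eq.refl)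
    then have "coxeter_eq n (?v @ [i, i + 1]) (k # ?w)"
      by (simp add: v 7)
    then have "conj_square (positive_word (k # ?w)) i = conj_square (positive_word (?v @ [i, i + 1])) i"
      using assms w i v(2) 7 by (intro conj_square_coxeter_cong[symmetric]) auto
    also have "\<dots> = conj_square (positive_word ?v @ [(i, True), (i + 1, True)]) i"
      by simp
    also have "\<dots> = conj_square (positive_word ?v) (i + 1)"
      using assms 7 v by (intro conj_square_braid) auto
    finally have "conj_square ((k, True) # positive_word ?w) i = pure_gen n (i + 1) j"
      by (simp add: pure_gen_eq)
    then show ?thesis
      using assms 7 by (intro exI[of _ "i + 1"] exI[of _ j]) auto
  qed
qed

lemma conj_square_is_pure_gen:
  assumes "u \<in> W" "i \<in> {1..<n}"
  shows "\<exists>a b. 1 \<le> a \<and> a < b \<and> b \<le> n \<and> conj_square u i = pure_gen n a b"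
  using assms(1)
proof (induction u)
  case Nil
  then show ?case
    using assms(2) by (intro exI[of _ i] exI[of _ "i + 1"]) (simp add: pure_gen_eq)
next
  case (Cons x u)
  obtain k b where x: "x = (k, b)" by force
  obtain a c where ac: "1 \<le> a" "a < c" "c \<le> n" "conj_square u i = pure_gen n a c"
    using Cons by auto
  let ?w = "positive_word (rev [a + 1..<c])"
  have w: "?w \<in> W" "a \<in> {1..<n}" "k \<in> {1..<n}"
    using ac Cons.prems x by auto
  have "conj_square (x # u) i = cls [x] \<cdot> conj_square ?w a \<cdot> inv\<^bsub>Q\<^esub> cls [x]"
    using conj_square_append[of "[x]" u i] Cons.prems assms(2) ac by (simp add: pure_gen_eq)
  also have "\<dots> = conj_square (x # ?w) a"
    using conj_square_append[of "[x]" ?w a] Cons.prems w by simp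
  also have "\<dots> = conj_square ((k, True) # ?w) a"
    using w x by (intro conj_square_cong) (auto simp: x)
  finally show ?case
    using conj_generator_pure_gen[OF ac(1-3) w(3)] by simp
qed

definition pure_gens :: "nat word set set set" where
  "pure_gens = {pure_gen n a b | a b. 1 \<le> a \<and> a < b \<and> b \<le> n}"

lemma pure_gens_subset: "pure_gens \<subseteq> pure_quot n"
proof -
  have "pure_gen n a b \<in> pure_quot n" if "1 \<le> a" "a < b" "b \<le> n" for a b
  proof -
    let ?w = "positive_word (rev [a + 1..<b])"
    have "word_perm (?w @ [(a, True), (a, True)] @ word_inverse ?w) = id"
      using bij_is_inj[OF bij_word_perm, of ?w]
      by (simp add: word_perm_append word_perm_word_inverse fun_eq_iff)
    then show ?thesis
      unfolding pure_gen_eq conj_square_def pure_quot_eq using that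
      by (intro imageI CollectI conjI) auto
  qed
  then show ?thesis by (auto simp: pure_gens_def)
qed

lemma pure_quot_subset: "pure_quot n \<subseteq> carrier Q"
  by (auto simp: pure_quot_eq)

lemma normal_pure_gens: "generate Q pure_gens \<lhd> Q"
proof (rule Q.normal_generateI)
  show "pure_gens \<subseteq> carrier Q"
    using pure_gens_subset pure_quot_subset by blast
  fix h g assume "h \<in> pure_gens" "g \<in> carrier Q"
  then obtain a b u where *: "1 \<le> a" "a < b" "b \<le> n" "h = pure_gen n a b" "u \<in> W" "g = cls u"
    by (auto simp: pure_gens_def carrier_Q)
  then have "g \<cdot> h \<cdot> inv\<^bsub>Q\<^esub> g = conj_square (u @ positive_word (rev [a + 1..<b])) a"
    unfolding * pure_gen_eq by (subst conj_square_append) auto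
  then show "g \<cdot> h \<cdot> inv\<^bsub>Q\<^esub> g \<in> pure_gens"
    using conj_square_is_pure_gen[of "u @ positive_word (rev [a + 1..<b])" a] *
    by (auto simp: pure_gens_def)
qed

end

lemma coxeter_eq_letters:
  "coxeter_eq n u v \<Longrightarrow> set u \<subseteq> {1..<n} \<longleftrightarrow> set v \<subseteq> {1..<n}"
  by (induction rule: coxeter_eq.induct) auto

lemma word_perm_map_fst: "word_perm (positive_word (map fst w)) = word_perm w"
  by (induction w) auto

context braid_quotient
begin

abbreviation "N \<equiv> generate Q pure_gens"

lemma coset_append:
  assumes "u \<in> W" "v \<in> W"
  shows "N #>\<^bsub>Q\<^esub> cls (u @ v) = (N #>\<^bsub>Q\<^esub> cls u) <#>\<^bsub>Q\<^esub> (N #>\<^bsub>Q\<^esub> cls v)"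
  using assms by (simp add: normal.rcos_sum[OF normal_pure_gens] quot_class_mult)

lemma coset_square:
  assumes "i \<in> {1..<n}"
  shows "N #>\<^bsub>Q\<^esub> cls [(i, True), (i, True)] = N #>\<^bsub>Q\<^esub> cls []"
proof -
  have "cls [(i, True), (i, True)] = pure_gen n i (i + 1)"
    by (simp add: pure_gen_def)
  then have "cls [(i, True), (i, True)] \<in> N"
    using assms unfolding pure_gens_def
    by (simp, intro generate.incl CollectI exI[of _ i] exI[of _ "i + 1"]) auto
  moreover have "cls [] \<in> N"
    unfolding quot_class_one[symmetric] by (rule generate.one)
  moreover have "subgroup N Q"
    using normal_pure_gens by (rule normal.axioms(1))
  ultimately have "N #>\<^bsub>Q\<^esub> cls [(i, True), (i, True)] = N" "N #>\<^bsub>Q\<^esub> cls [] = N"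
    using assms by (simp_all add: Q.coset_join2)
  then show ?thesis by simp
qed

text \<open>Inverse letters may be replaced by letters, as \<open>\<sigma>\<^sub>i = \<sigma>\<^sub>i\<^sup>2 \<sigma>\<^sub>i\<^sup>-\<^sup>1\<close> and squares are trivial in the
quotient.\<close>

lemma coset_inverse_letter:
  assumes "i \<in> {1..<n}"
  shows "N #>\<^bsub>Q\<^esub> cls [(i, b)] = N #>\<^bsub>Q\<^esub> cls [(i, True)]"
proof (cases b)
  case False
  let ?r = "pres_eq {1..<n} (braid_relations n)"
  have "?r ([(i, True)] @ [(i, True), (i, \<not> True)]) ([(i, True)] @ [])"
    using assms by (intro pres_eq.append pres_eq.refl pres_eq.cancel) auto
  then have "cls ([(i, True), (i, True)] @ [(i, False)]) = cls [(i, True)]"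
    by (intro quot_class_pres_eq) simp
  then have "N #>\<^bsub>Q\<^esub> cls [(i, True)] = N #>\<^bsub>Q\<^esub> cls ([(i, True), (i, True)] @ [(i, False)])"
    by simp
  also have "\<dots> = (N #>\<^bsub>Q\<^esub> cls [(i, True), (i, True)]) <#>\<^bsub>Q\<^esub> (N #>\<^bsub>Q\<^esub> cls [(i, False)])"
    using assms by (intro coset_append) auto
  also have "\<dots> = N #>\<^bsub>Q\<^esub> cls ([] @ [(i, False)])"
    unfolding coset_square[OF assms] using assms by (intro coset_append[symmetric]) auto
  finally have "N #>\<^bsub>Q\<^esub> cls [(i, True)] = N #>\<^bsub>Q\<^esub> cls [(i, False)]"
    by simp
  then show ?thesis using False by simp
qed simp

lemma coset_positive:
  "w \<in> W \<Longrightarrow> N #>\<^bsub>Q\<^esub> cls w = N #>\<^bsub>Q\<^esub> cls (positive_word (map fst w))"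
proof (induction w)
  case (Cons x w)
  then have "set (map fst w) \<subseteq> {1..<n}"
    by (auto simp: words_def)
  then show ?case
    using Cons coset_append[of "[x]" w] coset_append[of "[(fst x, True)]" "positive_word (map fst w)"]
      coset_inverse_letter[of "fst x" "snd x"] by (simp del: map_map)
qed simp

lemma coset_coxeter_eq:
  assumes "coxeter_eq n u v" "set u \<subseteq> {1..<n}"
  shows "N #>\<^bsub>Q\<^esub> cls (positive_word u) = N #>\<^bsub>Q\<^esub> cls (positive_word v)"
  using assms
proof (induction rule: coxeter_eq.induct)
  case (append u u' v v')
  then have "set u' \<subseteq> {1..<n}" "set v' \<subseteq> {1..<n}"
    using coxeter_eq_letters by auto
  with append show ?case by (simp add: coset_append)
next
  case (sym u v)
  then show ?case using coxeter_eq_letters by simp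
next
  case (trans u v w)
  then show ?case using coxeter_eq_letters by simp
next
  case (square i)
  then show ?case using coset_square by simp
next
  case (commute i j)
  then show ?case using quot_class_commute[of j i] by simp
next
  case (braid i)
  then show ?case using quot_class_braid by simp
qed simp

text \<open>Modulo the normal subgroup generated by the \<open>A\<close>, the word of a pure braid is a word in
involutions satisfying the braid relations, with trivial permutation; by the Coxeter presentation it
is trivial.\<close>

theorem pure_quot_generated: "pure_quot n = N"
proof
  show "N \<subseteq> pure_quot n"
  proof (rule Q.generate_subgroup_incl[OF pure_gens_subset])
    show "subgroup (pure_quot n) Q"
      by (rule Q.subgroupI)
        (auto simp: pure_quot_altdef quot_perm_mult quot_perm_inv inv_id intro!: exI[of _ "\<one>\<^bsub>Q\<^esub>"])
  qed
  show "pure_quot n \<subseteq> N"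
  proof
    fix x assume "x \<in> pure_quot n"
    then obtain w where w: "w \<in> W" "word_perm w = id" "x = cls w"
      by (auto simp: pure_quot_eq)
    have "set (map fst w) \<subseteq> {1..<n}"
      using w(1) by (auto simp: words_def)
    moreover from this have "coxeter_eq n (map fst w) []"
      using w(2) by (intro coxeter_presentation) (simp_all only: word_perm_map_fst)
    ultimately have "N #>\<^bsub>Q\<^esub> x = N #>\<^bsub>Q\<^esub> \<one>\<^bsub>Q\<^esub>"
      using coset_coxeter_eq[of "map fst w" "[]"] coset_positive[of w] w
      by (simp add: quot_class_one del: map_map)
    moreover have "subgroup N Q"
      using normal_pure_gens by (rule normal.axioms(1))
    ultimately show "x \<in> N"
      using Q.rcos_self[of x N] w by (simp add: Q.coset_mult_one subgroup.subset)
  qed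
qed

lemma subgroup_pure_quot: "subgroup (pure_quot n) Q"
  unfolding pure_quot_generated using normal_pure_gens by (rule normal.axioms(1))

lemma comm_group_pure_subgroup:
  assumes "subgroup H Q" "H \<subseteq> pure_quot n"
  shows "comm_group (Q\<lparr>carrier := H\<rparr>)"
proof -
  interpret H: group "Q\<lparr>carrier := H\<rparr>"
    using assms(1) by (rule Q.subgroup_imp_group)
  show ?thesis
    using assms pure_quot_commute by (intro H.group_comm_groupI) auto
qed

text \<open>On pure braids the cocycle is a homomorphism, as the permutation in the second term is trivial.\<close>

lemma lk_hom:
  assumes "subgroup H Q" "H \<subseteq> pure_quot n"
  shows "group_hom (Q\<lparr>carrier := H\<rparr>) integer_group (\<lambda>x. lk x e)"
proof (intro group_hom.intro group_hom_axioms.intro homI)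
  show "group (Q\<lparr>carrier := H\<rparr>)"
    using assms(1) by (rule Q.subgroup_imp_group)
  show "lk (x \<otimes>\<^bsub>Q\<lparr>carrier := H\<rparr>\<^esub> y) e = lk x e \<otimes>\<^bsub>integer_group\<^esub> lk y e"
    if "x \<in> carrier (Q\<lparr>carrier := H\<rparr>)" "y \<in> carrier (Q\<lparr>carrier := H\<rparr>)" for x y
    using that assms(2) lk_mult[of x y e] by (auto simp: pure_quot_altdef subset_iff)
qed auto

lemma lk_int_pow:
  assumes "subgroup H Q" "H \<subseteq> pure_quot n" "x \<in> H"
  shows "lk (x [^]\<^bsub>Q\<lparr>carrier := H\<rparr>\<^esub> (k :: int)) e = k * lk x e"
proof -
  interpret group_hom "Q\<lparr>carrier := H\<rparr>" integer_group "\<lambda>x. lk x e"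
    using assms(1,2) by (rule lk_hom)
  show ?thesis
    using hom_int_pow[of x k] assms(3) by simp
qed

lemma lk_nat_pow:
  assumes "x \<in> pure_quot n"
  shows "lk (x [^]\<^bsub>Q\<^esub> (k :: nat)) e = int k * lk x e"
  using lk_int_pow[OF subgroup_pure_quot order_refl assms, of "int k" e]
    Q.int_pow_consistent[OF subgroup_pure_quot assms, of "int k"]
  by (simp add: int_pow_int)

lemma lk_finprod:
  assumes "subgroup H Q" "H \<subseteq> pure_quot n" "finite A" "f \<in> A \<rightarrow> H"
  shows "lk (finprod (Q\<lparr>carrier := H\<rparr>) f A) e = (\<Sum>a\<in>A. lk (f a) e)"
proof -
  interpret H: comm_group "Q\<lparr>carrier := H\<rparr>"
    using assms(1,2) by (rule comm_group_pure_subgroup)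
  interpret h: group_hom "Q\<lparr>carrier := H\<rparr>" integer_group "\<lambda>x. lk x e"
    using assms(1,2) by (rule lk_hom)
  show ?thesis
    using assms(3,4)
  proof (induction A rule: finite_induct)
    case empty
    then show ?case using h.hom_one by simp
  next
    case (insert a A)
    then have "finprod (Q\<lparr>carrier := H\<rparr>) f A \<in> H"
      using H.finprod_closed[of f A] by auto
    with insert show ?case
      using h.hom_mult[of "f a" "finprod (Q\<lparr>carrier := H\<rparr>) f A"]
      by (simp add: H.finprod_insert Pi_iff)
  qed
qed

text \<open>The crossings made by the conjugating word are undone by its inverse. What remains are the two
  crossings of the square, between the strands that the word has brought to the positions \<open>i\<close> and
  \<open>i + 1\<close>; these strands start at \<open>i\<close> and \<open>j\<close>.\<close>

lemma lk_pure_gen: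
  assumes "1 \<le> i" "i < j" "j \<le> n"
  shows "lk (pure_gen n i j) e = (if e = {i, j} then 2 else 0)"
proof -
  let ?w = "positive_word (rev [i + 1..<j])"
  have W: "?w \<in> W" "i \<in> {1..<n}" using assms by auto
  have "word_perm ?w i = i"
    by (intro word_perm_fixes) auto
  moreover have "word_perm ?w j = i + 1"
    using assms by (intro word_perm_descending) auto
  ultimately have "word_perm ?w ` {i, j} = {i, i + 1}" by simp
  then have iff: "word_perm ?w ` e = {i, i + 1} \<longleftrightarrow> e = {i, j}"
    using inj_image_eq_iff[OF bij_is_inj[OF bij_word_perm], of ?w e "{i, j}"] by simp
  have "transpose i (i + 1) ` X = {i, i + 1} \<longleftrightarrow> X = {i, i + 1}" for X
    unfolding transpose_image_eq_iff by auto
  then have sq: "linking [(i, True), (i, True)] X = (if X = {i, i + 1} then 2 else 0)" for X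
    by simp
  have "linking (word_inverse ?w) (word_perm ?w ` e) = - linking ?w e"
    using lk_inv[of "cls ?w" "word_perm ?w ` e"] W bij_word_perm[of ?w]
    by (simp only: quot_class_inv lk_class quot_perm_class word_inverse_in_words word_perm_word_inverse
        quot_class_in_carrier image_comp bij_is_inj inv_o_cancel image_id id_apply)
  moreover have "word_perm [(i, True), (i, True)] = id"
    by (simp add: fun_eq_iff)
  ultimately have "linking (?w @ [(i, True), (i, True)] @ word_inverse ?w) e = (if e = {i, j} then 2 else 0)"
    unfolding linking_append sq by (simp add: iff image_id)
  then show ?thesis
    unfolding pure_gen_eq conj_square_def using W by (subst lk_class) auto
qed

lemma pure_quot_expansion:
  assumes "x \<in> pure_quot n"
  shows "\<exists>c :: nat set \<Rightarrow> int. x = finprod (Q\<lparr>carrier := pure_quot n\<rparr>)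
    (\<lambda>e. pure_gen n (Min e) (Max e) [^]\<^bsub>Q\<lparr>carrier := pure_quot n\<rparr>\<^esub> c e) (pairs n)"
proof -
  define P where "P = Q\<lparr>carrier := pure_quot n\<rparr>"
  let ?A = "\<lambda>e. pure_gen n (Min e) (Max e)"
  interpret P: comm_group P
    unfolding P_def using comm_group_pure_subgroup[OF subgroup_pure_quot] by simp
  have carrier_P: "carrier P = pure_quot n"
    by (simp add: P_def)
  have A: "?A e \<in> carrier P" if "e \<in> pairs n" for e
    using that pure_gens_subset by (fastforce simp: pairs_eq pure_gens_def carrier_P)
  have *: "\<exists>c :: nat set \<Rightarrow> int. h = finprod P (\<lambda>e. ?A e [^]\<^bsub>P\<^esub> c e) (pairs n)" if h: "h \<in> pure_gens" for h
  proof -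
    obtain a b where ab: "1 \<le> a" "a < b" "b \<le> n" "h = pure_gen n a b"
      using h by (auto simp: pure_gens_def)
    have "finprod P (\<lambda>e. ?A e [^]\<^bsub>P\<^esub> (if e = {a, b} then 1 else 0 :: int)) (pairs n) =
        finprod P (\<lambda>e. if {a, b} = e then ?A e else \<one>\<^bsub>P\<^esub>) (pairs n)"
      using A by (intro P.finprod_cong') auto
    also have "\<dots> = ?A {a, b}"
    proof (rule P.finprod_singleton)
      show "{a, b} \<in> pairs n"
        using ab by (auto simp: pairs_eq)
    qed (use A in auto)
    finally show ?thesis using ab by (intro exI[of _ "\<lambda>e. if e = {a, b} then 1 else 0"]) simp
  qed
  have "x \<in> generate P pure_gens"
    using Q.generate_consistent[OF pure_gens_subset subgroup_pure_quot] assms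
    by (simp add: P_def flip: pure_quot_generated)
  then show ?thesis
    unfolding P_def[symmetric]
  proof (induction rule: generate.induct)
    case one
    have "finprod P (\<lambda>e. ?A e [^]\<^bsub>P\<^esub> (0 :: int)) (pairs n) = \<one>\<^bsub>P\<^esub>"
      by (intro P.finprod_one_eqI) auto
    then show ?case by (intro exI[of _ "\<lambda>_. 0"]) (rule HOL.sym)
  next
    case (incl h)
    then show ?case by (rule *)
  next
    case (inv h)
    then obtain c where c: "h = finprod P (\<lambda>e. ?A e [^]\<^bsub>P\<^esub> (c e :: int)) (pairs n)"
      using * by blast
    have "finprod P (\<lambda>e. ?A e [^]\<^bsub>P\<^esub> (- c e)) (pairs n) \<otimes>\<^bsub>P\<^esub> h =
        finprod P (\<lambda>e. ?A e [^]\<^bsub>P\<^esub> (- c e) \<otimes>\<^bsub>P\<^esub> ?A e [^]\<^bsub>P\<^esub> c e) (pairs n)"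
      unfolding c using A by (intro P.finprod_multf[symmetric]) auto
    also have "\<dots> = \<one>\<^bsub>P\<^esub>"
      using A by (intro P.finprod_one_eqI) (simp flip: P.int_pow_mult)
    finally have "inv\<^bsub>P\<^esub> h = finprod P (\<lambda>e. ?A e [^]\<^bsub>P\<^esub> (- c e)) (pairs n)"
      using A inv pure_gens_subset by (intro P.inv_equality) (auto simp flip: carrier_P)
    then show ?case by (intro exI[of _ "\<lambda>e. - c e"])
  next
    case (eng h1 h2)
    then obtain c d where cd: "h1 = finprod P (\<lambda>e. ?A e [^]\<^bsub>P\<^esub> (c e :: int)) (pairs n)"
      "h2 = finprod P (\<lambda>e. ?A e [^]\<^bsub>P\<^esub> (d e :: int)) (pairs n)"
      by blast
    have "h1 \<otimes>\<^bsub>P\<^esub> h2 = finprod P (\<lambda>e. ?A e [^]\<^bsub>P\<^esub> c e \<otimes>\<^bsub>P\<^esub> ?A e [^]\<^bsub>P\<^esub> d e) (pairs n)"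
      unfolding cd using A by (intro P.finprod_multf[symmetric]) auto
    also have "\<dots> = finprod P (\<lambda>e. ?A e [^]\<^bsub>P\<^esub> (c e + d e)) (pairs n)"
      using A by (intro P.finprod_cong') (auto simp: P.int_pow_mult)
    finally show ?case by (intro exI[of _ "\<lambda>e. c e + d e"])
  qed
qed

text \<open>The exponents in a product of the generators can be read off from the linking numbers, so the
generators are independent.\<close>

lemma pure_quot_coefficients:
  assumes "x \<in> pure_quot n"
  obtains c :: "nat set \<Rightarrow> int" where
    "x = finprod (Q\<lparr>carrier := pure_quot n\<rparr>)
      (\<lambda>e. pure_gen n (Min e) (Max e) [^]\<^bsub>Q\<lparr>carrier := pure_quot n\<rparr>\<^esub> c e) (pairs n)"
    "\<And>e. e \<in> pairs n \<Longrightarrow> lk x e = 2 * c e"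
proof -
  define P where "P = Q\<lparr>carrier := pure_quot n\<rparr>"
  let ?A = "\<lambda>e. pure_gen n (Min e) (Max e)"
  interpret P: comm_group P
    unfolding P_def using comm_group_pure_subgroup[OF subgroup_pure_quot] by simp
  have carrier_P: "carrier P = pure_quot n"
    by (simp add: P_def)
  obtain c :: "nat set \<Rightarrow> int" where c: "x = finprod P (\<lambda>e. ?A e [^]\<^bsub>P\<^esub> c e) (pairs n)"
    using pure_quot_expansion[OF assms] unfolding P_def by blast
  have A: "?A e \<in> pure_quot n" "lk (?A e) e' = (if e' = e then 2 else 0)" if "e \<in> pairs n" for e e'
  proof -
    obtain a b where ab: "e = {a, b}" "1 \<le> a" "a < b" "b \<le> n"
      using \<open>e \<in> pairs n\<close> by (auto simp: pairs_eq)
    then show "?A e \<in> pure_quot n"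
      using pure_gens_subset by (auto simp: pure_gens_def)
    show "lk (?A e) e' = (if e' = e then 2 else 0)"
      using ab by (simp add: lk_pure_gen)
  qed
  have "lk x e = 2 * c e" if e: "e \<in> pairs n" for e
  proof -
    have "lk x e = (\<Sum>e'\<in>pairs n. lk (?A e' [^]\<^bsub>P\<^esub> c e') e)"
      unfolding c P_def using A(1) P.int_pow_closed
      by (subst lk_finprod[OF subgroup_pure_quot]) (auto simp: carrier_P P_def)
    also have "\<dots> = (\<Sum>e'\<in>pairs n. if e = e' then 2 * c e' else 0)"
      using A by (intro sum.cong) (auto simp: P_def lk_int_pow[OF subgroup_pure_quot])
    also have "\<dots> = 2 * c e"
      using e by simp
    finally show ?thesis .
  qed
  with c that show ?thesis unfolding P_def by blast
qed

lemma lk_even: "x \<in> pure_quot n \<Longrightarrow> e \<in> pairs n \<Longrightarrow> even (lk x e)"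
  by (metis pure_quot_coefficients dvd_triv_left)

theorem pure_quot_eqI:
  assumes "x \<in> pure_quot n" "y \<in> pure_quot n" "\<And>e. e \<in> pairs n \<Longrightarrow> lk x e = lk y e"
  shows "x = y"
proof -
  define P where "P = Q\<lparr>carrier := pure_quot n\<rparr>"
  let ?A = "\<lambda>e. pure_gen n (Min e) (Max e)"
  interpret P: comm_group P
    unfolding P_def using comm_group_pure_subgroup[OF subgroup_pure_quot] by simp
  have carrier_P: "carrier P = pure_quot n"
    by (simp add: P_def)
  obtain c where c: "x = finprod P (\<lambda>e. ?A e [^]\<^bsub>P\<^esub> (c e :: int)) (pairs n)"
    "\<And>e. e \<in> pairs n \<Longrightarrow> lk x e = 2 * c e"
    using pure_quot_coefficients[OF assms(1)] unfolding P_def by blast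
  obtain d where d: "y = finprod P (\<lambda>e. ?A e [^]\<^bsub>P\<^esub> (d e :: int)) (pairs n)"
    "\<And>e. e \<in> pairs n \<Longrightarrow> lk y e = 2 * d e"
    using pure_quot_coefficients[OF assms(2)] unfolding P_def by blast
  have A: "?A e \<in> carrier P" if "e \<in> pairs n" for e
    using that pure_gens_subset by (fastforce simp: pairs_eq pure_gens_def carrier_P)
  show ?thesis
    unfolding c(1) d(1) using assms(3) c(2) d(2) A by (intro P.finprod_cong') auto
qed

end


section \<open>Characteristic polynomials\<close>

definition companion :: "nat \<Rightarrow> (nat \<Rightarrow> int) \<Rightarrow> int mat" where
  "companion k a = mat k k (\<lambda>(r, c). if c = k - 1 then - a r else if r = c + 1 then 1 else 0)"

lemma companion_carrier [simp]: "companion k a \<in> carrier_mat k k"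
  by (simp add: companion_def)

lemma companion_index:
  "r < k \<Longrightarrow> c < k \<Longrightarrow>
    companion k a $$ (r, c) = (if c = k - 1 then - a r else if r = c + 1 then 1 else 0)"
  by (simp add: companion_def)

lemma char_poly_matrix_index:
  assumes "A \<in> carrier_mat k k" "r < k" "c < k"
  shows "char_poly_matrix A $$ (r, c) = (if r = c then [:0, 1:] else 0) + [:- A $$ (r, c):]"
  using assms by (auto simp: char_poly_matrix_def)

text \<open>In the expansion along the first row, the entry \<open>x\<close> leaves a smaller companion matrix, and the entry in
the last column leaves a triangular matrix with diagonal entries \<open>-1\<close>.\<close>

lemma char_poly_companion:
  "k \<ge> 1 \<Longrightarrow> char_poly (companion k a) = monom 1 k + (\<Sum>i<k. monom (a i) i)"
proof (induction k arbitrary: a rule: nat_induct_at_least)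
  case base
  have "char_poly_matrix (companion 1 a) $$ (0, 0) = [:a 0, 1:]"
    by (subst char_poly_matrix_index[of _ 1]) (auto simp: companion_def)
  moreover have "char_poly_matrix (companion 1 a) \<in> carrier_mat 1 1"
    by (rule char_poly_matrix_closed) (auto simp: companion_def)
  ultimately have "char_poly (companion 1 a) = [:a 0, 1:]"
    unfolding char_poly_def by (subst det_single) auto
  then show ?case by (simp add: monom_0 monom_Suc)
next
  case (Suc k)
  let ?C = "companion (Suc k) a" and ?C' = "companion k (\<lambda>i. a (Suc i))"
  define D where "D = char_poly_matrix ?C"
  have C: "?C \<in> carrier_mat (Suc k) (Suc k)" "?C' \<in> carrier_mat k k"
    by (auto simp: companion_def)
  have D: "D \<in> carrier_mat (Suc k) (Suc k)"
    using C unfolding D_def by (intro char_poly_matrix_closed)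
  have D_index: "D $$ (r, c) = (if r = c then [:0, 1:] else 0) + [:- ?C $$ (r, c):]"
    if "r < Suc k" "c < Suc k" for r c
    unfolding D_def by (rule char_poly_matrix_index[OF C(1) that])
  have first: "mat_delete D 0 0 = char_poly_matrix ?C'"
  proof (rule eq_matI)
    fix r c assume "r < dim_row (char_poly_matrix ?C')" "c < dim_col (char_poly_matrix ?C')"
    then have rc: "r < k" "c < k"
      using char_poly_matrix_closed[OF C(2)] by auto
    have "mat_delete D 0 0 $$ (r, c) = D $$ (Suc r, Suc c)"
      using mat_delete_index[OF D, of 0 0 r c] rc by simp
    also have "\<dots> = char_poly_matrix ?C' $$ (r, c)"
      using rc Suc.hyps C
      by (auto simp: D_index char_poly_matrix_index[OF C(2)] companion_index)
    finally show "mat_delete D 0 0 $$ (r, c) = char_poly_matrix ?C' $$ (r, c)" .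
  qed (simp_all add: carrier_matD[OF D] carrier_matD[OF char_poly_matrix_closed[OF C(2)]])
  have "det (mat_delete D 0 k) = (-1) ^ k"
  proof -
    let ?M = "mat_delete D 0 k"
    have M: "?M \<in> carrier_mat k k"
      using mat_delete_carrier[OF D] by simp
    have M_index: "?M $$ (r, c) = D $$ (Suc r, c)" if "r < k" "c < k" for r c
      using mat_delete_index[OF D, of 0 k r c] that by simp
    have "upper_triangular ?M"
      using M by (auto simp: upper_triangular_def M_index D_index companion_index)
    then have "det ?M = prod_list (diag_mat ?M)"
      using M by (rule det_upper_triangular)
    also have "\<dots> = (\<Prod>i = 0..<k. ?M $$ (i, i))"
      by (simp add: prod_list_diag_prod carrier_matD[OF D])
    also have "\<dots> = (\<Prod>i = 0..<k. -1)"
      by (intro prod.cong) (auto simp: M_index D_index companion_index one_pCons)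
    finally show ?thesis by simp
  qed
  then have last: "cofactor D 0 k = 1"
    by (simp add: cofactor_def flip: power_mult_distrib)
  have first': "cofactor D 0 0 = char_poly ?C'"
    by (simp add: cofactor_def first char_poly_def)
  have "det D = (\<Sum>j<Suc k. D $$ (0, j) * cofactor D 0 j)"
    by (rule laplace_expansion_row[OF D]) simp
  also have "\<dots> = (\<Sum>j\<in>{0, k}. D $$ (0, j) * cofactor D 0 j)"
    by (intro sum.mono_neutral_right) (auto simp: D_index companion_index)
  also have "\<dots> = D $$ (0, 0) * cofactor D 0 0 + D $$ (0, k) * cofactor D 0 k"
    using Suc.hyps by simp
  also have "\<dots> = [:0, 1:] * char_poly ?C' + [:a 0:]"
    using Suc.hyps by (simp add: D_index companion_index last first')
  also have "char_poly ?C' = monom 1 k + (\<Sum>i<k. monom (a (Suc i)) i)"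
    by (rule Suc.IH)
  also have "[:0, 1:] * (monom 1 k + (\<Sum>i<k. monom (a (Suc i)) i)) + [:a 0:] =
      monom 1 (Suc k) + (\<Sum>i<Suc k. monom (a i) i)"
    by (subst sum.lessThan_Suc_shift)
      (simp add: monom_0 monom_Suc distrib_left sum_distrib_left)
  finally show ?case
    unfolding char_poly_def D_def .
qed

lemma char_poly_four_block_diag:
  fixes A B :: "int mat"
  assumes "A \<in> carrier_mat k k" "B \<in> carrier_mat l l" "C \<in> carrier_mat k l"
  shows "char_poly (four_block_mat A C (0\<^sub>m l k) B) = char_poly A * char_poly B"
proof -
  have "char_poly_matrix (four_block_mat A C (0\<^sub>m l k) B) =
      four_block_mat (char_poly_matrix A) (map_mat (\<lambda>a. [:- a:]) C) (0\<^sub>m l k) (char_poly_matrix B)"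
    using assms by (intro eq_matI) (auto simp: char_poly_matrix_def)
  moreover have "det (four_block_mat (char_poly_matrix A) (map_mat (\<lambda>a. [:- a:]) C) (0\<^sub>m l k)
      (char_poly_matrix B)) = det (char_poly_matrix A) * det (char_poly_matrix B)"
    using assms by (intro det_four_block_mat_lower_left_zero) auto
  ultimately show ?thesis
    by (simp add: char_poly_def)
qed

lemma char_poly_diag_block_mat:
  fixes As :: "int mat list"
  assumes "\<And>A. A \<in> set As \<Longrightarrow> square_mat A"
  shows "char_poly (diag_block_mat As) = (\<Prod>A\<leftarrow>As. char_poly A)"
  using assms
proof (induction As)
  case Nil
  have "char_poly_matrix (0\<^sub>m 0 0 :: int mat) \<in> carrier_mat 0 0"
    by (rule char_poly_matrix_closed) auto
  then show ?case by (simp add: char_poly_def)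
next
  case (Cons A As)
  define B where "B = diag_block_mat As"
  have "square_mat B"
    unfolding B_def using Cons.prems by (intro diag_block_mat_square) auto
  then have B: "B \<in> carrier_mat (dim_row B) (dim_row B)"
    by (intro carrier_matI) auto
  have A: "A \<in> carrier_mat (dim_row A) (dim_row A)"
    using Cons.prems by (intro carrier_matI) auto
  have "diag_block_mat (A # As) = four_block_mat A (0\<^sub>m (dim_row A) (dim_col B)) (0\<^sub>m (dim_row B) (dim_col A)) B"
    by (simp add: Let_def B_def)
  also have "\<dots> = four_block_mat A (0\<^sub>m (dim_row A) (dim_row B)) (0\<^sub>m (dim_row B) (dim_row A)) B"
    using A B by (metis carrier_matD(2))
  finally have "char_poly (diag_block_mat (A # As)) = char_poly A * char_poly B"
    using char_poly_four_block_diag[OF A B zero_carrier_mat] by metis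
  then show ?case
    using Cons unfolding B_def by simp
qed

lemma M_mat_carrier: "z \<ge> 1 \<Longrightarrow> M_mat z \<in> carrier_mat z z"
  by (auto simp: M_mat_def mat_of_cols_def)

lemma N_mat_carrier: "z \<ge> 2 \<Longrightarrow> N_mat z q \<in> carrier_mat z z"
  by (auto simp: N_mat_def mat_of_cols_def)

lemma col_M_mat: "i < z \<Longrightarrow> col (M_mat z) i = unit_vec z (if i = z - 1 then 0 else i + 1)"
  unfolding M_mat_def by (subst col_mat_of_cols) (auto simp: nth_append)

lemma col_N_mat:
  assumes "i < z" "z \<ge> 2"
  shows "col (N_mat z q) i = (if i = 0 then unit_vec z 0 else if i = z - 1
    then vec z (\<lambda>r. if r = 0 then int q else - 1) else unit_vec z (i + 1))"
proof (cases i)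
  case 0
  then show ?thesis
    unfolding N_mat_def using assms by (subst col_mat_of_cols) (auto simp: nth_append)
next
  case (Suc i')
  then show ?thesis
    unfolding N_mat_def using assms by (subst col_mat_of_cols) (auto simp: nth_append)
qed

lemma M_mat_companion:
  assumes "z \<ge> 1"
  shows "M_mat z = companion z (\<lambda>i. if i = 0 then - 1 else 0)"
proof (rule eq_matI)
  fix r c assume rc: "r < dim_row (companion z (\<lambda>i. if i = 0 then - 1 else 0))"
    "c < dim_col (companion z (\<lambda>i. if i = 0 then - 1 else 0))"
  then have "M_mat z $$ (r, c) = col (M_mat z) c $ r"
    using M_mat_carrier[OF assms] by (auto simp: companion_def)
  then show "M_mat z $$ (r, c) = companion z (\<lambda>i. if i = 0 then - 1 else 0) $$ (r, c)"
    using rc assms by (auto simp: col_M_mat companion_def)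
qed (use M_mat_carrier[OF assms] in \<open>auto simp: companion_def\<close>)

lemma char_poly_M_mat: "z \<ge> 1 \<Longrightarrow> char_poly (M_mat z) = monom 1 z - 1"
proof -
  assume z: "z \<ge> 1"
  have "(\<Sum>i<z. monom (if i = 0 then - 1 else 0 :: int) i) = (\<Sum>i\<in>{0}. monom (- 1) i)"
    using z by (intro sum.mono_neutral_cong_right) auto
  then show ?thesis
    using z by (simp add: M_mat_companion char_poly_companion monom_0 one_pCons)
qed

text \<open>The first basis vector is fixed, and modulo it the matrix is the companion matrix of
\<open>1 + x + \<dots> + x\<^sup>z\<^sup>-\<^sup>1\<close>.\<close>

lemma N_mat_four_block:
  assumes "z \<ge> 2"
  shows "N_mat z q = four_block_mat (1\<^sub>m 1) (mat 1 (z - 1) (\<lambda>(r, c). if c = z - 2 then int q else 0))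
    (0\<^sub>m (z - 1) 1) (companion (z - 1) (\<lambda>_. 1))" (is "_ = ?R")
proof (rule eq_matI)
  fix r c assume rc: "r < dim_row ?R" "c < dim_col ?R"
  then have rc: "r < z" "c < z" using assms by (auto simp: companion_def)
  then have "N_mat z q $$ (r, c) = col (N_mat z q) c $ r"
    using N_mat_carrier[OF assms, of q] by auto
  then show "N_mat z q $$ (r, c) = ?R $$ (r, c)"
    using rc assms by (auto simp: col_N_mat companion_def)
qed (use N_mat_carrier[OF assms, of q] assms in \<open>auto simp: companion_def\<close>)

lemma char_poly_N_mat:
  assumes "z \<ge> 2"
  shows "char_poly (N_mat z q) = monom 1 z - 1"
proof -
  have one: "char_poly (1\<^sub>m 1 :: int mat) = [:- 1, 1:]"
  proof -
    have "1\<^sub>m 1 = companion 1 (\<lambda>_. - 1)"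
      by (rule eq_matI) (auto simp: companion_def)
    then show ?thesis
      by (simp add: char_poly_companion monom_0 monom_Suc)
  qed
  have "char_poly (N_mat z q) = char_poly (1\<^sub>m 1 :: int mat) * char_poly (companion (z - 1) (\<lambda>_. 1))"
    unfolding N_mat_four_block[OF assms]
    by (rule char_poly_four_block_diag) auto
  also have "\<dots> = [:- 1, 1:] * (monom 1 (z - 1) + (\<Sum>i<z - 1. monom 1 i))"
    using assms by (simp only: one, subst char_poly_companion) auto
  also have "monom 1 (z - 1) + (\<Sum>i<z - 1. monom 1 i) = (\<Sum>i<Suc (z - 1). monom (1 :: int) i)"
    by simp
  also have "[:- 1, 1:] * (\<Sum>i<k. monom (1 :: int) i) = monom 1 k - 1" for k
    by (induction k) (auto simp: distrib_left monom_Suc monom_0 one_pCons)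
  finally show ?thesis using assms by simp
qed


section \<open>Bases made of blocks with disjoint supports\<close>

definition fun_comb :: "('e \<Rightarrow> int) list \<Rightarrow> int vec \<Rightarrow> 'e \<Rightarrow> int" where
  "fun_comb fs c e = (\<Sum>i<length fs. c $ i * (fs ! i) e)"

lemma sum_lessThan_add: "(\<Sum>i<a + b. h i) = (\<Sum>i<a. h i) + (\<Sum>i<(b :: nat). h (a + i))"
  for h :: "nat \<Rightarrow> int"
  by (induction b) auto

lemma fun_comb_append:
  assumes "c \<in> carrier_vec (length fs)" "d \<in> carrier_vec (length gs)"
  shows "fun_comb (fs @ gs) (c @\<^sub>v d) e = fun_comb fs c e + fun_comb gs d e"
proof -
  let ?h = "\<lambda>i. (c @\<^sub>v d) $ i * ((fs @ gs) ! i) e"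
  have "fun_comb (fs @ gs) (c @\<^sub>v d) e = (\<Sum>i<length fs. ?h i) + (\<Sum>i<length gs. ?h (length fs + i))"
    by (simp add: fun_comb_def sum_lessThan_add)
  also have "(\<Sum>i<length fs. ?h i) = fun_comb fs c e"
    unfolding fun_comb_def using assms by (intro sum.cong) (auto simp: nth_append)
  also have "(\<Sum>i<length gs. ?h (length fs + i)) = fun_comb gs d e"
    unfolding fun_comb_def using assms by (intro sum.cong) (auto simp: nth_append)
  finally show ?thesis .
qed

text \<open>Here \<open>P\<close> stands for the congruences that hold on the lattice under consideration. They need only
be sufficient for the existence of integer coordinates, which are then unique.\<close>

definition supported_basis :: "'e set \<Rightarrow> ('e \<Rightarrow> int) list \<Rightarrow> 'e set \<Rightarrow> (('e \<Rightarrow> int) \<Rightarrow> bool) \<Rightarrow> bool" where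
  "supported_basis E fs S P \<longleftrightarrow> S \<subseteq> E \<and> (\<forall>f\<in>set fs. \<forall>e\<in>E - S. f e = 0) \<and>
    (\<forall>v. P v \<longrightarrow> (\<exists>!c. c \<in> carrier_vec (length fs) \<and> (\<forall>e\<in>S. fun_comb fs c e = v e)))"

lemma fun_comb_outside:
  assumes "supported_basis E fs S P" "e \<in> E - S"
  shows "fun_comb fs c e = 0"
  using assms unfolding fun_comb_def supported_basis_def by (intro sum.neutral) auto

text \<open>A combination of both lists is a combination of the first list on \<open>S\<close>, where the second one
vanishes, and vice versa on \<open>T\<close>.\<close>

lemma supported_basis_append:
  assumes fs: "supported_basis E fs S P" and gs: "supported_basis E gs T R" and disj: "S \<inter> T = {}"
  shows "supported_basis E (fs @ gs) (S \<union> T) (\<lambda>v. P v \<and> R v)"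
  unfolding supported_basis_def
proof (intro conjI allI impI)
  show "S \<union> T \<subseteq> E" "\<forall>f\<in>set (fs @ gs). \<forall>e\<in>E - (S \<union> T). f e = 0"
    using fs gs by (auto simp: supported_basis_def)
  fix v assume v: "P v \<and> R v"
  obtain c where c: "c \<in> carrier_vec (length fs)" "\<forall>e\<in>S. fun_comb fs c e = v e"
    and c_unique: "\<And>c'. c' \<in> carrier_vec (length fs) \<Longrightarrow> \<forall>e\<in>S. fun_comb fs c' e = v e \<Longrightarrow> c' = c"
    using fs v unfolding supported_basis_def by metis
  obtain d where d: "d \<in> carrier_vec (length gs)" "\<forall>e\<in>T. fun_comb gs d e = v e"
    and d_unique: "\<And>d'. d' \<in> carrier_vec (length gs) \<Longrightarrow> \<forall>e\<in>T. fun_comb gs d' e = v e \<Longrightarrow> d' = d"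
    using gs v unfolding supported_basis_def by metis
  have S: "fun_comb gs d' e = 0" if "e \<in> S" for d' e
    using that disj fs by (intro fun_comb_outside[OF gs]) (auto simp: supported_basis_def)
  have T: "fun_comb fs c' e = 0" if "e \<in> T" for c' e
    using that disj gs by (intro fun_comb_outside[OF fs]) (auto simp: supported_basis_def)
  show "\<exists>!x. x \<in> carrier_vec (length (fs @ gs)) \<and> (\<forall>e\<in>S \<union> T. fun_comb (fs @ gs) x e = v e)"
  proof (intro ex1I[of _ "c @\<^sub>v d"] conjI ballI)
    show "c @\<^sub>v d \<in> carrier_vec (length (fs @ gs))"
      using c d by simp
    show "fun_comb (fs @ gs) (c @\<^sub>v d) e = v e" if "e \<in> S \<union> T" for e
      using that c d by (auto simp: fun_comb_append[OF c(1) d(1)] S T)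
    fix x assume x: "x \<in> carrier_vec (length (fs @ gs)) \<and> (\<forall>e\<in>S \<union> T. fun_comb (fs @ gs) x e = v e)"
    define c' d' where "c' = vec_first x (length fs)" and "d' = vec_last x (length gs)"
    have c'd': "c' \<in> carrier_vec (length fs)" "d' \<in> carrier_vec (length gs)" "x = c' @\<^sub>v d'"
      using x by (auto simp: c'_def d'_def)
    have sum: "fun_comb fs c' e + fun_comb gs d' e = v e" if "e \<in> S \<union> T" for e
      using x that unfolding c'd'(3) fun_comb_append[OF c'd'(1,2)] by blast
    have "fun_comb fs c' e = v e" if "e \<in> S" for e
      using sum[of e] S[OF that, of d'] that by simp
    then have "c' = c"
      using c'd'(1) by (intro c_unique) auto
    moreover have "fun_comb gs d' e = v e" if "e \<in> T" for e
      using sum[of e] T[OF that, of c'] that by simp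
    then have "d' = d"
      using c'd'(2) by (intro d_unique) auto
    ultimately show "x = c @\<^sub>v d"
      using c'd' by simp
  qed
qed

lemma supported_basis_concat:
  assumes "\<And>x. x \<in> set xs \<Longrightarrow> supported_basis E (F x) (S x) (P x)"
    "distinct xs" "\<And>x x'. x \<in> set xs \<Longrightarrow> x' \<in> set xs \<Longrightarrow> x \<noteq> x' \<Longrightarrow> S x \<inter> S x' = {}"
  shows "supported_basis E (concat (map F xs)) (\<Union>x\<in>set xs. S x) (\<lambda>v. \<forall>x\<in>set xs. P x v)"
  using assms
proof (induction xs)
  case Nil
  show ?case
    by (auto simp: supported_basis_def intro!: ex1I[of _ "0\<^sub>v 0"])
next
  case (Cons y ys)
  have "supported_basis E (F y @ concat (map F ys)) (S y \<union> (\<Union>x\<in>set ys. S x))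
      (\<lambda>v. P y v \<and> (\<forall>x\<in>set ys. P x v))"
  proof (rule supported_basis_append)
    show "supported_basis E (concat (map F ys)) (\<Union>x\<in>set ys. S x) (\<lambda>v. \<forall>x\<in>set ys. P x v)"
      using Cons.prems by (intro Cons.IH) auto
    show "S y \<inter> (\<Union>x\<in>set ys. S x) = {}"
      using Cons.prems(2) Cons.prems(3)[of y] by fastforce
  qed (use Cons.prems in auto)
  then show ?case by simp
qed

text \<open>The columns of \<open>D\<close> express the functions \<open>f \<circ> \<tau>\<close>, for \<open>f\<close> in the list, by the list itself.\<close>

definition acts_by :: "'e set \<Rightarrow> ('e \<Rightarrow> int) list \<Rightarrow> int mat \<Rightarrow> ('e \<Rightarrow> 'e) \<Rightarrow> bool" where
  "acts_by E fs D \<tau> \<longleftrightarrow> D \<in> carrier_mat (length fs) (length fs) \<and>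
    (\<forall>i<length fs. \<forall>e\<in>E. fun_comb fs (col D i) e = (fs ! i) (\<tau> e))"

lemma fun_comb_zero [simp]: "fun_comb fs (0\<^sub>v (length fs)) e = 0"
  by (simp add: fun_comb_def)

lemma acts_by_append:
  assumes A: "acts_by E fs A \<tau>" and B: "acts_by E gs B \<tau>"
  shows "acts_by E (fs @ gs) (four_block_mat A (0\<^sub>m (dim_row A) (dim_col B)) (0\<^sub>m (dim_row B) (dim_col A)) B) \<tau>"
    (is "acts_by E _ ?D \<tau>")
proof -
  have dims: "A \<in> carrier_mat (length fs) (length fs)" "B \<in> carrier_mat (length gs) (length gs)"
    using A B by (auto simp: acts_by_def)
  have "fun_comb (fs @ gs) (col ?D i) e = ((fs @ gs) ! i) (\<tau> e)" if i: "i < length (fs @ gs)" and e: "e \<in> E" for i e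
  proof (cases "i < length fs")
    case True
    then have "col ?D i = col A i @\<^sub>v 0\<^sub>v (length gs)"
      using dims by (intro eq_vecI) auto
    then show ?thesis
      using True A e dims carrier_vecI[of "col A i" "length fs"]
      by (subst \<open>col ?D i = _\<close>, subst fun_comb_append) (auto simp: acts_by_def nth_append)
  next
    case False
    then have "col ?D i = 0\<^sub>v (length fs) @\<^sub>v col B (i - length fs)"
      using dims i by (intro eq_vecI) auto
    then show ?thesis
      using False B e i dims carrier_vecI[of "col B (i - length fs)" "length gs"]
      by (subst \<open>col ?D i = _\<close>, subst fun_comb_append) (auto simp: acts_by_def nth_append)
  qed
  moreover have "?D \<in> carrier_mat (length (fs @ gs)) (length (fs @ gs))"
    using dims by auto
  ultimately show ?thesis
    by (simp add: acts_by_def)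
qed

lemma acts_by_concat:
  assumes "\<And>x. x \<in> set xs \<Longrightarrow> acts_by E (F x) (D x) \<tau>"
  shows "acts_by E (concat (map F xs)) (diag_block_mat (map D xs)) \<tau>"
  using assms
proof (induction xs)
  case Nil
  show ?case by (simp add: acts_by_def)
next
  case (Cons y ys)
  then show ?case
    using acts_by_append[of E "F y" "D y" \<tau> "concat (map F ys)" "diag_block_mat (map D ys)"]
    by (simp add: Let_def)
qed

lemma fun_comb_unit_vec:
  assumes "i < length fs"
  shows "fun_comb fs (unit_vec (length fs) i) e = (fs ! i) e"
proof -
  have "fun_comb fs (unit_vec (length fs) i) e = (\<Sum>j<length fs. if j = i then (fs ! j) e else 0)"
    unfolding fun_comb_def by (intro sum.cong) (auto simp: unit_vec_def)
  then show ?thesis using assms by simp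
qed

context
  fixes E :: "'e set" and fs :: "('e \<Rightarrow> int) list" and z :: nat and \<epsilon> :: "nat \<Rightarrow> 'e" and w :: int
  assumes len: "length fs = z"
    and inj: "inj_on \<epsilon> {..<z}" and sub: "\<epsilon> ` {..<z} \<subseteq> E"
    and w: "w \<noteq> 0"
begin

lemma supported_basis_indicators:
  assumes fs: "\<And>i e. i < z \<Longrightarrow> e \<in> E \<Longrightarrow> (fs ! i) e = (if e = \<epsilon> i then w else 0)"
  shows "supported_basis E fs (\<epsilon> ` {..<z}) (\<lambda>v. \<forall>e\<in>\<epsilon> ` {..<z}. w dvd v e)"
  unfolding supported_basis_def
proof (intro conjI allI impI ballI sub)
  fix f e assume "f \<in> set fs" "e \<in> E - \<epsilon> ` {..<z}"
  then show "f e = 0"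
    using fs len by (auto simp: in_set_conv_nth)
next
  fix v assume v: "\<forall>e\<in>\<epsilon> ` {..<z}. w dvd v e"
  have comb: "fun_comb fs c (\<epsilon> k) = c $ k * w" if k: "k < z" for c k
  proof -
    have "fun_comb fs c (\<epsilon> k) = (\<Sum>i<z. if i = k then c $ i * w else 0)"
      unfolding fun_comb_def len using k sub inj
      by (intro sum.cong) (auto simp: fs inj_on_eq_iff)
    then show ?thesis using k by simp
  qed
  show "\<exists>!c. c \<in> carrier_vec (length fs) \<and> (\<forall>e\<in>\<epsilon> ` {..<z}. fun_comb fs c e = v e)"
  proof (rule ex1I[of _ "vec z (\<lambda>k. v (\<epsilon> k) div w)"])
    show "vec z (\<lambda>k. v (\<epsilon> k) div w) \<in> carrier_vec (length fs) \<and>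
        (\<forall>e\<in>\<epsilon> ` {..<z}. fun_comb fs (vec z (\<lambda>k. v (\<epsilon> k) div w)) e = v e)"
      using v len by (auto simp: comb)
    fix c assume c: "c \<in> carrier_vec (length fs) \<and> (\<forall>e\<in>\<epsilon> ` {..<z}. fun_comb fs c e = v e)"
    then have "c $ k * w = v (\<epsilon> k)" if "k < z" for k
      using that comb[of k c] by auto
    then show "c = vec z (\<lambda>k. v (\<epsilon> k) div w)"
      using c len w by (intro eq_vecI) (auto simp flip: \<open>\<And>k. k < z \<Longrightarrow> c $ k * w = v (\<epsilon> k)\<close>)
  qed
qed

lemma acts_by_M_mat:
  assumes fs: "\<And>i e. i < z \<Longrightarrow> e \<in> E \<Longrightarrow> (fs ! i) e = (if e = \<epsilon> i then w else 0)"
    and "z \<ge> 1" "\<And>e. e \<in> E \<Longrightarrow> \<tau> e \<in> E"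
    "\<And>k e. k < z \<Longrightarrow> e \<in> E \<Longrightarrow> \<tau> e = \<epsilon> k \<longleftrightarrow> e = \<epsilon> (if k = z - 1 then 0 else k + 1)"
  shows "acts_by E fs (M_mat z) \<tau>"
  unfolding acts_by_def
proof (intro conjI allI impI ballI)
  show "M_mat z \<in> carrier_mat (length fs) (length fs)"
    using assms len by (simp add: M_mat_carrier)
  fix i e assume i: "i < length fs" and e: "e \<in> E"
  let ?j = "if i = z - 1 then 0 else i + 1"
  have j: "?j < z" using i len by auto
  have "fun_comb fs (col (M_mat z) i) e = (fs ! ?j) e"
    using i len j fun_comb_unit_vec[of ?j fs e] col_M_mat[of i z] by (simp only:)
  also have "\<dots> = (fs ! i) (\<tau> e)"
    using i len e assms j by simp
  finally show "fun_comb fs (col (M_mat z) i) e = (fs ! i) (\<tau> e)" .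
qed

text \<open>The span of the constant function \<open>u\<close> and of the multiples of \<open>w = u q\<close> on a cycle is
  cut out by congruences. One indicator is left out of the basis; it is \<open>q\<close> times the
  constant function minus the other indicators, which explains the last column of the matrix.\<close>

context
  fixes u :: int and q :: nat
  assumes z: "z \<ge> 2" and wq: "w = u * int q"
    and fs_0: "\<And>e. e \<in> E \<Longrightarrow> (fs ! 0) e = (if e \<in> \<epsilon> ` {..<z} then u else 0)"
    and fs_Suc: "\<And>i e. Suc i < z \<Longrightarrow> e \<in> E \<Longrightarrow> (fs ! Suc i) e = (if e = \<epsilon> i then w else 0)"
begin

lemma fun_comb_cycle:
  assumes "k < z"
  shows "fun_comb fs c (\<epsilon> k) = c $ 0 * u + (if Suc k < z then c $ Suc k * w else 0)"
proof -
  have "fun_comb fs c (\<epsilon> k) = c $ 0 * u + (\<Sum>i<z - 1. c $ Suc i * (fs ! Suc i) (\<epsilon> k))"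
    using z assms sub unfolding fun_comb_def len
    by (cases z) (auto simp: sum.lessThan_Suc_shift fs_0 simp del: sum.lessThan_Suc)
  also have "(\<Sum>i<z - 1. c $ Suc i * (fs ! Suc i) (\<epsilon> k)) = (\<Sum>i<z - 1. if i = k then c $ Suc i * w else 0)"
    using assms sub inj by (intro sum.cong) (auto simp: fs_Suc inj_on_eq_iff)
  also have "\<dots> = (if Suc k < z then c $ Suc k * w else 0)"
    by auto
  finally show ?thesis .
qed

lemma supported_basis_cycle:
  "supported_basis E fs (\<epsilon> ` {..<z})
    (\<lambda>v. \<forall>e\<in>\<epsilon> ` {..<z}. u dvd v e \<and> (\<forall>e'\<in>\<epsilon> ` {..<z}. w dvd v e - v e'))"
  unfolding supported_basis_def
proof (intro conjI allI impI ballI sub)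
  fix f e assume "f \<in> set fs" "e \<in> E - \<epsilon> ` {..<z}"
  then obtain i where i: "i < z" "f = fs ! i" "e \<in> E - \<epsilon> ` {..<z}"
    using len by (auto simp: in_set_conv_nth)
  then show "f e = 0"
    using fs_0 fs_Suc by (cases i) auto
next
  fix v assume v: "\<forall>e\<in>\<epsilon> ` {..<z}. u dvd v e \<and> (\<forall>e'\<in>\<epsilon> ` {..<z}. w dvd v e - v e')"
  have u: "u \<noteq> 0" using w wq by auto
  define d where "d = vec z (\<lambda>i. if i = 0 then v (\<epsilon> (z - 1)) div u else (v (\<epsilon> (i - 1)) - v (\<epsilon> (z - 1))) div w)"
  show "\<exists>!c. c \<in> carrier_vec (length fs) \<and> (\<forall>e\<in>\<epsilon> ` {..<z}. fun_comb fs c e = v e)"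
  proof (rule ex1I[of _ d])
    have "fun_comb fs d (\<epsilon> k) = v (\<epsilon> k)" if k: "k < z" for k
    proof (cases "Suc k < z")
      case True
      have "v (\<epsilon> (z - 1)) div u * u = v (\<epsilon> (z - 1))" "(v (\<epsilon> k) - v (\<epsilon> (z - 1))) div w * w = v (\<epsilon> k) - v (\<epsilon> (z - 1))"
        using v k by auto
      then show ?thesis
        using True k by (simp add: fun_comb_cycle d_def)
    next
      case False
      then have "k = z - 1" using k by simp
      then show ?thesis
        using v k z by (simp add: fun_comb_cycle d_def)
    qed
    then show "d \<in> carrier_vec (length fs) \<and> (\<forall>e\<in>\<epsilon> ` {..<z}. fun_comb fs d e = v e)"
      using len by (auto simp: d_def)
    fix c assume c: "c \<in> carrier_vec (length fs) \<and> (\<forall>e\<in>\<epsilon> ` {..<z}. fun_comb fs c e = v e)"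
    have c0: "c $ 0 * u = v (\<epsilon> (z - 1))"
      using c z fun_comb_cycle[of "z - 1" c] by auto
    have cS: "c $ Suc k * w = v (\<epsilon> k) - v (\<epsilon> (z - 1))" if "Suc k < z" for k
      using c c0 that fun_comb_cycle[of k c] by auto
    have c0': "v (\<epsilon> (z - 1)) div u = c $ 0"
      unfolding c0[symmetric] using u by simp
    have cS': "(v (\<epsilon> k) - v (\<epsilon> (z - 1))) div w = c $ Suc k" if "Suc k < z" for k
      unfolding cS[OF that, symmetric] using w by simp
    show "c = d"
    proof (rule eq_vecI)
      fix i assume "i < dim_vec d"
      then show "c $ i = d $ i"
        using c0' cS'[of "i - 1"] by (cases i) (auto simp: d_def)
    qed (use c len in \<open>auto simp: d_def\<close>)
  qed
qed

lemma acts_by_N_mat: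
  assumes \<tau>: "\<And>e. e \<in> E \<Longrightarrow> \<tau> e \<in> E"
    "\<And>k e. k < z \<Longrightarrow> e \<in> E \<Longrightarrow> \<tau> e = \<epsilon> k \<longleftrightarrow> e = \<epsilon> (if k = z - 1 then 0 else k + 1)"
  shows "acts_by E fs (N_mat z q) \<tau>"
  unfolding acts_by_def
proof (intro conjI allI impI ballI)
  show "N_mat z q \<in> carrier_mat (length fs) (length fs)"
    using z len by (simp add: N_mat_carrier)
  fix i e assume i: "i < length fs" and e: "e \<in> E"
  have \<tau>_image: "\<tau> e \<in> \<epsilon> ` {..<z} \<longleftrightarrow> e \<in> \<epsilon> ` {..<z}"
  proof
    assume "\<tau> e \<in> \<epsilon> ` {..<z}"
    then obtain k where k: "k < z" "\<tau> e = \<epsilon> k" by auto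
    with \<tau>(2)[of k e] e have "e = \<epsilon> (if k = z - 1 then 0 else k + 1)" by simp
    moreover have "(if k = z - 1 then 0 else k + 1) < z" using k by auto
    ultimately show "e \<in> \<epsilon> ` {..<z}" by blast
  next
    assume "e \<in> \<epsilon> ` {..<z}"
    then obtain k where k: "k < z" "e = \<epsilon> k" by auto
    let ?k = "if k = 0 then z - 1 else k - 1"
    have "?k < z" using k z by auto
    moreover from this have "\<tau> e = \<epsilon> ?k"
      using \<tau>(2)[of ?k e] e k z by (auto split: if_splits)
    ultimately show "\<tau> e \<in> \<epsilon> ` {..<z}" by blast
  qed
  consider "i = 0" | i' where "i = Suc i'" "i \<noteq> z - 1" | "i = z - 1" "i \<noteq> 0"
    by (cases i; cases "i = z - 1") auto
  then show "fun_comb fs (col (N_mat z q) i) e = (fs ! i) (\<tau> e)"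
  proof cases
    case 1
    then show ?thesis
      using i len z e \<tau>(1) fun_comb_unit_vec[of 0 fs e] by (simp add: col_N_mat fs_0 \<tau>_image)
  next
    case 2
    then have "fun_comb fs (col (N_mat z q) i) e = (fs ! Suc i) e"
      using i len z fun_comb_unit_vec[of "Suc i" fs e] by (simp add: col_N_mat)
    also have "\<dots> = (fs ! i) (\<tau> e)"
    proof -
      have "i' < z" "i' \<noteq> z - 1" "Suc i < z" "Suc i' < z"
        using 2 i len by auto
      then show ?thesis
        using 2(1) e \<tau>(1)[of e] \<tau>(2)[of i' e] fs_Suc[of i e] fs_Suc[of i' "\<tau> e"] by simp
    qed
    finally show ?thesis .
  next
    case 3
    let ?v = "vec z (\<lambda>r. if r = 0 then int q else - 1)"
    obtain z' where z': "z = Suc (Suc z')" using z by (cases z; cases "z - 1") auto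
    have "fun_comb fs ?v e = (if e = \<epsilon> (z - 1) then w else 0)"
    proof (cases "e \<in> \<epsilon> ` {..<z}")
      case True
      then obtain k where k: "k < z" "e = \<epsilon> k" by auto
      have "\<epsilon> k = \<epsilon> (z - 1) \<longleftrightarrow> k = z - 1"
        using inj_on_eq_iff[OF inj, of k "z - 1"] k z by auto
      then have "\<epsilon> k = \<epsilon> (z - 1) \<longleftrightarrow> \<not> Suc k < z"
        using k by auto
      then show ?thesis
        using k z by (simp add: fun_comb_cycle wq mult.commute)
    next
      case False
      then have "fun_comb fs ?v e = 0"
        unfolding fun_comb_def
      proof (intro sum.neutral ballI)
        fix j assume "j \<in> {..<length fs}"
        then show "?v $ j * (fs ! j) e = 0"
          using False e len fs_0[of e] fs_Suc[of "j - 1" e] by (cases j) auto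
      qed
      moreover have "e \<noteq> \<epsilon> (z - 1)"
        using False z by auto
      ultimately show ?thesis by simp
    qed
    moreover have "(fs ! i) (\<tau> e) = (if e = \<epsilon> (z - 1) then w else 0)"
      using 3 z' e \<tau>(1) \<tau>(2)[of z' e] by (simp add: fs_Suc)
    ultimately show ?thesis
      using 3 i len z by (simp add: col_N_mat)
  qed
qed

end

end


section \<open>Rotations of the blocks\<close>

definition descending_word :: "(nat \<Rightarrow> bool) \<Rightarrow> nat \<Rightarrow> nat \<Rightarrow> nat word" where
  "descending_word f a b = map (\<lambda>k. (k, f k)) (rev [a..<b])"

lemma descending_word_Suc:
  "a \<le> b \<Longrightarrow> descending_word f a (Suc b) = (b, f b) # descending_word f a b"
  by (simp add: descending_word_def)

lemma word_perm_descending_word: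
  "a \<le> b \<Longrightarrow> word_perm (descending_word f a b) x = (if x = b then a else if a \<le> x \<and> x < b then x + 1 else x)"
proof (induction b arbitrary: x rule: nat_induct_at_least)
  case base
  then show ?case by (simp add: descending_word_def)
next
  case (Suc b)
  then show ?case by (auto simp: descending_word_Suc transpose_def)
qed

lemma linking_descending_word:
  "a \<le> b \<Longrightarrow> linking (descending_word f a b) e =
    (\<Sum>k = a..<b. if e = {k, b} then if f k then 1 else - 1 else 0)"
proof (induction b arbitrary: e rule: nat_induct_at_least)
  case base
  then show ?case by (simp add: descending_word_def)
next
  case (Suc b)
  have "transpose b (b + 1) ` e = {k, b} \<longleftrightarrow> e = {k, Suc b}" if "k \<in> {a..<b}" for k
    unfolding transpose_image_eq_iff using that by (simp add: transpose_def)
  then have "linking (descending_word f a b) (transpose b (b + 1) ` e) =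
      (\<Sum>k = a..<b. if e = {k, Suc b} then if f k then 1 else - 1 else 0)"
    unfolding Suc.IH by (intro sum.cong) auto
  then show ?case
    using Suc.hyps by (simp add: descending_word_Suc)
qed

lemma delta_block_eq:
  assumes "odd k"
  shows "delta_block n s k = quot_class n (descending_word (\<lambda>i. s + (k + 1) div 2 \<le> i) (s + 1) (s + k))"
proof -
  from assms obtain c where k: "k = 2 * c + 1" by (auto elim: oddE)
  let ?f = "\<lambda>i. s + (k + 1) div 2 \<le> i"
  have "[s + 1..<s + k] = [s + 1..<s + c + 1] @ [s + c + 1..<s + k]"
  proof -
    have "s + k = s + c + 1 + c" using k by simp
    then show ?thesis by (simp only:) (rule upt_add_eq_append, simp)
  qed
  then have "descending_word ?f (s + 1) (s + k) =
      map (\<lambda>i. (i, ?f i)) (rev [s + c + 1..<s + k]) @ map (\<lambda>i. (i, ?f i)) (rev [s + 1..<s + c + 1])"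
    by (simp only: descending_word_def rev_append map_append)
  also have "map (\<lambda>i. (i, ?f i)) (rev [s + c + 1..<s + k]) = map (\<lambda>i. (i, True)) (rev [s + c + 1..<s + k])"
    using k by (intro map_cong) auto
  also have "map (\<lambda>i. (i, ?f i)) (rev [s + 1..<s + c + 1]) = map (\<lambda>i. (i, False)) (rev [s + 1..<s + c + 1])"
    using k by (intro map_cong) auto
  finally show ?thesis
    using k by (simp del: upt_Suc add: delta_block_def)
qed

locale cyclic_blocks = braid_quotient n for n :: nat +
  fixes q t :: nat and m :: "nat \<Rightarrow> nat"
  assumes n_eq: "n = (\<Sum>j = 1..t. m j)"
    and m_odd: "j \<in> {1..t} \<Longrightarrow> odd (m j)"
    and m_ge_3: "j \<in> {1..t} \<Longrightarrow> m j \<ge> 3"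
    and m_coprime: "j \<in> {1..t} \<Longrightarrow> h \<in> {1..t} \<Longrightarrow> j \<noteq> h \<Longrightarrow> coprime (m j) (m h)"
    and q_pos: "q > 0"
begin

definition start :: "nat \<Rightarrow> nat" where
  "start j = block_start m (j - 1)"

lemma start_add:
  assumes "1 \<le> j" "j < h"
  shows "start j + m j \<le> start h"
proof -
  have "start j + m j = (\<Sum>i = 1..j. m i)"
    using assms by (cases j) (auto simp: start_def block_start_def)
  also have "\<dots> \<le> start h"
    unfolding start_def block_start_def using assms by (intro sum_mono2) auto
  finally show ?thesis .
qed

lemma start_add_le: "j \<in> {1..t} \<Longrightarrow> start j + m j \<le> n"
proof -
  assume j: "j \<in> {1..t}"
  have "start j + m j = (\<Sum>i = 1..j. m i)"
    using j by (cases j) (auto simp: start_def block_start_def)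
  also have "\<dots> \<le> n"
    unfolding n_eq using j by (intro sum_mono2) auto
  finally show ?thesis .
qed

text \<open>Positions in a block are numbered by integers modulo its length, so that rotations become
translations.\<close>

definition pos :: "nat \<Rightarrow> int \<Rightarrow> nat" where
  "pos j x = start j + 1 + nat (x mod int (m j))"

lemma pos_bounds:
  assumes "j \<in> {1..t}"
  shows "start j + 1 \<le> pos j x" "pos j x \<le> start j + m j"
proof -
  have "nat (x mod int (m j)) < m j"
    using m_ge_3[OF assms] by (simp add: nat_less_iff)
  then show "start j + 1 \<le> pos j x" "pos j x \<le> start j + m j"
    by (auto simp: pos_def)
qed

lemma pos_in: "j \<in> {1..t} \<Longrightarrow> pos j x \<in> {1..n}"
  using pos_bounds[of j x] start_add_le[of j] by auto

lemma pos_eq_iff: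
  assumes "j \<in> {1..t}" "h \<in> {1..t}"
  shows "pos j x = pos h y \<longleftrightarrow> j = h \<and> [x = y] (mod int (m j))"
proof
  assume eq: "pos j x = pos h y"
  have "\<not> j < h" "\<not> h < j"
    using eq pos_bounds[OF assms(1), of x] pos_bounds[OF assms(2), of y] start_add[of j h] start_add[of h j] assms
    by auto
  then have jh: "j = h" by simp
  have "0 \<le> x mod int (m j)" "0 \<le> y mod int (m j)"
    using m_ge_3[OF assms(1)] by auto
  with eq jh show "j = h \<and> [x = y] (mod int (m j))"
    by (simp add: pos_def cong_def)
qed (auto simp: pos_def cong_def)

lemma pos_cong: "[x = y] (mod int (m j)) \<Longrightarrow> pos j x = pos j y"
  by (simp add: pos_def cong_def)

lemma pos_small: "x < m j \<Longrightarrow> pos j (int x) = start j + 1 + x"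
  by (simp add: pos_def)

lemma pos_surj:
  assumes "a \<in> {1..n}"
  obtains j x where "j \<in> {1..t}" "x < m j" "a = pos j (int x)"
proof -
  have "\<exists>j\<in>{1..k}. \<exists>x<m j. a = pos j (int x)" if "1 \<le> a" "a \<le> (\<Sum>j = 1..k. m j)" for k
    using that
  proof (induction k)
    case (Suc k)
    show ?case
    proof (cases "a \<le> (\<Sum>j = 1..k. m j)")
      case True
      then show ?thesis using Suc by fastforce
    next
      case False
      then have "a - 1 - (\<Sum>j = 1..k. m j) < m (Suc k)"
        using Suc.prems by auto
      moreover from this have "a = pos (Suc k) (int (a - 1 - (\<Sum>j = 1..k. m j)))"
        using False Suc.prems by (subst pos_small) (auto simp: start_def block_start_def)
      ultimately show ?thesis by (intro bexI[of _ "Suc k"]) auto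
    qed
  qed auto
  from this[of t] assms that show ?thesis by (auto simp: n_eq)
qed

definition rotates :: "nat word set set \<Rightarrow> (nat \<Rightarrow> int) \<Rightarrow> bool" where
  "rotates x a \<longleftrightarrow> (\<forall>j\<in>{1..t}. \<forall>z. quot_perm x (pos j z) = pos j (z + a j))"

lemma rotates_one: "rotates \<one>\<^bsub>Q\<^esub> (\<lambda>_. 0)"
  by (simp add: rotates_def)

lemma rotates_mult:
  assumes "x \<in> carrier Q" "y \<in> carrier Q" "rotates x a" "rotates y b"
  shows "rotates (x \<cdot> y) (\<lambda>j. a j + b j)"
  using assms by (simp add: rotates_def quot_perm_mult add.assoc)

lemma rotates_inv:
  assumes "x \<in> carrier Q" "rotates x a"
  shows "rotates (inv\<^bsub>Q\<^esub> x) (\<lambda>j. - a j)"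
  unfolding rotates_def
proof (intro ballI allI)
  fix j z assume "j \<in> {1..t}"
  then have "quot_perm x (pos j (z - a j)) = pos j z"
    using assms(2) by (simp add: rotates_def)
  moreover have "inj (quot_perm x)"
    using quot_perm_permutes[OF assms(1)] by (rule permutes_inj)
  ultimately show "quot_perm (inv\<^bsub>Q\<^esub> x) (pos j z) = pos j (z + - a j)"
    using assms(1) by (metis quot_perm_inv inv_f_f uminus_add_conv_diff add.commute)
qed

lemma rotates_perm_eq:
  assumes "x \<in> carrier Q" "y \<in> carrier Q" "rotates x a" "rotates y b"
    "\<And>j. j \<in> {1..t} \<Longrightarrow> [a j = b j] (mod int (m j))"
  shows "quot_perm x = quot_perm y"
proof
  fix i
  show "quot_perm x i = quot_perm y i"
  proof (cases "i \<in> {1..n}")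
    case True
    then obtain j z where jz: "j \<in> {1..t}" "i = pos j (int z)"
      by (elim pos_surj)
    then have "pos j (int z + a j) = pos j (int z + b j)"
      using assms(5) by (intro pos_cong cong_add) auto
    then show ?thesis
      using jz assms by (simp add: rotates_def)
  next
    case False
    then show ?thesis
      using assms quot_perm_permutes by (metis permutes_not_in)
  qed
qed

lemma rotates_id_cong:
  assumes "rotates x a" "quot_perm x = id" "j \<in> {1..t}"
  shows "int (m j) dvd a j"
proof -
  have "pos j (0 + a j) = pos j 0"
    using assms unfolding rotates_def by (metis id_apply)
  then show ?thesis
    using assms by (simp add: pos_eq_iff cong_0_iff)
qed

definition block_delta :: "nat \<Rightarrow> nat word set set" where
  "block_delta j = delta_block n (start j) (m j)"

lemma descending_word_in: "1 \<le> a \<Longrightarrow> b \<le> n \<Longrightarrow> descending_word f a b \<in> W"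
  by (auto simp: descending_word_def words_def)

lemma block_delta_class:
  assumes "j \<in> {1..t}"
  defines "w \<equiv> descending_word (\<lambda>i. start j + (m j + 1) div 2 \<le> i) (start j + 1) (start j + m j)"
  shows "block_delta j = cls w" "w \<in> W"
  using assms start_add_le[OF assms(1)] m_odd[OF assms(1)]
  by (auto simp: block_delta_def delta_block_eq intro!: descending_word_in)

lemma block_delta_carrier [simp]: "j \<in> {1..t} \<Longrightarrow> block_delta j \<in> carrier Q"
  by (metis block_delta_class quot_class_in_carrier)

lemma quot_perm_block_delta:
  assumes j: "j \<in> {1..t}"
  shows "quot_perm (block_delta j) x = (if x = start j + m j then start j + 1
    else if start j + 1 \<le> x \<and> x < start j + m j then x + 1 else x)"
  unfolding block_delta_class(1)[OF j] quot_perm_class[OF block_delta_class(2)[OF j]]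
  using m_ge_3[OF j] by (intro word_perm_descending_word) auto

lemma lk_block_delta:
  assumes j: "j \<in> {1..t}"
  shows "lk (block_delta j) e = (\<Sum>k = start j + 1..<start j + m j.
    if e = {k, start j + m j} then if start j + (m j + 1) div 2 \<le> k then 1 else - 1 else 0)"
  unfolding block_delta_class(1)[OF j] lk_class[OF block_delta_class(2)[OF j]]
  using m_ge_3[OF j] by (intro linking_descending_word) auto

lemma mod_Suc_int:
  assumes "k > (0 :: int)"
  shows "(x + 1) mod k = (if x mod k = k - 1 then 0 else x mod k + 1)"
proof -
  have "(x + 1) mod k = (x mod k + 1) mod k"
    by (simp add: mod_add_left_eq)
  moreover have "0 \<le> x mod k" "x mod k < k"
    using assms by auto
  ultimately show ?thesis by auto
qed

lemma rotates_block_delta: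
  assumes j: "j \<in> {1..t}"
  shows "rotates (block_delta j) (\<lambda>i. if i = j then 1 else 0)"
  unfolding rotates_def
proof (intro ballI allI)
  fix i z assume i: "i \<in> {1..t}"
  show "quot_perm (block_delta j) (pos i z) = pos i (z + (if i = j then 1 else 0))"
  proof (cases "i = j")
    case True
    define r where "r = nat (z mod int (m j))"
    have r: "z mod int (m j) = int r" "r < m j"
      using m_ge_3[OF j] by (auto simp: r_def nat_less_iff)
    have "(z + 1) mod int (m j) = int (if r = m j - 1 then 0 else r + 1)"
      using mod_Suc_int[of "int (m j)" z] m_ge_3[OF j] r by (auto simp: of_nat_diff)
    then have "pos j z = start j + 1 + r" "pos j (z + 1) = start j + 1 + (if r = m j - 1 then 0 else r + 1)"
      using r(1) by (simp_all only: pos_def nat_int)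
    then show ?thesis
      using True r(2) by (auto simp: quot_perm_block_delta[OF j])
  next
    case False
    then show ?thesis
      using pos_bounds[OF i, of z] start_add[of i j] start_add[of j i] m_ge_3[OF j] i j
      by (cases "i < j") (auto simp: quot_perm_block_delta[OF j])
  qed
qed

text \<open>The indicator function of these pairs is a potential for the crossings of \<open>\<delta>\<close>, see
\<open>rlk_block_delta\<close>.\<close>

definition wide :: "nat set \<Rightarrow> bool" where
  "wide e \<longleftrightarrow> (\<exists>j\<in>{1..t}. \<exists>x y. x < y \<and> y < m j \<and> m j < 2 * (y - x) \<and> e = {pos j (int x), pos j (int y)})"

lemma pos_int_eq_iff:
  assumes "j \<in> {1..t}" "h \<in> {1..t}" "x < m j" "y < m h"
  shows "pos j (int x) = pos h (int y) \<longleftrightarrow> j = h \<and> x = y"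
  using assms by (auto simp: pos_eq_iff cong_def)

lemma wide_same_block:
  assumes j: "j \<in> {1..t}" and xy: "x < y" "y < m j"
  shows "wide {pos j (int x), pos j (int y)} \<longleftrightarrow> m j < 2 * (y - x)"
proof
  assume "wide {pos j (int x), pos j (int y)}"
  then obtain h x' y' where h: "h \<in> {1..t}" "x' < y'" "y' < m h" "m h < 2 * (y' - x')"
    "{pos j (int x), pos j (int y)} = {pos h (int x'), pos h (int y')}"
    by (auto simp: wide_def)
  have "j = h \<and> x = x' \<and> y = y'"
    using h(5) j xy h(1-3) by (auto simp: doubleton_eq_iff pos_int_eq_iff)
  then show "m j < 2 * (y - x)" using h by simp
next
  assume "m j < 2 * (y - x)"
  with assms show "wide {pos j (int x), pos j (int y)}"
    unfolding wide_def by blast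
qed

lemma not_wide_cross:
  assumes "i \<in> {1..t}" "h \<in> {1..t}" "i \<noteq> h"
  shows "\<not> wide {pos i x, pos h y}"
proof
  assume "wide {pos i x, pos h y}"
  then obtain j x' y' where j: "j \<in> {1..t}" "{pos i x, pos h y} = {pos j (int x'), pos j (int y')}"
    unfolding wide_def by blast
  then have "pos i x = pos j (int x') \<or> pos i x = pos j (int y')"
    "pos h y = pos j (int x') \<or> pos h y = pos j (int y')"
    by (auto simp: doubleton_eq_iff)
  then have "i = j" "h = j"
    using assms j(1) pos_eq_iff by blast+
  with assms show False by simp
qed

lemma pair_cases:
  assumes "e \<in> pairs n"
  obtains (same) j x y where "j \<in> {1..t}" "x < y" "y < m j" "e = {pos j (int x), pos j (int y)}"
  | (cross) i h x y where "i \<in> {1..t}" "h \<in> {1..t}" "i < h" "x < m i" "y < m h"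
      "e = {pos i (int x), pos h (int y)}"
proof -
  obtain a b where "1 \<le> a" "a < b" "b \<le> n" and e: "e = {a, b}"
    using assms unfolding pairs_eq by blast
  then have ab: "a \<in> {1..n}" "b \<in> {1..n}" "a \<noteq> b"
    by auto
  obtain i x where ix: "i \<in> {1..t}" "x < m i" "a = pos i (int x)"
    using pos_surj[OF ab(1)] by blast
  obtain h y where hy: "h \<in> {1..t}" "y < m h" "b = pos h (int y)"
    using pos_surj[OF ab(2)] by blast
  consider "i < h" | "h < i" | "i = h" "x < y" | "i = h" "y < x"
    using ab ix hy by (cases "i = h"; cases "x = y") (auto simp: nat_neq_iff)
  then show thesis
  proof cases
    case 1
    then show ?thesis using cross[of i h x y] e ix hy by simp
  next
    case 2
    then show ?thesis using cross[of h i y x] e ix hy by (simp add: insert_commute)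
  next
    case 3
    then show ?thesis using same[of i x y] e ix hy by simp
  next
    case 4
    then show ?thesis using same[of i y x] e ix hy by (simp add: insert_commute)
  qed
qed

lemma perm_image_pairs: "x \<in> carrier Q \<Longrightarrow> e \<in> pairs n \<Longrightarrow> quot_perm x ` e \<in> pairs n"
  unfolding pairs_def mem_Collect_eq
  by (metis card_image image_mono permutes_image permutes_inj_on quot_perm_permutes)

text \<open>The linking numbers, changed by a coboundary. The changed cocycle agrees with the old one on pure
braids and vanishes on the rotations \<open>\<delta>\<close>.\<close>

definition rlk :: "nat word set set \<Rightarrow> nat set \<Rightarrow> int" where
  "rlk x e = lk x e - of_bool (wide (quot_perm x ` e)) + of_bool (wide e)"

lemma rlk_one [simp]: "rlk \<one>\<^bsub>Q\<^esub> e = 0"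
  by (simp add: rlk_def)

lemma rlk_mult:
  "x \<in> carrier Q \<Longrightarrow> y \<in> carrier Q \<Longrightarrow> rlk (x \<cdot> y) e = rlk x e + rlk y (quot_perm x ` e)"
  by (simp add: rlk_def lk_mult quot_perm_mult image_comp)

lemma rlk_inv:
  assumes "x \<in> carrier Q"
  shows "rlk (inv\<^bsub>Q\<^esub> x) e = - rlk x (quot_perm (inv\<^bsub>Q\<^esub> x) ` e)"
  using rlk_mult[of "inv\<^bsub>Q\<^esub> x" x e] assms by simp

lemma rlk_pure: "x \<in> pure_quot n \<Longrightarrow> rlk x e = lk x e"
  by (simp add: rlk_def pure_quot_altdef)

lemma rotates_image:
  assumes "rotates x a" "i \<in> {1..t}" "h \<in> {1..t}"
  shows "quot_perm x ` {pos i y, pos h z} = {pos i (y + a i), pos h (z + a h)}"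
  using assms by (auto simp: rotates_def)

lemma pos_last: "j \<in> {1..t} \<Longrightarrow> pos j (int (m j - 1)) = start j + m j"
  using m_ge_3[of j] pos_small[of "m j - 1" j] by linarith

lemma lk_block_delta_last:
  assumes j: "j \<in> {1..t}" and x: "x < m j - 1"
  shows "lk (block_delta j) {pos j (int x), pos j (int (m j - 1))} = (if m j < 2 * (x + 1) then 1 else - 1)"
proof -
  let ?p = "pos j (int x)" and ?l = "start j + m j"
  have m: "m j \<ge> 3" "odd (m j)" using m_ge_3 m_odd j by auto
  have p: "?p = start j + 1 + x" "pos j (int (m j - 1)) = ?l"
    using x pos_last[OF j] by (auto simp: pos_small)
  have "lk (block_delta j) {?p, ?l} = (\<Sum>k = start j + 1..<?l.
      if k = ?p then if start j + (m j + 1) div 2 \<le> k then 1 else - 1 else 0)"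
    unfolding lk_block_delta[OF j] using p x by (intro sum.cong) (auto simp: doubleton_eq_iff)
  also have "\<dots> = (if start j + (m j + 1) div 2 \<le> ?p then 1 else - 1)"
    using p x by simp
  also have "start j + (m j + 1) div 2 \<le> ?p \<longleftrightarrow> m j < 2 * (x + 1)"
    using m by (auto simp: p elim!: oddE)
  finally show ?thesis by (simp only: p)
qed

lemma lk_block_delta_zero:
  assumes j: "j \<in> {1..t}"
    and e: "\<And>x. x < m j - 1 \<Longrightarrow> e \<noteq> {pos j (int x), pos j (int (m j - 1))}"
  shows "lk (block_delta j) e = 0"
  unfolding lk_block_delta[OF j]
proof (intro sum.neutral ballI)
  fix k assume "k \<in> {start j + 1..<start j + m j}"
  then obtain x where "k = start j + 1 + x" "x < m j - 1"
    using nat_le_iff_add[of "start j + 1" k] by auto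
  then show "(if e = {k, start j + m j} then if start j + (m j + 1) div 2 \<le> k then 1 else - 1 else 0) = (0 :: int)"
    using e[of x] pos_last[OF j] pos_small[of x j] by simp
qed

text \<open>The strand from the last to the first position of a block crosses the strands from the upper half
  of the block positively and those from the lower half negatively. The former pairs are those that
  become wide by the rotation, and the latter are those that cease to be wide.\<close>

lemma rlk_block_delta:
  assumes j: "j \<in> {1..t}" and e: "e \<in> pairs n"
  shows "rlk (block_delta j) e = 0"
  using e
proof (cases rule: pair_cases)
  case (cross i h x y)
  have "lk (block_delta j) e = 0"
  proof (rule lk_block_delta_zero[OF j])
    fix x' assume x': "x' < m j - 1"
    have "m j - 1 < m j" using m_ge_3[OF j] by simp
    then show "e \<noteq> {pos j (int x'), pos j (int (m j - 1))}"
      using cross j by (metis doubleton_eq_iff pos_eq_iff less_irrefl)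
  qed
  then show ?thesis
    using cross rotates_image[OF rotates_block_delta[OF j], of i h "int x" "int y"] not_wide_cross[of i h]
    by (simp add: rlk_def)
next
  case (same i x y)
  show ?thesis
  proof (cases "i = j \<and> y = m j - 1")
    case True
    have m: "m j \<ge> 3" "odd (m j)" using m_ge_3 m_odd j by auto
    have e': "e = {pos j (int x), pos j (int (m j - 1))}" "x < m j - 1"
      using same True by auto
    have "quot_perm (block_delta j) ` e = {pos j (int x + 1), pos j (int (m j - 1) + 1)}"
      unfolding e' using rotates_image[OF rotates_block_delta[OF j] j j] by simp
    also have "pos j (int (m j - 1) + 1) = pos j (int 0)"
      using m by (intro pos_cong) (auto simp: cong_def of_nat_diff)
    also have "{pos j (int x + 1), pos j (int 0)} = {pos j (int 0), pos j (int (x + 1))}"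
      by (simp add: insert_commute)
    finally have "wide (quot_perm (block_delta j) ` e) \<longleftrightarrow> m j < 2 * (x + 1)"
      using wide_same_block[OF j, of 0 "x + 1"] e' by simp
    moreover have "m j < 2 * (m j - 1 - x) \<longleftrightarrow> \<not> m j < 2 * (x + 1)"
      using m(2) e'(2) by presburger
    then have "wide e \<longleftrightarrow> \<not> m j < 2 * (x + 1)"
      unfolding e' using wide_same_block[OF j, of x "m j - 1"] e'(2) m(1) by (simp del: of_nat_diff)
    moreover have "lk (block_delta j) e = (if m j < 2 * (x + 1) then 1 else - 1)"
      unfolding e' by (rule lk_block_delta_last[OF j e'(2)])
    ultimately show ?thesis by (simp add: rlk_def)
  next
    case False
    have "lk (block_delta j) e = 0"
    proof (rule lk_block_delta_zero[OF j])
      fix x' assume x': "x' < m j - 1"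
      have l: "m j - 1 < m j" using m_ge_3[OF j] by simp
      show "e \<noteq> {pos j (int x'), pos j (int (m j - 1))}"
      proof
        assume "e = {pos j (int x'), pos j (int (m j - 1))}"
        then have "pos i (int x) = pos j (int x') \<and> pos i (int y) = pos j (int (m j - 1)) \<or>
            pos i (int x) = pos j (int (m j - 1)) \<and> pos i (int y) = pos j (int x')"
          using same by (simp only: doubleton_eq_iff)
        then have "i = j \<and> (x = x' \<and> y = m j - 1 \<or> x = m j - 1 \<and> y = x')"
          unfolding pos_int_eq_iff[OF same(1) j less_trans[OF same(2,3)] less_trans[OF x' l]]
            pos_int_eq_iff[OF same(1) j less_trans[OF same(2,3)] l]
            pos_int_eq_iff[OF same(1) j same(3) less_trans[OF x' l]] pos_int_eq_iff[OF same(1) j same(3) l]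
          by blast
        then show "False"
          using False same x' by auto
      qed
    qed
    moreover have "wide (quot_perm (block_delta j) ` e) \<longleftrightarrow> wide e"
    proof (cases "i = j")
      case True
      then have "y + 1 < m j" using same False by auto
      then show ?thesis
        using True same rotates_image[OF rotates_block_delta[OF j] j j, of "int x" "int y"]
          wide_same_block[OF j, of "x + 1" "y + 1"] wide_same_block[OF j, of x y]
        by (simp add: add.commute)
    next
      case False
      then show ?thesis
        using same rotates_image[OF rotates_block_delta[OF j], of i i "int x" "int y"] by simp
    qed
    ultimately show ?thesis by (simp add: rlk_def)
  qed
qed


section \<open>The groups \<open>\<Gamma>\<close> and their translation lattices\<close>

definition adjacent_pairs :: "nat \<Rightarrow> nat set set" where
  "adjacent_pairs j = {{pos j z, pos j (z + 1)} | z. True}"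

abbreviation "all_adjacent \<equiv> \<Union>j\<in>{1..t}. adjacent_pairs j"

text \<open>While the adjacent pair at \<open>z\<close> moves \<open>a j \<ge> 0\<close> steps, it meets the first pair of its block as
often as there are multiples of \<open>m j\<close> in \<open>{z..<z + a j}\<close>. The difference of quotients is this number,
continued to a cocycle in \<open>a\<close>, and each meeting contributes the two crossings of a factor \<open>A\<close>. For
\<open>d = 0\<close> the congruences are equations.\<close>

definition twisted :: "int \<Rightarrow> nat word set set \<Rightarrow> (nat \<Rightarrow> int) \<Rightarrow> bool" where
  "twisted d x a \<longleftrightarrow> x \<in> carrier Q \<and> rotates x a \<and>
    (\<forall>j\<in>{1..t}. \<forall>z. [rlk x {pos j z, pos j (z + 1)} =
      2 * ((z - 1 + a j) div int (m j) - (z - 1) div int (m j))] (mod d)) \<and>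
    (\<forall>e\<in>pairs n - all_adjacent. [rlk x e = 0] (mod d))"

lemma twistedD:
  assumes "twisted d x a"
  shows "x \<in> carrier Q" "rotates x a"
    "j \<in> {1..t} \<Longrightarrow> [rlk x {pos j z, pos j (z + 1)} =
      2 * ((z - 1 + a j) div int (m j) - (z - 1) div int (m j))] (mod d)"
    "e \<in> pairs n - all_adjacent \<Longrightarrow> [rlk x e = 0] (mod d)"
  using assms unfolding twisted_def by blast+

lemma twisted_one: "twisted d \<one>\<^bsub>Q\<^esub> (\<lambda>_. 0)"
  by (simp add: twisted_def rotates_one)

lemma rotates_adjacent:
  assumes "rotates x a" "j \<in> {1..t}"
  shows "quot_perm x ` {pos j z, pos j (z + 1)} = {pos j (z + a j), pos j (z + a j + 1)}"
  using rotates_image[OF assms(1,2,2), of z "z + 1"] by (simp add: ac_simps)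

lemma rotates_not_adjacent:
  assumes "x \<in> carrier Q" "rotates x a" "e \<in> pairs n - all_adjacent"
  shows "quot_perm x ` e \<in> pairs n - all_adjacent"
proof -
  have *: "e \<in> adjacent_pairs j" if j: "j \<in> {1..t}" "quot_perm x ` e = {pos j z, pos j (z + 1)}" for j z
  proof -
    have "quot_perm x ` e = quot_perm x ` {pos j (z - a j), pos j (z - a j + 1)}"
      using rotates_adjacent[OF assms(2) j(1), of "z - a j"] j(2) by simp
    then have "e = {pos j (z - a j), pos j (z - a j + 1)}"
      using permutes_inj[OF quot_perm_permutes[OF assms(1)]] by (simp only: inj_image_eq_iff)
    then show ?thesis by (auto simp: adjacent_pairs_def)
  qed
  show ?thesis
  proof (intro DiffI notI)
    show "quot_perm x ` e \<in> pairs n"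
      using assms(1,3) perm_image_pairs by blast
    assume "quot_perm x ` e \<in> all_adjacent"
    then obtain j z where "j \<in> {1..t}" "quot_perm x ` e = {pos j z, pos j (z + 1)}"
      unfolding adjacent_pairs_def by blast
    with *[of j z] assms(3) show False by blast
  qed
qed

lemma twisted_mult:
  assumes x: "twisted d x a" and y: "twisted d y b"
  shows "twisted d (x \<cdot> y) (\<lambda>j. a j + b j)"
  unfolding twisted_def
proof (intro conjI ballI allI)
  have car: "x \<in> carrier Q" "y \<in> carrier Q" and rot: "rotates x a" "rotates y b"
    using x y by (auto simp: twisted_def)
  show "x \<cdot> y \<in> carrier Q" using car by simp
  show "rotates (x \<cdot> y) (\<lambda>j. a j + b j)"
    using car rot by (rule rotates_mult)
  fix j z assume j: "j \<in> {1..t}"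
  let ?d = "\<lambda>z. z div int (m j)"
  have "[rlk x {pos j z, pos j (z + 1)} + rlk y {pos j (z + a j), pos j (z + a j + 1)} =
      2 * (?d (z - 1 + a j) - ?d (z - 1)) + 2 * (?d (z + a j - 1 + b j) - ?d (z + a j - 1))] (mod d)"
    by (rule cong_add[OF twistedD(3)[OF x j] twistedD(3)[OF y j]])
  moreover have "2 * (?d (z - 1 + a j) - ?d (z - 1)) + 2 * (?d (z + a j - 1 + b j) - ?d (z + a j - 1)) =
      2 * (?d (z - 1 + (a j + b j)) - ?d (z - 1))"
    by (simp add: algebra_simps)
  ultimately show "[rlk (x \<cdot> y) {pos j z, pos j (z + 1)} = 2 * (?d (z - 1 + (a j + b j)) - ?d (z - 1))] (mod d)"
    by (simp only: rlk_mult[OF car] rotates_adjacent[OF rot(1) j])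
next
  fix e assume e: "e \<in> pairs n - all_adjacent"
  have car: "x \<in> carrier Q" "y \<in> carrier Q" and rot: "rotates x a"
    using x y by (auto simp: twisted_def)
  have "[rlk x e + rlk y (quot_perm x ` e) = 0 + 0] (mod d)"
    by (rule cong_add[OF twistedD(4)[OF x e] twistedD(4)[OF y rotates_not_adjacent[OF car(1) rot e]]])
  then show "[rlk (x \<cdot> y) e = 0] (mod d)"
    using rlk_mult[OF car] by simp
qed

lemma twisted_inv:
  assumes x: "twisted d x a"
  shows "twisted d (inv\<^bsub>Q\<^esub> x) (\<lambda>j. - a j)"
  unfolding twisted_def
proof (intro conjI ballI allI)
  have car: "x \<in> carrier Q" and rot: "rotates x a"
    using x by (auto simp: twisted_def)
  show "inv\<^bsub>Q\<^esub> x \<in> carrier Q" using car by simp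
  show rot': "rotates (inv\<^bsub>Q\<^esub> x) (\<lambda>j. - a j)"
    using car rot by (rule rotates_inv)
  fix j z assume j: "j \<in> {1..t}"
  let ?d = "\<lambda>z. z div int (m j)"
  have "[- rlk x {pos j (z - a j), pos j (z - a j + 1)} = - (2 * (?d (z - a j - 1 + a j) - ?d (z - a j - 1)))] (mod d)"
    unfolding cong_minus_minus_iff by (rule twistedD(3)[OF x j])
  moreover have "- (2 * (?d (z - a j - 1 + a j) - ?d (z - a j - 1))) = 2 * (?d (z - 1 + - a j) - ?d (z - 1))"
    by (simp add: algebra_simps)
  ultimately show "[rlk (inv\<^bsub>Q\<^esub> x) {pos j z, pos j (z + 1)} = 2 * (?d (z - 1 + - a j) - ?d (z - 1))] (mod d)"
    by (simp only: rlk_inv[OF car] rotates_adjacent[OF rot' j] diff_conv_add_uminus)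
next
  fix e assume e: "e \<in> pairs n - all_adjacent"
  have car: "x \<in> carrier Q" and rot: "rotates x a"
    using x by (auto simp: twisted_def)
  have "quot_perm (inv\<^bsub>Q\<^esub> x) ` e \<in> pairs n - all_adjacent"
    using car rotates_inv[OF car rot] e by (intro rotates_not_adjacent) auto
  then have "[- rlk x (quot_perm (inv\<^bsub>Q\<^esub> x) ` e) = - 0] (mod d)"
    unfolding cong_minus_minus_iff by (rule twistedD(4)[OF x])
  then show "[rlk (inv\<^bsub>Q\<^esub> x) e = 0] (mod d)"
    using rlk_inv[OF car] by simp
qed

lemma twisted_pow:
  assumes "twisted d x a"
  shows "twisted d (x [^]\<^bsub>Q\<^esub> (k :: nat)) (\<lambda>j. int k * a j)"
proof (induction k)
  case (Suc k)
  have "twisted d (x [^]\<^bsub>Q\<^esub> k \<cdot> x) (\<lambda>j. int k * a j + a j)"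
    using Suc assms by (rule twisted_mult)
  then show ?case by (simp add: algebra_simps)
qed (simp add: twisted_one)

end

lemma div_diff_pred:
  fixes z k :: int
  assumes "k > 0"
  shows "z div k - (z - 1) div k = (if k dvd z then 1 else 0)"
proof (cases "k dvd z")
  case True
  then obtain c where c: "z = k * c" by auto
  have "(z - 1) div k = c - 1"
    using assms by (intro int_div_pos_eq[of _ _ _ "k - 1"]) (auto simp: c algebra_simps)
  then show ?thesis using True c assms by simp
next
  case False
  then have "0 < z mod k" "z mod k < k"
    using assms pos_mod_sign[of k z] pos_mod_bound[of k z] by (simp_all add: dvd_eq_mod_eq_0 order_less_le)
  moreover have "z - 1 = k * (z div k) + (z mod k - 1)"
    using mult_div_mod_eq[of k z] by linarith
  ultimately have "(z - 1) div k = z div k"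
    using int_div_pos_eq[of "z - 1" k "z div k" "z mod k - 1"] by simp
  then show ?thesis using False by simp
qed

context braid_quotient
begin

lemma conj_pure:
  assumes "g \<in> carrier Q" "x \<in> pure_quot n"
  shows "g \<cdot> x \<cdot> inv\<^bsub>Q\<^esub> g \<in> pure_quot n"
    and "lk (g \<cdot> x \<cdot> inv\<^bsub>Q\<^esub> g) e = lk x (quot_perm g ` e)"
proof -
  have x: "x \<in> carrier Q" "quot_perm x = id"
    using assms(2) by (auto simp: pure_quot_altdef)
  have bij: "bij (quot_perm g)"
    using quot_perm_permutes[OF assms(1)] by (rule permutes_bij)
  have "quot_perm (inv\<^bsub>Q\<^esub> g) ` quot_perm g ` e = e"
    using bij assms(1) by (simp add: quot_perm_inv image_comp bij_is_inj)
  then show "lk (g \<cdot> x \<cdot> inv\<^bsub>Q\<^esub> g) e = lk x (quot_perm g ` e)"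
    using x assms(1) by (simp add: lk_mult lk_inv quot_perm_mult)
  show "g \<cdot> x \<cdot> inv\<^bsub>Q\<^esub> g \<in> pure_quot n"
    using x assms(1) bij by (auto simp: pure_quot_altdef quot_perm_mult quot_perm_inv bij_is_inj)
qed

lemma pure_gen_pure: "1 \<le> a \<Longrightarrow> a < b \<Longrightarrow> b \<le> n \<Longrightarrow> pure_gen n a b \<in> pure_quot n"
  using pure_gens_subset unfolding pure_gens_def by blast

lemma pure_gen_pow_pure:
  assumes "1 \<le> a" "a < b" "b \<le> n"
  shows "pure_gen n a b [^]\<^bsub>Q\<^esub> (k :: nat) \<in> pure_quot n"
    and "lk (pure_gen n a b [^]\<^bsub>Q\<^esub> k) e = (if e = {a, b} then 2 * int k else 0)"
proof -
  have A: "pure_gen n a b \<in> pure_quot n"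
    using assms by (rule pure_gen_pure)
  then show "lk (pure_gen n a b [^]\<^bsub>Q\<^esub> k) e = (if e = {a, b} then 2 * int k else 0)"
    using assms by (simp add: lk_nat_pow lk_pure_gen)
  show "pure_gen n a b [^]\<^bsub>Q\<^esub> k \<in> pure_quot n"
    using Q.subgroup_int_pow_closed[OF subgroup_pure_quot A, of "int k"] by (simp add: int_pow_int)
qed

end

context cyclic_blocks
begin

definition gamma :: "nat \<Rightarrow> nat word set set" where
  "gamma j = twisted_delta n m (j - 1)"

lemma gamma_eq:
  "j \<in> {1..t} \<Longrightarrow> gamma j = pure_gen n (start j + 1) (start j + 2) \<cdot> block_delta j"
  by (simp add: gamma_def twisted_delta_def start_def block_delta_def)

lemma start_pair_bounds: "j \<in> {1..t} \<Longrightarrow> start j + 3 \<le> n"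
  using start_add_le[of j] m_ge_3[of j] by linarith

lemma gamma_carrier: "j \<in> {1..t} \<Longrightarrow> gamma j \<in> carrier Q"
  using pure_gen_pure[of "start j + 1" "start j + 2"] start_pair_bounds[of j]
  by (simp add: gamma_eq pure_quot_altdef)

lemma rlk_gamma:
  assumes "j \<in> {1..t}" "e \<in> pairs n"
  shows "rlk (gamma j) e = (if e = {pos j 0, pos j 1} then 2 else 0)"
proof -
  have A: "pure_gen n (start j + 1) (start j + 2) \<in> pure_quot n"
    using start_pair_bounds[OF assms(1)] by (intro pure_gen_pure) auto
  have "pos j 0 = start j + 1" "pos j 1 = start j + 2"
    using pos_small[of 0 j] pos_small[of 1 j] m_ge_3[OF assms(1)] by auto
  then show ?thesis
    using assms A start_pair_bounds[OF assms(1)] rlk_block_delta[OF assms] rlk_pure[OF A]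
    by (simp add: gamma_eq rlk_mult lk_pure_gen pure_quot_altdef)
qed

lemma adjacent_eq_first_iff:
  assumes "i \<in> {1..t}" "j \<in> {1..t}"
  shows "{pos i z, pos i (z + 1)} = {pos j 0, pos j 1} \<longleftrightarrow> i = j \<and> int (m j) dvd z"
proof
  assume eq: "{pos i z, pos i (z + 1)} = {pos j 0, pos j 1}"
  then consider "pos i z = pos j 0" | "pos i z = pos j 1" "pos i (z + 1) = pos j 0"
    by (auto simp: doubleton_eq_iff)
  then show "i = j \<and> int (m j) dvd z"
  proof cases
    case 1
    then show ?thesis using assms by (auto simp: pos_eq_iff cong_0_iff)
  next
    case 2
    then have ij: "i = j" and "[z = 1] (mod int (m j))" "[z + 1 = 0] (mod int (m j))"
      using assms by (auto simp: pos_eq_iff)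
    then have "[1 + 1 = 0] (mod int (m j))"
      by (metis cong_add_rcancel cong_sym cong_trans)
    then have "int (m j) dvd 2"
      by (simp add: cong_0_iff)
    then have "int (m j) \<le> 2" by (rule zdvd_imp_le) simp
    then show ?thesis using m_ge_3[OF assms(2)] by simp
  qed
next
  assume *: "i = j \<and> int (m j) dvd z"
  then have "pos j z = pos j 0" "pos j (z + 1) = pos j 1"
    by (auto intro!: pos_cong simp: cong_iff_dvd_diff)
  with * show "{pos i z, pos i (z + 1)} = {pos j 0, pos j 1}" by simp
qed

lemma adjacent_in_pairs:
  assumes "j \<in> {1..t}"
  shows "{pos j z, pos j (z + 1)} \<in> pairs n"
proof -
  have "pos j z \<noteq> pos j (z + 1)"
  proof
    assume "pos j z = pos j (z + 1)"
    then have "[z = z + 1] (mod int (m j))"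
      using assms by (simp add: pos_eq_iff)
    then have "int (m j) dvd 1"
      by (simp add: cong_iff_dvd_diff)
    then show False using m_ge_3[OF assms] by simp
  qed
  then show ?thesis
    using pos_in[OF assms] by (auto simp: pairs_def card_2_iff)
qed

text \<open>One step over the origin happens exactly for the multiples of the length of the block, see
\<open>div_diff_pred\<close>.\<close>

lemma twisted_gamma:
  assumes j: "j \<in> {1..t}"
  shows "twisted d (gamma j) (\<lambda>i. if i = j then 1 else 0)"
  unfolding twisted_def
proof (intro conjI ballI allI)
  show "gamma j \<in> carrier Q" using j by (rule gamma_carrier)
  have A: "pure_gen n (start j + 1) (start j + 2) \<in> pure_quot n"
    using start_pair_bounds[OF j] by (intro pure_gen_pure) auto
  then have "rotates (pure_gen n (start j + 1) (start j + 2)) (\<lambda>_. 0)"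
    by (simp add: rotates_def pure_quot_altdef)
  then show "rotates (gamma j) (\<lambda>i. if i = j then 1 else 0)"
    unfolding gamma_eq[OF j]
    using rotates_mult[of "pure_gen n (start j + 1) (start j + 2)" "block_delta j" "\<lambda>_. 0"]
      rotates_block_delta[OF j] A j by (simp add: pure_quot_altdef)
  fix i z assume i: "i \<in> {1..t}"
  have "rlk (gamma j) {pos i z, pos i (z + 1)} = (if i = j \<and> int (m j) dvd z then 2 else 0)"
    using rlk_gamma[OF j adjacent_in_pairs[OF i]] adjacent_eq_first_iff[OF i j] by simp
  also have "\<dots> = 2 * ((z - 1 + (if i = j then 1 else 0)) div int (m i) - (z - 1) div int (m i))"
  proof (cases "i = j")
    case True
    have "z div int (m j) - (z - 1) div int (m j) = (if int (m j) dvd z then 1 else 0)"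
      using m_ge_3[OF j] by (intro div_diff_pred) simp
    with True show ?thesis by simp
  qed simp
  finally show "[rlk (gamma j) {pos i z, pos i (z + 1)} =
      2 * ((z - 1 + (if i = j then 1 else 0)) div int (m i) - (z - 1) div int (m i))] (mod d)"
    by (simp only: cong_refl)
next
  fix e assume e: "e \<in> pairs n - all_adjacent"
  have "e \<noteq> {pos j 0, pos j 1}"
  proof
    assume "e = {pos j 0, pos j 1}"
    then have "e \<in> adjacent_pairs j"
      unfolding adjacent_pairs_def by (intro CollectI exI[of _ 0]) simp
    with e j show False by blast
  qed
  then show "[rlk (gamma j) e = 0] (mod d)"
    using rlk_gamma[OF j, of e] e by simp
qed

lemma twisted_pure_gen_pow:
  assumes "1 \<le> a" "a < b" "b \<le> n"
  shows "twisted (2 * int q) (pure_gen n a b [^]\<^bsub>Q\<^esub> q) (\<lambda>_. 0)"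
  using pure_gen_pow_pure[OF assms, of q] rlk_pure[OF pure_gen_pow_pure(1)[OF assms, of q]]
  by (auto simp: twisted_def rotates_def pure_quot_altdef cong_0_iff)

lemma Gamma_generator_twisted:
  assumes "x \<in> {twisted_delta n m l | l. l < t} \<union>
    {pure_gen n a b [^]\<^bsub>Q\<^esub> q | a b. 1 \<le> a \<and> a < b \<and> b \<le> n}"
  shows "\<exists>a. twisted (2 * int q) x a"
proof -
  consider l where "l < t" "x = twisted_delta n m l"
    | a b where "1 \<le> a" "a < b" "b \<le> n" "x = pure_gen n a b [^]\<^bsub>Q\<^esub> q"
    using assms by blast
  then show ?thesis
  proof cases
    case (1 l)
    then show ?thesis using twisted_gamma[of "l + 1"] by (auto simp: gamma_def)
  next
    case (2 a b)
    then show ?thesis using twisted_pure_gen_pow by blast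
  qed
qed

lemma subgroup_Gamma: "subgroup (Gamma n q t m) Q"
  unfolding Gamma_def
  by (rule Q.generate_is_subgroup) (use Gamma_generator_twisted twistedD(1) in blast)

lemma gamma_in_Gamma: "j \<in> {1..t} \<Longrightarrow> gamma j \<in> Gamma n q t m"
  unfolding Gamma_def gamma_def by (intro generate.incl UnI1 CollectI exI[of _ "j - 1"]) auto

lemma pure_gen_pow_in_Gamma:
  "1 \<le> a \<Longrightarrow> a < b \<Longrightarrow> b \<le> n \<Longrightarrow> pure_gen n a b [^]\<^bsub>Q\<^esub> q \<in> Gamma n q t m"
  unfolding Gamma_def by (intro generate.incl UnI2) blast

lemma Gamma_twisted: "x \<in> Gamma n q t m \<Longrightarrow> \<exists>a. twisted (2 * int q) x a"
  unfolding Gamma_def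
proof (induction rule: generate.induct)
  case one
  show ?case using twisted_one by blast
next
  case (incl h)
  then show ?case by (rule Gamma_generator_twisted)
next
  case (inv h)
  then show ?case using Gamma_generator_twisted twisted_inv by blast
next
  case (eng h1 h2)
  then show ?case using twisted_mult by blast
qed

abbreviation "Lat \<equiv> Gamma n q t m \<inter> pure_quot n"

lemma translation_lattice_eq: "translation_lattice n q t m = Q\<lparr>carrier := Lat\<rparr>"
  by (simp add: translation_lattice_def)

lemma subgroup_Lat: "subgroup Lat Q"
  using subgroup_Gamma subgroup_pure_quot by (rule Q.subgroups_Inter_pair)

text \<open>A pure element rotates each block by a multiple of its length, so that the number of passages over the
origin is the same for all adjacent pairs of the block.\<close>

lemma Lat_adjacent_cong:
  assumes x: "x \<in> Lat" and j: "j \<in> {1..t}" and e: "e \<in> adjacent_pairs j" "e' \<in> adjacent_pairs j"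
  shows "2 dvd lk x e" "2 * int q dvd lk x e - lk x e'"
proof -
  obtain a where a: "twisted (2 * int q) x a"
    using x Gamma_twisted by blast
  have "int (m j) dvd a j"
    using rotates_id_cong[OF twistedD(2)[OF a] _ j] x by (auto simp: pure_quot_altdef)
  then obtain b where b: "a j = int (m j) * b" by auto
  have *: "[lk x e = 2 * b] (mod 2 * int q)" if e: "e \<in> adjacent_pairs j" for e
  proof -
    obtain z where z: "e = {pos j z, pos j (z + 1)}"
      using e by (auto simp: adjacent_pairs_def)
    have "(z - 1 + a j) div int (m j) - (z - 1) div int (m j) = b"
      using m_ge_3[OF j] by (simp add: b)
    then show ?thesis
      using twistedD(3)[OF a j, of z] rlk_pure[of x] x z by simp
  qed
  show "2 * int q dvd lk x e - lk x e'"
    using cong_diff[OF *[OF e(1)] *[OF e(2)]] by (simp add: cong_0_iff)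
  have "e \<in> pairs n"
    using e(1) adjacent_in_pairs[OF j] by (auto simp: adjacent_pairs_def)
  then show "2 dvd lk x e"
    using lk_even[of x e] x by simp
qed

lemma Lat_not_adjacent_cong:
  assumes "x \<in> Lat" "e \<in> pairs n - all_adjacent"
  shows "2 * int q dvd lk x e"
proof -
  obtain a where a: "twisted (2 * int q) x a"
    using assms Gamma_twisted by blast
  then show ?thesis
    using twistedD(4)[OF a assms(2)] rlk_pure[of x] assms(1) by (simp add: cong_0_iff)
qed


section \<open>The holonomy representation\<close>

lemma rotates_cong:
  "rotates x a \<Longrightarrow> (\<And>j. j \<in> {1..t} \<Longrightarrow> a j = b j) \<Longrightarrow> rotates x b"
  by (simp add: rotates_def)

abbreviation delta_product :: "nat list \<Rightarrow> nat word set set" where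
  "delta_product ls \<equiv>
    foldr (mult Q) (map (\<lambda>l. delta_block n (block_start m l) (m (l + 1))) ls) \<one>\<^bsub>Q\<^esub>"

abbreviation gamma_product :: "nat list \<Rightarrow> nat word set set" where
  "gamma_product ls \<equiv> foldr (mult Q) (map (\<lambda>l. gamma (l + 1)) ls) \<one>\<^bsub>Q\<^esub>"

lemma product_rotates:
  assumes "distinct ls" "set ls \<subseteq> {0..<t}"
  defines "a \<equiv> (\<lambda>j. if j - 1 \<in> set ls then 1 else 0)"
  shows "delta_product ls \<in> carrier Q \<and> rotates (delta_product ls) a \<and>
    gamma_product ls \<in> Gamma n q t m \<and> rotates (gamma_product ls) a"
  using assms(1,2) unfolding a_def
proof (induction ls)
  case Nil
  show ?case
    using rotates_one subgroup.one_closed[OF subgroup_Gamma] by simp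
next
  case (Cons l ls)
  let ?j = "l + 1"
  let ?a = "\<lambda>j. if j - 1 \<in> set ls then 1 else 0 :: int"
  have IH: "delta_product ls \<in> carrier Q" "rotates (delta_product ls) ?a"
    "gamma_product ls \<in> Gamma n q t m" "rotates (gamma_product ls) ?a"
    using Cons by auto
  have j: "?j \<in> {1..t}" using Cons.prems by auto
  have D: "delta_block n (block_start m l) (m (l + 1)) = block_delta ?j"
    by (simp add: block_delta_def start_def)
  have cong: "rotates x (\<lambda>j. if j - 1 \<in> set (l # ls) then 1 else 0)"
    if x: "rotates x (\<lambda>i. (if i = ?j then 1 else 0) + ?a i)" for x
  proof (rule rotates_cong[OF x])
    fix i assume "i \<in> {1..t}"
    then show "(if i = ?j then 1 else 0) + ?a i = (if i - 1 \<in> set (l # ls) then 1 else 0)"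
      using Cons.prems by auto
  qed
  have G: "gamma_product ls \<in> carrier Q" "gamma ?j \<in> Gamma n q t m"
    using IH(3) subgroup.subset[OF subgroup_Gamma] gamma_in_Gamma[OF j] by auto
  have "rotates (block_delta ?j \<cdot> delta_product ls) (\<lambda>i. (if i = ?j then 1 else 0) + ?a i)"
    using IH j rotates_block_delta[OF j] by (intro rotates_mult) auto
  moreover have "rotates (gamma ?j \<cdot> gamma_product ls) (\<lambda>i. (if i = ?j then 1 else 0) + ?a i)"
    using IH G(1) twistedD(1,2)[OF twisted_gamma[OF j, of 0]] by (intro rotates_mult) auto
  moreover have "gamma ?j \<cdot> gamma_product ls \<in> Gamma n q t m"
    using G(2) IH(3) subgroup.m_closed[OF subgroup_Gamma] by blast
  ultimately show ?case
    using IH(1) j cong by (simp add: D)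
qed

abbreviation "\<delta> \<equiv> delta n t m"

lemma delta_rotates: "\<delta> \<in> carrier Q" "rotates \<delta> (\<lambda>_. 1)"
  and ex_Gamma_delta: "\<exists>g\<in>Gamma n q t m. quot_perm g = quot_perm \<delta>"
proof -
  let ?D = "delta_product [0..<t]" and ?G = "gamma_product [0..<t]"
  have D: "\<delta> = ?D" by (simp only: delta_def)
  have *: "?D \<in> carrier Q \<and> rotates ?D (\<lambda>j. if j - 1 \<in> set [0..<t] then 1 else 0) \<and>
    ?G \<in> Gamma n q t m \<and> rotates ?G (\<lambda>j. if j - 1 \<in> set [0..<t] then 1 else 0)"
    by (rule product_rotates) auto
  show "\<delta> \<in> carrier Q" using * unfolding D by blast
  show "rotates \<delta> (\<lambda>_. 1)" using * unfolding D by (auto simp: rotates_def)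
  show "\<exists>g\<in>Gamma n q t m. quot_perm g = quot_perm \<delta>"
  proof (rule bexI[of _ ?G])
    have "?G \<in> carrier Q"
      using * subgroup.subset[OF subgroup_Gamma] by blast
    then show "quot_perm ?G = quot_perm \<delta>"
      unfolding D using * by (intro rotates_perm_eq[OF _ _ _ _ cong_refl]) blast+
  qed (use * in blast)
qed

lemma delta_pow_rotates: "\<delta> [^]\<^bsub>Q\<^esub> (k :: nat) \<in> carrier Q" "rotates (\<delta> [^]\<^bsub>Q\<^esub> k) (\<lambda>_. int k)"
proof -
  show "\<delta> [^]\<^bsub>Q\<^esub> k \<in> carrier Q" using delta_rotates by simp
  show "rotates (\<delta> [^]\<^bsub>Q\<^esub> k) (\<lambda>_. int k)"
  proof (induction k)
    case (Suc k)
    have "rotates (\<delta> [^]\<^bsub>Q\<^esub> k \<cdot> \<delta>) (\<lambda>_. int k + 1)"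
      using Suc delta_rotates by (intro rotates_mult) auto
    then show ?case by (simp add: add.commute)
  qed (simp add: rotates_one)
qed

text \<open>Conjugation acts on linking numbers through the permutation alone, so the chosen lift may be
replaced by \<open>\<delta>\<close>. A lift exists in \<open>\<Gamma>\<close>, since the product of all \<open>A \<delta>\<close> has the permutation of
\<open>\<delta>\<close>.\<close>

lemma holonomy_rep_lattice:
  assumes x: "x \<in> Lat"
  defines "y \<equiv> holonomy_rep n q t m (theta n t m) x"
  shows "y \<in> Lat" "lk y e = lk x (quot_perm \<delta> ` e)"
proof -
  define g where "g = (SOME g. g \<in> Gamma n q t m \<and> quot_perm g = theta n t m)"
  have "g \<in> Gamma n q t m \<and> quot_perm g = theta n t m"
    unfolding g_def by (rule someI_ex) (use ex_Gamma_delta in \<open>auto simp: theta_def\<close>)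
  then have g: "g \<in> Gamma n q t m" "quot_perm g = quot_perm \<delta>" "g \<in> carrier Q"
    using subgroup.subset[OF subgroup_Gamma] by (auto simp: theta_def)
  have y: "y = g \<cdot> x \<cdot> inv\<^bsub>Q\<^esub> g"
    by (simp add: y_def holonomy_rep_def g_def Let_def)
  have "y \<in> Gamma n q t m"
    unfolding y using g x subgroup_Gamma by (intro subgroup.m_closed subgroup.m_inv_closed) auto
  then show "y \<in> Lat"
    using conj_pure(1)[OF g(3)] x y by auto
  show "lk y e = lk x (quot_perm \<delta> ` e)"
    unfolding y using conj_pure(2)[OF g(3)] x g(2) by auto
qed

lemma delta_conj_pure:
  assumes "x \<in> pure_quot n"
  shows "delta_conj n t m k x \<in> pure_quot n"
    and "lk (delta_conj n t m k x) e = lk x (quot_perm (\<delta> [^]\<^bsub>Q\<^esub> k) ` e)"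
  unfolding delta_conj_def using conj_pure[OF delta_pow_rotates(1) assms] by auto

end


section \<open>Orbits of pairs of positions\<close>

text \<open>\<open>Inner j h\<close> is the orbit of the pairs at distance \<open>h + 1\<close> within the \<open>j\<close>-th block, and \<open>Cross j h\<close> the
orbit of the pairs between two blocks.\<close>

datatype orbit = Inner nat nat | Cross nat nat

lemma sum_triangle:
  fixes f :: "nat \<Rightarrow> nat"
  shows "(\<Sum>j = 1..k. f j)\<^sup>2 = (\<Sum>j = 1..k. (f j)\<^sup>2) + 2 * (\<Sum>j = 1..k. \<Sum>h = j + 1..k. f j * f h)"
proof (induction k)
  case (Suc k)
  have "(\<Sum>j = 1..k. \<Sum>h = j + 1..Suc k. f j * f h) = (\<Sum>j = 1..k. (\<Sum>h = j + 1..k. f j * f h) + f j * f (Suc k))"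
    by (intro sum.cong) auto
  also have "\<dots> = (\<Sum>j = 1..k. \<Sum>h = j + 1..k. f j * f h) + (\<Sum>j = 1..k. f j) * f (Suc k)"
    by (simp add: sum.distrib sum_distrib_right)
  finally show ?case
    using Suc by (simp add: power2_eq_square algebra_simps)
qed simp

lemma sum_list_upt_Suc: "(\<Sum>x\<leftarrow>[a..<b + 1]. f x) = (\<Sum>x = a..b. f x)"
  by (subst sum_list_distinct_conv_sum_set) (auto intro: sum.cong)

lemma prod_list_upt_Suc: "(\<Prod>x\<leftarrow>[a..<b + 1]. f x) = (\<Prod>x = a..b. f x :: 'a :: comm_monoid_mult)"
  by (subst prod.distinct_set_conv_list[symmetric]) (auto intro: prod.cong)

lemma sum_list_concat_map: "sum_list (map f (concat (map g xs))) = (\<Sum>x\<leftarrow>xs. sum_list (map f (g x)))"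
  by (induction xs) auto

lemma prod_list_concat_map: "prod_list (map f (concat (map g xs))) = (\<Prod>x\<leftarrow>xs. prod_list (map f (g x)))"
  by (induction xs) auto

lemma concat_map_concat_map: "concat (map f (concat (map g xs))) = concat (map (\<lambda>x. concat (map f (g x))) xs)"
  by (induction xs) auto

context cyclic_blocks
begin

text \<open>The pair on which the \<open>k\<close>-th conjugate under \<open>\<delta>\<close> is concentrated. Conjugation by \<open>\<delta>\<close> moves
  pairs backwards, hence the negative signs. The orbit of adjacent pairs starts at the second pair of
  the block.\<close>

fun orbit_pair :: "orbit \<Rightarrow> int \<Rightarrow> nat set" where
  "orbit_pair (Inner j h) k = (if h = 0 then {pos j (1 - k), pos j (2 - k)}
    else {pos j (- k), pos j (int h + 1 - k)})"
| "orbit_pair (Cross j h) k = {pos j (- k), pos h (- k)}"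

fun orbit_size :: "orbit \<Rightarrow> nat" where
  "orbit_size (Inner j h) = m j"
| "orbit_size (Cross j h) = m j * m h"

definition orbits :: "orbit list" where
  "orbits = concat (map (\<lambda>j. map (Inner j) [0..<(m j - 3) div 2 + 1]) [1..<t + 1]) @
    concat (map (\<lambda>j. map (Cross j) [j + 1..<t + 1]) [1..<t + 1])"

lemma set_orbits:
  "set orbits = (\<Union>j\<in>{1..t}. Inner j ` {0..(m j - 3) div 2}) \<union> (\<Union>j\<in>{1..t}. Cross j ` {j + 1..t})"
proof -
  have "{1..<t + 1} = {1..t}" "\<And>k :: nat. {0..<k + 1} = {0..k}" "\<And>j. {j + 1..<t + 1} = {j + 1..t}"
    by auto
  then show ?thesis
    by (simp only: orbits_def set_append set_concat set_map set_upt image_image)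
qed

lemma Inner_in_orbits [simp]: "Inner j h \<in> set orbits \<longleftrightarrow> j \<in> {1..t} \<and> h \<le> (m j - 3) div 2"
  unfolding set_orbits by (auto simp: image_iff)

lemma Cross_in_orbits [simp]: "Cross j h \<in> set orbits \<longleftrightarrow> 1 \<le> j \<and> j < h \<and> h \<le> t"
  unfolding set_orbits by (auto simp: image_iff)

lemma distinct_concat_map:
  assumes "distinct xs" "\<And>x. x \<in> set xs \<Longrightarrow> distinct (f x)"
    "\<And>x y. x \<in> set xs \<Longrightarrow> y \<in> set xs \<Longrightarrow> x \<noteq> y \<Longrightarrow> set (f x) \<inter> set (f y) = {}"
  shows "distinct (concat (map f xs))"
  using assms
proof (induction xs)
  case (Cons y ys)
  have "set (f y) \<inter> set (f x) = {}" if "x \<in> set ys" for x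
    using that Cons.prems(1) Cons.prems(3)[of y x] by (simp, metis)
  then have "set (f y) \<inter> set (concat (map f ys)) = {}"
    by auto
  moreover have "distinct (concat (map f ys))"
    using Cons.prems by (intro Cons.IH) auto
  ultimately show ?case
    using Cons.prems(2)[of y] by simp
qed simp

lemma distinct_orbits: "distinct orbits"
  unfolding orbits_def distinct_append
proof (intro conjI distinct_concat_map)
  show "set (concat (map (\<lambda>j. map (Inner j) [0..<(m j - 3) div 2 + 1]) [1..<t + 1])) \<inter>
      set (concat (map (\<lambda>j. map (Cross j) [j + 1..<t + 1]) [1..<t + 1])) = {}"
    by auto
qed (auto simp: distinct_map inj_on_def)

lemma orbit_size_pos: "x \<in> set orbits \<Longrightarrow> orbit_size x > 0"
proof (cases x)
  case (Inner j h)
  assume "x \<in> set orbits"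
  then show ?thesis using Inner m_ge_3[of j] by simp
next
  case (Cross j h)
  assume "x \<in> set orbits"
  then show ?thesis using Cross m_ge_3[of j] m_ge_3[of h] by simp
qed

lemma orbit_pair_rotate:
  assumes "rotates x (\<lambda>_. c)" "y \<in> set orbits"
  shows "quot_perm x ` orbit_pair y k = orbit_pair y (k - c)"
  using assms by (cases y) (auto simp: rotates_def algebra_simps)

lemma orbit_pair_cong:
  assumes "[k = k'] (mod int (orbit_size x))"
  shows "orbit_pair x k = orbit_pair x k'"
proof (cases x)
  case (Inner j h)
  have "pos j (a - k) = pos j (a - k')" for a
    using assms Inner by (intro pos_cong cong_diff) auto
  from this[of 1] this[of 2] this[of 0] this[of "int h + 1"] Inner show ?thesis
    by simp
next
  case (Cross j h)
  have "[k = k'] (mod int (m j))" "[k = k'] (mod int (m h))"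
    using assms Cross by (auto intro: cong_dvd_modulus)
  then have "pos j (- k) = pos j (- k')" "pos h (- k) = pos h (- k')"
    by (auto intro!: pos_cong simp: cong_minus_minus_iff)
  with Cross show ?thesis by simp
qed

lemma orbit_pair_mod_size:
  assumes "x \<in> set orbits"
  shows "\<exists>k'<orbit_size x. orbit_pair x k = orbit_pair x (int k')"
proof -
  let ?z = "int (orbit_size x)"
  have z: "?z > 0" using orbit_size_pos[OF assms] by simp
  have "orbit_pair x k = orbit_pair x (int (nat (k mod ?z)))"
    using z by (intro orbit_pair_cong) (simp add: cong_def)
  moreover have "nat (k mod ?z) < orbit_size x"
    using z by (simp add: nat_less_iff)
  ultimately show ?thesis by blast
qed

lemma near_pair_in_orbit:
  assumes j: "j \<in> {1..t}" and d: "1 \<le> d" "2 * d < m j"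
  shows "\<exists>x\<in>set orbits. \<exists>k. {pos j z, pos j (z + int d)} = orbit_pair x k"
proof (cases "d = 1")
  case True
  have "{pos j z, pos j (z + int d)} = orbit_pair (Inner j 0) (1 - z)"
    using True by (simp add: algebra_simps)
  moreover have "Inner j 0 \<in> set orbits"
    using j by simp
  ultimately show ?thesis by blast
next
  case False
  have "{pos j z, pos j (z + int d)} = orbit_pair (Inner j (d - 1)) (- z)"
    using d False by (simp add: of_nat_diff algebra_simps)
  moreover have "d - 1 \<le> (m j - 3) div 2"
    using d m_odd[OF j] by presburger
  then have "Inner j (d - 1) \<in> set orbits"
    using j by simp
  ultimately show ?thesis by blast
qed

text \<open>Two positions in a block of odd length are, in one of the two directions, at a distance of less than half
the length. Two positions in different blocks are rotated to the origins simultaneously by the Chinese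
remainder theorem.\<close>

lemma pair_in_orbit:
  assumes "e \<in> pairs n"
  shows "\<exists>x\<in>set orbits. \<exists>k<orbit_size x. e = orbit_pair x (int k)"
proof -
  have "\<exists>x\<in>set orbits. \<exists>k. e = orbit_pair x k"
    using assms
  proof (cases rule: pair_cases)
    case (same j x y)
    show ?thesis
    proof (cases "2 * (y - x) < m j")
      case True
      then show ?thesis
        using near_pair_in_orbit[OF same(1), of "y - x" "int x"] same by simp
    next
      case False
      let ?d = "m j - (y - x)"
      have "2 * ?d < m j" "1 \<le> ?d"
      proof -
        have "2 * (M - D) < M \<and> 1 \<le> M - D" if "odd M" "\<not> 2 * D < M" "D < M" for M D :: nat
          using that by presburger
        from this[OF m_odd[OF same(1)] False] show "2 * ?d < m j" "1 \<le> ?d"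
          using same by linarith+
      qed
      moreover have "pos j (int y + int ?d) = pos j (int x)"
        using same by (intro pos_cong) (simp add: cong_iff_dvd_diff)
      ultimately show ?thesis
        using near_pair_in_orbit[OF same(1), of ?d "int y"] same by (simp add: insert_commute)
    qed
  next
    case (cross i h x y)
    have "coprime (m i) (m h)"
      using cross by (intro m_coprime) auto
    then obtain k where k: "[k = m i - x] (mod m i)" "[k = m h - y] (mod m h)"
      using binary_chinese_remainder_nat by blast
    have *: "pos j (- int k) = pos j (int z)" if "[k = m j - z] (mod m j)" "z < m j" for j z
    proof (rule pos_cong)
      have "[int k = int (m j - z)] (mod int (m j))"
        using that(1) cong_int_iff by blast
      then have "[- int k = - int (m j - z)] (mod int (m j))"
        unfolding cong_minus_minus_iff .
      also have "[- int (m j - z) = int z] (mod int (m j))"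
        using that(2) by (simp add: cong_iff_dvd_diff)
      finally show "[- int k = int z] (mod int (m j))" .
    qed
    have "e = orbit_pair (Cross i h) (int k)"
      using cross *[OF k(1)] *[OF k(2)] by simp
    moreover have "Cross i h \<in> set orbits"
      using cross by simp
    ultimately show ?thesis by blast
  qed
  then show ?thesis
    using orbit_pair_mod_size by metis
qed

lemma m_inner_size: "j \<in> {1..t} \<Longrightarrow> 2 * (m j * ((m j - 3) div 2 + 1)) + m j = (m j)\<^sup>2"
  using m_odd[of j] m_ge_3[of j] by (auto elim!: oddE simp: power2_eq_square algebra_simps)

lemma sum_orbit_size: "(\<Sum>x\<leftarrow>orbits. orbit_size x) = n * (n - 1) div 2"
proof -
  let ?I = "\<Sum>j = 1..t. m j * ((m j - 3) div 2 + 1)" and ?C = "\<Sum>j = 1..t. \<Sum>h = j + 1..t. m j * m h"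
  have "(\<Sum>x\<leftarrow>orbits. orbit_size x) = ?I + ?C"
    unfolding orbits_def map_append sum_list_append sum_list_concat_map map_map comp_def
      sum_list_upt_Suc orbit_size.simps
    by (simp del: upt_Suc add: sum_list_triv algebra_simps)
  moreover have "2 * (?I + ?C) + n = n\<^sup>2"
  proof -
    have "2 * ?I + n = (\<Sum>j = 1..t. (m j)\<^sup>2)"
      unfolding n_eq sum_distrib_left sum.distrib[symmetric] by (intro sum.cong m_inner_size) auto
    then show ?thesis
      using sum_triangle[of m t] unfolding n_eq by simp
  qed
  moreover have "n\<^sup>2 = n * (n - 1) + n"
    by (cases n) (auto simp: power2_eq_square)
  ultimately show ?thesis by simp
qed

lemma card_pairs: "card (pairs n) = n * (n - 1) div 2"
  unfolding pairs_def using n_subsets[of "{1..n}" 2] by (simp add: choose_two)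

text \<open>The orbits cover all pairs and their sizes add up to the number of pairs, so no pair
  is met twice.\<close>

lemma orbit_pair_bij:
  "bij_betw (\<lambda>(x, k). orbit_pair x (int k)) (SIGMA x:set orbits. {..<orbit_size x}) (pairs n)"
proof -
  let ?f = "\<lambda>(x, k). orbit_pair x (int k)" and ?S = "SIGMA x:set orbits. {..<orbit_size x}"
  have fin: "finite ?S" by auto
  have sub: "pairs n \<subseteq> ?f ` ?S"
    using pair_in_orbit by force
  have "card ?S = (\<Sum>x\<leftarrow>orbits. orbit_size x)"
    using distinct_orbits by (simp add: sum_list_distinct_conv_sum_set)
  then have card: "card ?S = card (pairs n)"
    by (simp only: sum_orbit_size card_pairs)
  have "card (pairs n) \<le> card (?f ` ?S)"
    using sub fin by (intro card_mono) auto
  moreover have "card (?f ` ?S) \<le> card ?S"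
    using fin by (rule card_image_le)
  ultimately have eq: "card (?f ` ?S) = card ?S" "card (?f ` ?S) = card (pairs n)"
    using card by auto
  have "inj_on ?f ?S"
    using eq(1) fin by (rule eq_card_imp_inj_on[rotated])
  moreover have "?f ` ?S = pairs n"
    using sub eq(2) fin by (intro card_subset_eq[symmetric]) auto
  ultimately show ?thesis by (simp add: bij_betw_def)
qed

lemma orbit_pair_eq_iff:
  assumes "x \<in> set orbits" "y \<in> set orbits" "k < orbit_size x" "l < orbit_size y"
  shows "orbit_pair x (int k) = orbit_pair y (int l) \<longleftrightarrow> x = y \<and> k = l"
  using inj_onD[OF bij_betw_imp_inj_on[OF orbit_pair_bij], of "(x, k)" "(y, l)"] assms by auto

lemma orbit_pair_in_pairs:
  assumes "x \<in> set orbits"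
  shows "orbit_pair x k \<in> pairs n"
proof -
  obtain k' where k': "k' < orbit_size x" "orbit_pair x k = orbit_pair x (int k')"
    using orbit_pair_mod_size[OF assms] by blast
  then have "orbit_pair x (int k') \<in> (\<lambda>(x, k). orbit_pair x (int k)) ` (SIGMA x:set orbits. {..<orbit_size x})"
    using assms by (intro image_eqI[of _ _ "(x, k')"]) auto
  then show ?thesis
    using bij_betw_imp_surj_on[OF orbit_pair_bij] k' by simp
qed

definition orbit_set :: "orbit \<Rightarrow> nat set set" where
  "orbit_set x = (\<lambda>k. orbit_pair x (int k)) ` {..<orbit_size x}"

lemma orbit_set_disjoint:
  assumes "x \<in> set orbits" "y \<in> set orbits" "x \<noteq> y"
  shows "orbit_set x \<inter> orbit_set y = {}"
  using assms by (auto simp: orbit_set_def orbit_pair_eq_iff)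

lemma Union_orbit_set: "(\<Union>x\<in>set orbits. orbit_set x) = pairs n"
  using pair_in_orbit orbit_pair_in_pairs unfolding orbit_set_def by blast

lemma orbit_set_Inner_0:
  assumes "j \<in> {1..t}"
  shows "orbit_set (Inner j 0) = adjacent_pairs j"
proof (intro equalityI subsetI)
  fix e assume "e \<in> orbit_set (Inner j 0)"
  then obtain k where "e = {pos j (1 - int k), pos j (1 - int k + 1)}"
    by (auto simp: orbit_set_def)
  then show "e \<in> adjacent_pairs j"
    unfolding adjacent_pairs_def by blast
next
  fix e assume "e \<in> adjacent_pairs j"
  then obtain z where "e = {pos j z, pos j (z + 1)}"
    unfolding adjacent_pairs_def by blast
  then have "e = orbit_pair (Inner j 0) (1 - z)"
    by (simp add: algebra_simps)
  then show "e \<in> orbit_set (Inner j 0)"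
    using orbit_pair_mod_size[of "Inner j 0" "1 - z"] assms by (auto simp: orbit_set_def)
qed


section \<open>The basis and the matrix of the holonomy representation\<close>

fun orbit_block :: "orbit \<Rightarrow> nat word set set list" where
  "orbit_block (Inner j h) = (if h = 0 then basis_fixed n m j # map (basis_adjacent n q t m j) [1..<m j]
    else map (basis_inner n q t m j h) [1..<m j + 1])"
| "orbit_block (Cross j h) = map (basis_cross n q t m j h) [1..<m j * m h + 1]"

fun orbit_mat :: "orbit \<Rightarrow> int mat" where
  "orbit_mat (Inner j h) = (if h = 0 then N_mat (m j) q else M_mat (m j))"
| "orbit_mat (Cross j h) = M_mat (m j * m h)"

lemma upt_0_Suc: "[0..<k + 1] = 0 # [1..<k + 1]"
  using upt_conv_Cons[of 0 "k + 1"] by (simp del: upt_Suc add: One_nat_def)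

lemma lattice_basis_eq: "lattice_basis n q t m = concat (map orbit_block orbits)"
proof -
  have "concat (map orbit_block (map (Inner j) [0..<(m j - 3) div 2 + 1])) =
      basis_fixed n m j # map (basis_adjacent n q t m j) [1..<m j] @
      concat (map (\<lambda>h. map (basis_inner n q t m j h) [1..<m j + 1]) [1..<(m j - 3) div 2 + 1])" for j
  proof -
    have "map orbit_block (map (Inner j) [1..<(m j - 3) div 2 + 1]) =
        map (\<lambda>h. map (basis_inner n q t m j h) [1..<m j + 1]) [1..<(m j - 3) div 2 + 1]"
      by (simp del: upt_Suc)
    then show ?thesis
      unfolding upt_0_Suc by (simp del: upt_Suc map_map)
  qed
  moreover have "concat (map orbit_block (map (Cross j) [j + 1..<t + 1])) =
      concat (map (\<lambda>h. map (basis_cross n q t m j h) [1..<m j * m h + 1]) [j + 1..<t + 1])" for j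
    by (simp del: upt_Suc add: comp_def)
  ultimately show ?thesis
    unfolding lattice_basis_def orbits_def map_append concat_append concat_map_concat_map
    by (simp only: append_Cons)
qed

lemma map_orbits:
  "map f orbits = concat (map (\<lambda>j. map (\<lambda>h. f (Inner j h)) [0..<(m j - 3) div 2 + 1]) [1..<t + 1]) @
    concat (map (\<lambda>j. map (\<lambda>h. f (Cross j h)) [j + 1..<t + 1]) [1..<t + 1])"
  by (simp del: upt_Suc add: orbits_def map_concat comp_def)

lemma holonomy_mat_eq: "holonomy_mat q t m = diag_block_mat (map orbit_mat orbits)"
proof -
  have "map (\<lambda>h. orbit_mat (Inner j h)) [0..<(m j - 3) div 2 + 1] =
      N_mat (m j) q # map (\<lambda>h. M_mat (m j)) [1..<(m j - 3) div 2 + 1]" for j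
    unfolding upt_0_Suc by (simp del: upt_Suc)
  then show ?thesis
    unfolding holonomy_mat_def map_orbits by (simp only: orbit_mat.simps(2))
qed

lemma perm_image_eq_orbit_pair_iff:
  assumes "x \<in> carrier Q" "rotates x (\<lambda>_. c)" "y \<in> set orbits"
  shows "quot_perm x ` e = orbit_pair y k \<longleftrightarrow> e = orbit_pair y (k + c)"
proof -
  have "orbit_pair y k = quot_perm x ` orbit_pair y (k + c)"
    using orbit_pair_rotate[OF assms(2,3), of "k + c"] by simp
  then show ?thesis
    using permutes_inj[OF quot_perm_permutes[OF assms(1)]] by (simp only: inj_image_eq_iff)
qed

definition concentrated :: "nat set \<Rightarrow> nat word set set \<Rightarrow> bool" where
  "concentrated e y \<longleftrightarrow> y \<in> Lat \<and> (\<forall>e'. lk y e' = (if e' = e then 2 * int q else 0))"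

text \<open>By comparison of linking numbers, the conjugate of a power of a generator \<open>A\<close> is the same power of
another one, hence in \<open>\<Gamma>\<close>.\<close>

lemma delta_conj_concentrated:
  fixes k :: nat
  assumes x: "x \<in> set orbits" and ab: "orbit_pair x 0 = {a, b}" "1 \<le> a" "a < b" "b \<le> n"
  shows "concentrated (orbit_pair x (int k)) (delta_conj n t m k (pure_gen n a b [^]\<^bsub>Q\<^esub> q))"
    (is "concentrated _ ?y")
proof -
  note A = pure_gen_pow_pure[OF ab(2-4), of q]
  have y: "?y \<in> pure_quot n"
    by (rule delta_conj_pure(1)[OF A(1)])
  have lk: "lk ?y e = (if e = orbit_pair x (int k) then 2 * int q else 0)" for e
    using perm_image_eq_orbit_pair_iff[OF delta_pow_rotates x, of k e 0]
    unfolding delta_conj_pure(2)[OF A(1)] A(2) ab(1)[symmetric] by simp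
  obtain a' b' where ab': "1 \<le> a'" "a' < b'" "b' \<le> n" "orbit_pair x (int k) = {a', b'}"
    using orbit_pair_in_pairs[OF x, of "int k"] unfolding pairs_eq by blast
  have "?y = pure_gen n a' b' [^]\<^bsub>Q\<^esub> q"
    using y pure_gen_pow_pure[OF ab'(1-3), of q] by (intro pure_quot_eqI) (auto simp: lk ab'(4))
  then have "?y \<in> Lat"
    using pure_gen_pow_in_Gamma[OF ab'(1-3)] y by simp
  with lk show ?thesis
    by (simp add: concentrated_def)
qed

lemma basis_adjacent_concentrated:
  assumes j: "j \<in> {1..t}"
  shows "concentrated (orbit_pair (Inner j 0) (int k)) (basis_adjacent n q t m j (k + 1))"
proof -
  have "pos j 1 = start j + 2" "pos j 2 = start j + 3"
    using pos_small[of 1 j] pos_small[of 2 j] m_ge_3[OF j] by auto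
  then have "orbit_pair (Inner j 0) 0 = {start j + 2, start j + 3}" by simp
  from delta_conj_concentrated[OF _ this] show ?thesis
    using j start_pair_bounds[OF j] by (simp add: basis_adjacent_def start_def)
qed

lemma basis_inner_concentrated:
  assumes j: "Inner j h \<in> set orbits" and h: "h \<noteq> 0"
  shows "concentrated (orbit_pair (Inner j h) (int k)) (basis_inner n q t m j h (k + 1))"
proof -
  have h': "h + 1 < m j" "j \<in> {1..t}"
    using j m_ge_3[of j] by auto
  then have "pos j 0 = start j + 1" "pos j (int h + 1) = start j + h + 2"
    using pos_small[of 0 j] pos_small[of "h + 1" j] by (auto simp: add.commute)
  then have "orbit_pair (Inner j h) 0 = {start j + 1, start j + h + 2}"
    using h by simp
  from delta_conj_concentrated[OF j this] show ?thesis
    using h' start_add_le[of j] by (simp add: basis_inner_def start_def)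
qed

lemma basis_cross_concentrated:
  assumes jh: "Cross j h \<in> set orbits"
  shows "concentrated (orbit_pair (Cross j h) (int k)) (basis_cross n q t m j h (k + 1))"
proof -
  have *: "j \<in> {1..t}" "h \<in> {1..t}" "j < h" using jh by auto
  have "pos j 0 = start j + 1" "pos h 0 = start h + 1"
    using pos_small[of 0 j] pos_small[of 0 h] m_ge_3[OF *(1)] m_ge_3[OF *(2)] by auto
  then have "orbit_pair (Cross j h) 0 = {start j + 1, start h + 1}" by simp
  from delta_conj_concentrated[OF jh this] show ?thesis
    using * start_add[of j h] start_add_le[of h] m_ge_3[of j] m_ge_3[of h]
    by (simp add: basis_cross_def start_def)
qed

text \<open>In a full turn each adjacent pair of the block meets the first one once. The linking numbers are exact
here: the congruences are used with modulus 0.\<close>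

lemma basis_fixed_lattice:
  assumes j: "j \<in> {1..t}"
  shows "basis_fixed n m j \<in> Lat"
    "e \<in> pairs n \<Longrightarrow> lk (basis_fixed n m j) e = (if e \<in> adjacent_pairs j then 2 else 0)"
proof -
  let ?x = "basis_fixed n m j" and ?a = "\<lambda>i. int (m j) * (if i = j then 1 else 0)"
  have x: "?x = gamma j [^]\<^bsub>Q\<^esub> m j" by (simp add: basis_fixed_def gamma_def)
  have tw: "twisted 0 ?x ?a"
    unfolding x by (rule twisted_pow[OF twisted_gamma[OF j]])
  have "quot_perm ?x = quot_perm \<one>\<^bsub>Q\<^esub>"
    by (rule rotates_perm_eq[OF twistedD(1)[OF tw] _ twistedD(2)[OF tw] rotates_one]) (auto simp: cong_0_iff)
  then have pure: "?x \<in> pure_quot n"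
    using twistedD(1)[OF tw] by (simp add: pure_quot_altdef)
  have "?x \<in> Gamma n q t m"
    unfolding x using Q.subgroup_int_pow_closed[OF subgroup_Gamma gamma_in_Gamma[OF j], of "int (m j)"]
    by (simp add: int_pow_int)
  with pure show "?x \<in> Lat" by simp
  assume e: "e \<in> pairs n"
  show "lk ?x e = (if e \<in> adjacent_pairs j then 2 else 0)"
  proof (cases "e \<in> (\<Union>i\<in>{1..t}. adjacent_pairs i)")
    case True
    then obtain i z where i: "i \<in> {1..t}" "e = {pos i z, pos i (z + 1)}"
      unfolding adjacent_pairs_def by blast
    have "lk ?x e = 2 * ((z - 1 + ?a i) div int (m i) - (z - 1) div int (m i))"
      using twistedD(3)[OF tw i(1), of z] rlk_pure[OF pure] i(2) by (simp add: cong_def)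
    also have "\<dots> = (if i = j then 2 else 0)"
      using m_ge_3[OF j] by simp
    also have "i = j \<longleftrightarrow> e \<in> adjacent_pairs j"
    proof
      assume "i = j"
      then show "e \<in> adjacent_pairs j"
        using i(2) unfolding adjacent_pairs_def by blast
    next
      assume "e \<in> adjacent_pairs j"
      then obtain z' where "{pos i z, pos i (z + 1)} = {pos j z', pos j (z' + 1)}"
        using i(2) unfolding adjacent_pairs_def by blast
      then have "pos i z = pos j z' \<or> pos i z = pos j (z' + 1)"
        by (auto simp only: doubleton_eq_iff)
      then show "i = j"
        using i(1) j pos_eq_iff by blast
    qed
    finally show ?thesis .
  next
    case False
    then show ?thesis
      using twistedD(4)[OF tw, of e] rlk_pure[OF pure] e j by (auto simp: cong_def)
  qed
qed

lemma length_orbit_block: "x \<in> set orbits \<Longrightarrow> length (orbit_block x) = orbit_size x"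
  using m_ge_3 by (cases x) (fastforce simp del: upt_Suc)+

lemma orbit_block_subset:
  assumes "x \<in> set orbits"
  shows "set (orbit_block x) \<subseteq> Lat"
proof
  fix y assume y: "y \<in> set (orbit_block x)"
  show "y \<in> Lat"
  proof (cases x)
    case (Inner j h)
    then have j: "j \<in> {1..t}" using assms by simp
    consider "y = basis_fixed n m j" | k where "h = 0" "1 \<le> k" "y = basis_adjacent n q t m j k"
      | k where "h \<noteq> 0" "1 \<le> k" "y = basis_inner n q t m j h k"
      using y Inner by (auto simp del: upt_Suc split: if_splits)
    then show ?thesis
    proof cases
      case 1
      then show ?thesis using basis_fixed_lattice(1)[OF j] by simp
    next
      case (2 k)
      then show ?thesis using basis_adjacent_concentrated[OF j, of "k - 1"] by (simp add: concentrated_def)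
    next
      case (3 k)
      then show ?thesis using basis_inner_concentrated[of j h "k - 1"] assms Inner by (simp add: concentrated_def)
    qed
  next
    case (Cross j h)
    then obtain k where "1 \<le> k" "y = basis_cross n q t m j h k"
      using y by (auto simp del: upt_Suc)
    then show ?thesis using basis_cross_concentrated[of j h "k - 1"] assms Cross by (simp add: concentrated_def)
  qed
qed

text \<open>The conditions that membership in the lattice imposes on the linking numbers on one orbit.\<close>

definition orbit_congruence :: "orbit \<Rightarrow> (nat set \<Rightarrow> int) \<Rightarrow> bool" where
  "orbit_congruence x v \<longleftrightarrow> (if \<exists>j. x = Inner j 0
    then \<forall>e\<in>orbit_set x. 2 dvd v e \<and> (\<forall>e'\<in>orbit_set x. 2 * int q dvd v e - v e')
    else \<forall>e\<in>orbit_set x. 2 * int q dvd v e)"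

lemma delta_shift:
  assumes x: "x \<in> set orbits" and k: "k < orbit_size x"
  shows "quot_perm \<delta> ` e = orbit_pair x (int k) \<longleftrightarrow>
    e = orbit_pair x (int (if k = orbit_size x - 1 then 0 else k + 1))"
proof -
  have "orbit_pair x (int k + 1) = orbit_pair x (int (if k = orbit_size x - 1 then 0 else k + 1))"
    using k by (intro orbit_pair_cong) (auto simp: cong_iff_dvd_diff of_nat_diff)
  then show ?thesis
    using perm_image_eq_orbit_pair_iff[OF delta_rotates x, of e "int k"] by simp
qed

lemma orbit_block_basis:
  assumes x: "x \<in> set orbits"
  shows "supported_basis (pairs n) (map lk (orbit_block x)) (orbit_set x) (orbit_congruence x)"
    and "acts_by (pairs n) (map lk (orbit_block x)) (orbit_mat x) (image (quot_perm \<delta>))"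
proof -
  let ?fs = "map lk (orbit_block x)" and ?z = "orbit_size x" and ?\<epsilon> = "\<lambda>k. orbit_pair x (int k)"
  have len: "length ?fs = ?z"
    using length_orbit_block[OF x] by simp
  have inj: "inj_on ?\<epsilon> {..<?z}"
    using x by (auto intro!: inj_onI simp: orbit_pair_eq_iff)
  have sub: "?\<epsilon> ` {..<?z} \<subseteq> pairs n"
    using orbit_pair_in_pairs[OF x] by auto
  have w: "2 * int q \<noteq> 0" using q_pos by simp
  have \<delta>: "quot_perm \<delta> ` e \<in> pairs n" if "e \<in> pairs n" for e
    using that delta_rotates by (intro perm_image_pairs)
  have shift: "quot_perm \<delta> ` e = ?\<epsilon> k \<longleftrightarrow> e = ?\<epsilon> (if k = ?z - 1 then 0 else k + 1)"
    if "k < ?z" "e \<in> pairs n" for k e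
    using delta_shift[OF x that(1)] .
  have "supported_basis (pairs n) ?fs (orbit_set x) (orbit_congruence x) \<and>
      acts_by (pairs n) ?fs (orbit_mat x) (image (quot_perm \<delta>))"
  proof (cases "\<exists>j. x = Inner j 0")
    case True
    then obtain j where j: "x = Inner j 0" "j \<in> {1..t}" using x by auto
    have z: "?z \<ge> 2" using j m_ge_3[OF j(2)] by simp
    have f0: "(?fs ! 0) e = (if e \<in> ?\<epsilon> ` {..<?z} then 2 else 0)" if "e \<in> pairs n" for e
      using basis_fixed_lattice(2)[OF j(2) that] orbit_set_Inner_0[OF j(2)] j(1)
      by (simp add: orbit_set_def)
    have fS: "(?fs ! Suc i) e = (if e = ?\<epsilon> i then 2 * int q else 0)"
      if "Suc i < ?z" "e \<in> pairs n" for i e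
      using that basis_adjacent_concentrated[OF j(2), of i] j(1)
      by (simp del: upt_Suc add: concentrated_def add.commute)
    have S: "orbit_set x = ?\<epsilon> ` {..<?z}" by (simp only: orbit_set_def)
    have "orbit_congruence x = (\<lambda>v. \<forall>e\<in>?\<epsilon> ` {..<?z}. 2 dvd v e \<and> (\<forall>e'\<in>?\<epsilon> ` {..<?z}. 2 * int q dvd v e - v e'))"
      using True by (simp add: orbit_congruence_def orbit_set_def fun_eq_iff)
    moreover have "orbit_mat x = N_mat ?z q"
      using j by simp
    moreover have "supported_basis (pairs n) ?fs (?\<epsilon> ` {..<?z})
        (\<lambda>v. \<forall>e\<in>?\<epsilon> ` {..<?z}. 2 dvd v e \<and> (\<forall>e'\<in>?\<epsilon> ` {..<?z}. 2 * int q dvd v e - v e'))"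
      by (rule supported_basis_cycle[OF len inj sub w z HOL.refl]; fact f0 fS)
    moreover have "acts_by (pairs n) ?fs (N_mat ?z q) (image (quot_perm \<delta>))"
      by (rule acts_by_N_mat[OF len inj sub w z HOL.refl]; fact f0 fS \<delta> shift)
    ultimately show ?thesis
      unfolding S by (simp only:)
  next
    case False
    have z: "?z \<ge> 1" using orbit_size_pos[OF x] by simp
    have f: "(?fs ! i) e = (if e = ?\<epsilon> i then 2 * int q else 0)"
      if "i < ?z" "e \<in> pairs n" for i e
    proof (cases x)
      case (Inner j h)
      then show ?thesis
        using that False x basis_inner_concentrated[of j h i]
        by (simp del: upt_Suc add: concentrated_def add.commute)
    next
      case (Cross j h)
      then show ?thesis
        using that x basis_cross_concentrated[of j h i]
        by (simp del: upt_Suc add: concentrated_def add.commute)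
    qed
    have "orbit_congruence x = (\<lambda>v. \<forall>e\<in>?\<epsilon> ` {..<?z}. 2 * int q dvd v e)"
      using False by (simp add: orbit_congruence_def orbit_set_def fun_eq_iff)
    moreover have "orbit_mat x = M_mat ?z"
      using False by (cases x) auto
    moreover have "supported_basis (pairs n) ?fs (?\<epsilon> ` {..<?z}) (\<lambda>v. \<forall>e\<in>?\<epsilon> ` {..<?z}. 2 * int q dvd v e)"
      by (rule supported_basis_indicators[OF len inj sub w]; fact f)
    moreover have "acts_by (pairs n) ?fs (M_mat ?z) (image (quot_perm \<delta>))"
      by (rule acts_by_M_mat[OF len inj sub w]; fact f z \<delta> shift)
    ultimately show ?thesis
      unfolding orbit_set_def by (simp only:)
  qed
  then show "supported_basis (pairs n) ?fs (orbit_set x) (orbit_congruence x)"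
    "acts_by (pairs n) ?fs (orbit_mat x) (image (quot_perm \<delta>))"
    by blast+
qed

abbreviation "Basis \<equiv> lattice_basis n q t m"
abbreviation "L \<equiv> translation_lattice n q t m"

lemma map_lk_Basis: "map lk Basis = concat (map (\<lambda>x. map lk (orbit_block x)) orbits)"
  by (simp add: lattice_basis_eq map_concat comp_def)

lemma Basis_supported:
  "supported_basis (pairs n) (map lk Basis) (pairs n) (\<lambda>v. \<forall>x\<in>set orbits. orbit_congruence x v)"
  unfolding map_lk_Basis Union_orbit_set[symmetric]
proof (rule supported_basis_concat)
  show "orbit_set x \<inter> orbit_set x' = {}" if "x \<in> set orbits" "x' \<in> set orbits" "x \<noteq> x'" for x x'
    using that by (rule orbit_set_disjoint)
qed (simp_all only: Union_orbit_set orbit_block_basis(1) distinct_orbits)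

lemma Basis_acts:
  "acts_by (pairs n) (map lk Basis) (holonomy_mat q t m) (image (quot_perm \<delta>))"
  unfolding map_lk_Basis holonomy_mat_eq by (rule acts_by_concat) (rule orbit_block_basis(2))

lemma length_Basis: "length Basis = n * (n - 1) div 2"
proof -
  have "length Basis = (\<Sum>x\<leftarrow>orbits. length (orbit_block x))"
    by (simp add: lattice_basis_eq length_concat comp_def)
  also have "\<dots> = (\<Sum>x\<leftarrow>orbits. orbit_size x)"
    by (intro arg_cong[of _ _ sum_list] map_cong) (auto simp: length_orbit_block)
  finally show ?thesis by (simp only: sum_orbit_size)
qed

lemma Basis_subset: "set Basis \<subseteq> Lat"
  using orbit_block_subset unfolding lattice_basis_eq by auto

lemma Lat_orbit_congruence:
  assumes y: "y \<in> Lat" and x: "x \<in> set orbits"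
  shows "orbit_congruence x (lk y)"
proof (cases "\<exists>j. x = Inner j 0")
  case True
  then obtain j where j: "x = Inner j 0" "j \<in> {1..t}" using x by auto
  have "orbit_set x = adjacent_pairs j"
    using orbit_set_Inner_0[OF j(2)] j(1) by simp
  then show ?thesis
    using Lat_adjacent_cong[OF y j(2)] True by (simp add: orbit_congruence_def)
next
  case False
  have "2 * int q dvd lk y e" if e: "e \<in> orbit_set x" for e
  proof (rule Lat_not_adjacent_cong[OF y])
    have "e \<notin> adjacent_pairs j" if j: "j \<in> {1..t}" for j
      using orbit_set_disjoint[OF x, of "Inner j 0"] False e j orbit_set_Inner_0[OF j] by auto
    moreover have "e \<in> pairs n"
      using Union_orbit_set e x by blast
    ultimately show "e \<in> pairs n - all_adjacent"
      by blast
  qed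
  then show ?thesis
    using False by (simp add: orbit_congruence_def)
qed

lemma int_comb_lattice:
  shows "int_comb L Basis c \<in> Lat" "lk (int_comb L Basis c) e = fun_comb (map lk Basis) c e"
proof -
  note sub = subgroup_Lat Int_lower2[of "Gamma n q t m" "pure_quot n"]
  interpret L: comm_group L
    unfolding translation_lattice_eq using sub by (rule comm_group_pure_subgroup)
  have car: "carrier L = Lat" by (simp add: translation_lattice_eq)
  have B: "Basis ! i \<in> carrier L" if "i < length Basis" for i
    using that Basis_subset nth_mem unfolding car by blast
  then have pow: "(\<lambda>i. (Basis ! i) [^]\<^bsub>L\<^esub> c $ i) \<in> {..<length Basis} \<rightarrow> carrier L"
    by auto
  then show "int_comb L Basis c \<in> Lat"
    unfolding int_comb_def car[symmetric] by (rule L.finprod_closed)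
  have "lk (int_comb L Basis c) e = (\<Sum>i<length Basis. lk ((Basis ! i) [^]\<^bsub>L\<^esub> c $ i) e)"
    unfolding int_comb_def using pow sub by (simp only: translation_lattice_eq) (intro lk_finprod, auto)
  also have "\<dots> = (\<Sum>i<length Basis. c $ i * lk (Basis ! i) e)"
    using B sub unfolding translation_lattice_eq by (intro sum.cong lk_int_pow) auto
  finally show "lk (int_comb L Basis c) e = fun_comb (map lk Basis) c e"
    by (simp add: fun_comb_def)
qed

text \<open>Both sides are pure, so the equation may be tested on linking numbers.\<close>

lemma int_comb_eq_iff:
  assumes "y \<in> Lat"
  shows "int_comb L Basis c = y \<longleftrightarrow> (\<forall>e\<in>pairs n. fun_comb (map lk Basis) c e = lk y e)"
  using assms int_comb_lattice pure_quot_eqI[of "int_comb L Basis c" y] by auto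

theorem ordered_basis_lattice: "ordered_basis L Basis"
  unfolding ordered_basis_def
proof (intro conjI ballI)
  show "comm_group L"
    unfolding translation_lattice_eq using subgroup_Lat by (rule comm_group_pure_subgroup) auto
  show "set Basis \<subseteq> carrier L"
    using Basis_subset by (simp add: translation_lattice_eq)
  fix y assume "y \<in> carrier L"
  then have y: "y \<in> Lat" by (simp add: translation_lattice_eq)
  then have "\<forall>x\<in>set orbits. orbit_congruence x (lk y)"
    using Lat_orbit_congruence by blast
  then have "\<exists>!c. c \<in> carrier_vec (length (map lk Basis)) \<and>
      (\<forall>e\<in>pairs n. fun_comb (map lk Basis) c e = lk y e)"
    using Basis_supported unfolding supported_basis_def by blast
  then show "\<exists>!c. c \<in> carrier_vec (length Basis) \<and> int_comb L Basis c = y"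
    unfolding int_comb_eq_iff[OF y] by (simp only: length_map)
qed

lemma coordinates_eq:
  assumes "c \<in> carrier_vec (length Basis)" "int_comb L Basis c = y" "y \<in> Lat"
  shows "coordinates L Basis y = c"
proof -
  have "\<exists>!c. c \<in> carrier_vec (length Basis) \<and> int_comb L Basis c = y"
  proof -
    have "y \<in> carrier L"
      using assms(3) by (simp add: translation_lattice_eq)
    then show ?thesis
      using ordered_basis_lattice unfolding ordered_basis_def by blast
  qed
  then show ?thesis
    unfolding coordinates_def using assms(1,2) by (intro the1_equality) auto
qed

theorem matrix_holonomy: "matrix_wrt L Basis (holonomy_rep n q t m (theta n t m)) = holonomy_mat q t m"
proof -
  let ?D = "holonomy_mat q t m" and ?f = "holonomy_rep n q t m (theta n t m)"
  have D: "?D \<in> carrier_mat (length Basis) (length Basis)"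
    using Basis_acts by (simp add: acts_by_def)
  have "map (\<lambda>b. coordinates L Basis (?f b)) Basis = cols ?D"
  proof (rule nth_equalityI)
    fix i assume "i < length (map (\<lambda>b. coordinates L Basis (?f b)) Basis)"
    then have i: "i < length Basis" by simp
    then have B: "Basis ! i \<in> Lat" using Basis_subset nth_mem by blast
    have "int_comb L Basis (col ?D i) = ?f (Basis ! i)"
      unfolding int_comb_eq_iff[OF holonomy_rep_lattice(1)[OF B]] holonomy_rep_lattice(2)[OF B]
      using Basis_acts i by (simp add: acts_by_def)
    moreover have "col ?D i \<in> carrier_vec (length Basis)"
      using D by (intro carrier_vecI) simp
    ultimately have "coordinates L Basis (?f (Basis ! i)) = col ?D i"
      using holonomy_rep_lattice(1)[OF B] by (intro coordinates_eq)
    then show "map (\<lambda>b. coordinates L Basis (?f b)) Basis ! i = cols ?D ! i"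
      using i D by simp
  qed (use D in simp)
  then show ?thesis
    unfolding matrix_wrt_def using D mat_of_cols_cols[of ?D] by simp
qed

theorem char_poly_holonomy_mat:
  "char_poly (holonomy_mat q t m) = (\<Prod>j=1..t. (monom 1 (m j) - 1) ^ ((m j - 1) div 2)) *
    (\<Prod>j=1..t. \<Prod>h=j+1..t. (monom 1 (m j * m h) - 1))"
proof -
  have mat: "orbit_mat x \<in> carrier_mat (orbit_size x) (orbit_size x)"
    "char_poly (orbit_mat x) = monom 1 (orbit_size x) - 1" if x: "x \<in> set orbits" for x
  proof -
    have "(\<exists>j. x = Inner j 0 \<and> orbit_mat x = N_mat (orbit_size x) q) \<or> orbit_mat x = M_mat (orbit_size x)"
      by (cases x) auto
    moreover have "orbit_size x \<ge> 2" if "x = Inner j 0" for j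
      using x that m_ge_3[of j] by simp
    ultimately show "orbit_mat x \<in> carrier_mat (orbit_size x) (orbit_size x)"
      "char_poly (orbit_mat x) = monom 1 (orbit_size x) - 1"
      using orbit_size_pos[OF x] M_mat_carrier[of "orbit_size x"] N_mat_carrier[of "orbit_size x" q]
        char_poly_M_mat[of "orbit_size x"] char_poly_N_mat[of "orbit_size x" q] by auto
  qed
  have "char_poly (holonomy_mat q t m) = (\<Prod>x\<leftarrow>orbits. char_poly (orbit_mat x))"
    unfolding holonomy_mat_eq by (subst char_poly_diag_block_mat) (auto simp: comp_def carrier_matD[OF mat(1)])
  also have "\<dots> = (\<Prod>x\<leftarrow>orbits. monom 1 (orbit_size x) - 1)"
    by (intro arg_cong[of _ _ prod_list] map_cong) (auto simp: mat(2))
  also have "\<dots> = (\<Prod>j=1..t. \<Prod>h=0..(m j - 3) div 2. monom 1 (m j) - 1) *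
      (\<Prod>j=1..t. \<Prod>h=j+1..t. (monom 1 (m j * m h) - 1))"
    unfolding orbits_def map_append prod_list.append prod_list_concat_map map_map comp_def
      prod_list_upt_Suc orbit_size.simps ..
  also have "(\<Prod>j=1..t. \<Prod>h=0..(m j - 3) div 2. monom (1 :: int) (m j) - 1) =
      (\<Prod>j=1..t. (monom 1 (m j) - 1) ^ ((m j - 1) div 2))"
  proof (intro prod.cong HOL.refl)
    fix j assume j: "j \<in> {1..t}"
    have "(m j - 1) div 2 = card {0..(m j - 3) div 2}"
      using m_ge_3[OF j] by simp
    then show "(\<Prod>h=0..(m j - 3) div 2. monom (1 :: int) (m j) - 1) = (monom 1 (m j) - 1) ^ ((m j - 1) div 2)"
      by (simp only: prod_constant)
  qed
  finally show ?thesis .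
qed

end

theorem theorem11:
  fixes p r m :: "nat \<Rightarrow> nat" and t q n :: nat
  assumes "t \<ge> 1"
    and "\<And>i. i \<in> {1..t} \<Longrightarrow> prime (p i) \<and> odd (p i)"
    and "inj_on p {1..t}"
    and "\<And>i. i \<in> {1..t} \<Longrightarrow> r i \<ge> 1"
    and "m = (\<lambda>i. p i ^ r i)"
    and "q = (\<Prod>i=1..t. p i ^ r i)"
    and "n = (\<Sum>i=1..t. p i ^ r i)"
  defines "L \<equiv> translation_lattice n q t m"
    and "B \<equiv> lattice_basis n q t m"
    and "\<psi> \<equiv> holonomy_rep n q t m"
    and "\<theta> \<equiv> theta n t m"
  shows "ordered_basis L B \<and> length B = n * (n - 1) div 2 \<and>
    matrix_wrt L B (\<psi> \<theta>) = holonomy_mat q t m \<and>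
    (q = 3 \<longrightarrow> matrix_wrt L B (\<psi> \<theta>) = N_mat 3 3) \<and>
    char_poly (matrix_wrt L B (\<psi> \<theta>)) =
      (\<Prod>j=1..t. (monom 1 (m j) - 1) ^ ((m j - 1) div 2)) *
      (\<Prod>j=1..t. \<Prod>h=j+1..t. (monom 1 (m j * m h) - 1))"
proof -
  have m3: "m i \<ge> 3" if i: "i \<in> {1..t}" for i
  proof -
    have "p i \<ge> 2" "p i \<noteq> 2"
      using assms(2)[OF i] prime_ge_2_nat[of "p i"] by auto
    moreover have "p i \<le> p i ^ r i"
      using assms(4)[OF i] calculation(1) by (intro self_le_power) auto
    ultimately show ?thesis using assms(5) by simp
  qed
  interpret cyclic_blocks n q t m
  proof
    show "n = (\<Sum>j = 1..t. m j)" using assms(5,7) by simp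
    show "odd (m j)" "m j \<ge> 3" if "j \<in> {1..t}" for j
      using assms(2)[OF that] m3[OF that] assms(5) by auto
    show "coprime (m j) (m h)" if "j \<in> {1..t}" "h \<in> {1..t}" "j \<noteq> h" for j h
    proof -
      have "p j \<noteq> p h"
        using inj_onD[OF assms(3), of j h] that by blast
      then show ?thesis
        using assms(2)[OF that(1)] assms(2)[OF that(2)] assms(5) by (simp add: primes_coprime)
    qed
    show "q > 0"
      unfolding assms(6) using assms(2) prime_gt_0_nat by (intro prod_pos) auto
  qed
  have "holonomy_mat q t m = N_mat 3 3" if q: "q = 3"
  proof -
    \<comment> \<open>two or more blocks would make \<open>q\<close> at least 9\<close>
    have "(\<Prod>i=1..t. 3) \<le> (\<Prod>i=1..t. m i)"
      using m3 by (intro prod_mono) auto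
    then have "3 ^ t \<le> (3 ^ 1 :: nat)"
      using q assms(5,6) by simp
    then have "t = 1"
      using assms(1) by (subst (asm) power_increasing_iff) auto
    moreover from this have "m 1 = 3"
      using q assms(5,6) by simp
    ultimately show ?thesis
      using q by (simp add: holonomy_mat_def One_nat_def numeral_2_eq_2 del: diag_block_mat.simps)
  qed
  then show ?thesis
    unfolding L_def B_def \<psi>_def \<theta>_def matrix_holonomy
    using ordered_basis_lattice length_Basis char_poly_holonomy_mat by blast
qed

end
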